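(* For each $n$ let $K_n$ be the complete graph on $n$ vertices with independent edge costs $\xi_{K_n}(e)$, each exponentially distributed with mean $1$. For $k\ge 0$ let $\pi_{K_n}^{k}$ be the decision of the belief propagation algorithm on $K_n$ after $k$ iterations, and $\mathcal{C}(\pi_{K_n}^{k})$ the corresponding edge cover. Then $$\lim_{k\to\infty}\lim_{n\to\infty}\mathrm{E}\Bigl[\sum_{e\in\mathcal{C}(\pi_{K_n}^{k})}\xi_{K_n}(e)\Bigr]=W(1)+\frac{W(1)^2}{2}.$$
   Context: $W$ is Lambert's $W$-function on $[0,\infty)$, the inverse of $x\mapsto xe^x$; $W(1)e^{W(1)}=1$. Write $x^+=\max\{x,0\}$ and $u\sim v$ for adjacency. Belief propagation (BP) on a graph $G=(V,E)$ with edge costs $\xi_G(v,w)=\xi_G(w,v)=\xi_G(\{v,w\})$: for each ordered pair of adjacent vertices $(w,v)$ there is a message $X_G^k(w,v)$ (sent by $v$ to $w$), defined by $X_G^0(w,v)=0$ and $$X_G^{k+1}(w,v)=\min_{u\sim v,\,u\ne w}\bigl(\xi_G(v,u)-X_G^k(v,u)\bigr)^+,\quad k\ge0.$$ The decision at vertex $v$ after $k$ iterations is the set of neighbors $$\pi_G^k(v)=\operatorname{arg\,min}_{u\sim v}\bigl(\xi_G(v,u)-X_G^k(v,u)\bigr)^+$$ (the set of all minimizers). The associated edge cover is $\mathcal{C}(\pi_G^k)=\bigcup_{v\in V}\{\{v,w\}:w\in\pi_G^k(v)\}$. An edge cover is a set of edges such that every vertex is an endpoint of at least one of them. *)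

theory Defs
  imports "HOL-Probability.Probability"
begin

text \<open>
  A graph is given by its vertex set and its set of edges, each edge being a two-element set
  of vertices; edge costs are functions on edges, hence symmetric in the endpoints.
\<close>

definition complete_graph_edges :: "nat \<Rightarrow> nat set set" where
  "complete_graph_edges n = {e. e \<subseteq> {..<n} \<and> card e = 2}"

definition neighbors :: "'v set set \<Rightarrow> 'v \<Rightarrow> 'v set" where
  "neighbors E v = {u. {v, u} \<in> E}"

text \<open>
  \<open>bp_message E \<xi> k w v\<close> is the message sent by \<open>v\<close> to \<open>w\<close> (receiver first).  The minimum is
  meaningful at vertices of finite degree at least 2; for the complete graph on \<open>n\<close> vertices
  this holds whenever \<open>n \<ge> 3\<close>.
\<close>

primrec bp_message :: "'v set set \<Rightarrow> ('v set \<Rightarrow> real) \<Rightarrow> nat \<Rightarrow> 'v \<Rightarrow> 'v \<Rightarrow> real" where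
  "bp_message E \<xi> 0 = (\<lambda>w v. 0)"
| "bp_message E \<xi> (Suc k) =
     (\<lambda>w v. Min ((\<lambda>u. max (\<xi> {v, u} - bp_message E \<xi> k v u) 0) ` (neighbors E v - {w})))"

definition bp_decision :: "'v set set \<Rightarrow> ('v set \<Rightarrow> real) \<Rightarrow> nat \<Rightarrow> 'v \<Rightarrow> 'v set" where
  "bp_decision E \<xi> k v =
     {w. is_arg_min (\<lambda>u. max (\<xi> {v, u} - bp_message E \<xi> k v u) 0) (\<lambda>u. u \<in> neighbors E v) w}"

definition decision_cover :: "'v set \<Rightarrow> ('v \<Rightarrow> 'v set) \<Rightarrow> 'v set set" where
  "decision_cover V \<pi> = (\<Union>v\<in>V. {{v, w} |w. w \<in> \<pi> v})"

definition Lambert_W :: "real \<Rightarrow> real" where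
  "Lambert_W = the_inv_into {0..} (\<lambda>x. x * exp x)"

end

theory Submission
  imports Defs "HOL-Real_Asymp.Real_Asymp"
begin

text \<open>
  Send messages along self-avoiding walks only. Given the costs inside the remaining vertex set
  \<open>V\<close>, the message out of a new vertex is the minimum over \<open>t \<in> V\<close> of \<open>(\<zeta> t - a t)\<^sup>+\<close> with fresh
  exponential \<open>\<zeta> t\<close>, so it exceeds \<open>x \<ge> 0\<close> with probability exactly \<open>exp (- (\<Sum>t\<in>V. x + a t))\<close>.
  Hence changing the incoming messages changes the outgoing one, in mean, by at most the average
  change, and deleting one vertex of \<open>n\<close> changes a message by \<open>O(1/n\<^sup>2)\<close> in mean. Messages at
  different vertices are therefore asymptotically independent, sums of them concentrate, and
  their limiting means satisfy \<open>m\<^sub>0 = 0\<close>, \<open>m\<^sub>k\<^sub>+\<^sub>1 = exp (- m\<^sub>k)\<close>, so that \<open>m\<^sub>k \<longlongrightarrow> W(1)\<close>.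

  An edge is covered iff its cost is at most \<open>max (A\<^sub>k + B\<^sub>k\<^sub>+\<^sub>1) (A\<^sub>k\<^sub>+\<^sub>1 + B\<^sub>k)\<close>, where \<open>A\<close> and
  \<open>B\<close> are the messages out of its endpoints; so the expected cost tends to a quarter of
  the limit of the mean square of \<open>n\<close> times this maximum. Since \<open>A\<^sub>k\<close> is monotone in \<open>k\<close> up to
  alternation, \<open>(A\<^sub>k\<^sub>+\<^sub>1 - A\<^sub>k)\<^sup>2 \<le> \<bar>A\<^sub>k\<^sub>+\<^sub>1\<^sup>2 - A\<^sub>k\<^sup>2\<bar>\<close>, which vanishes in mean as \<open>k\<close> grows, and the
  limit of \<open>(A\<^sub>k + B\<^sub>k)\<^sup>2\<close> is \<open>4 W(1) + 2 W(1)\<^sup>2\<close>. Finally, the actual messages on the complete graph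
  agree with the self-avoiding ones unless edges of cost of order \<open>(ln n)\<^sup>2 / n\<close> close a short cycle.
\<close>

subsection \<open>Independent exponential costs\<close>

text \<open>Three obstacles shape the proof. Consecutive messages out of one vertex use the same
  costs, so their joint law must be carried along; it closes up, since the joint tail at step k+1 is
  the exponential of minus a sum over V of a function of the messages at steps k and k+1. Each
  recursion step deletes a vertex, so limits must be uniform over sets missing boundedly many
  vertices while the scale n stays fixed. And the inner limit must exist for every k although it is
  not computed: it comes from completeness, via bounded approximations, and only the means m_k are
  identified. The quarter is about n^2/2 edges times theta^2/2 for a threshold theta of order 1/n.
  Given the inner costs, a scaled message is 0 or, with probability p, exponential of mean about 1,
  so two independent ones satisfy E (A+B)^2 = 4p + 2p^2, and p tends to W(1). The cutoff M = (ln
  n)^2/n makes exp (-n M) smaller than every power of n, while n M, the order of the number of short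
  edges at a vertex, stays polylogarithmic.\<close>

abbreviation expo :: "real measure" where
  "expo \<equiv> density lborel (exponential_density 1)"

text \<open>The index type is left open: costs of the whole graph are indexed by edges, the fresh
  costs at one new vertex by the far endpoint.\<close>

definition iid :: "('i \<Rightarrow> real) measure" where
  "iid = PiM UNIV (\<lambda>_. expo)"

lemma prob_space_expo: "prob_space expo"
  by (rule prob_space_exponential_density) simp

lemma emeasure_expo_greaterThan: "emeasure expo {c<..} = ennreal (exp (- max 0 c))"
proof -
  interpret prob_space expo by (rule prob_space_expo)
  have D: "distributed expo lborel (\<lambda>x. x) (exponential_density 1)"
    by (simp add: distributed_def distr_id2 del: measurable_lborel1)
  have *: "prob {x \<in> space expo. a < x} = exp (- a)" if "0 \<le> a" for a
    using exponential_distributedD_gt[OF D that] by simp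
  have "prob {c<..} = exp (- max 0 c)"
  proof (cases "0 \<le> c")
    case True
    then show ?thesis using *[of c] by (simp add: greaterThan_def max_def)
  next
    case False
    have "prob {0<..} \<le> prob {c<..}"
      using False by (intro finite_measure_mono) auto
    then have "prob {c<..} = 1"
      using *[of 0] prob_le_1[of "{c<..}"] by (simp add: greaterThan_def order_antisym)
    then show ?thesis using False by simp
  qed
  then show ?thesis by (simp add: emeasure_eq_measure)
qed

interpretation iid_factors: product_prob_space "\<lambda>_. expo" "UNIV :: 'i set"
  by (simp add: product_prob_spaceI prob_space_expo)

interpretation iid: prob_space "iid :: ('i \<Rightarrow> real) measure"
  unfolding iid_def by (rule prob_space_PiM) (rule prob_space_expo)

lemma space_iid [simp]: "space iid = UNIV"
  by (simp add: iid_def space_PiM)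

lemma sets_iid [measurable_cong]: "sets iid = sets (PiM UNIV (\<lambda>_. borel))"
  unfolding iid_def by (intro sets_PiM_cong) simp_all

lemma measurable_iid_component [measurable]: "(\<lambda>\<zeta>. \<zeta> i) \<in> borel_measurable iid"
  by measurable

lemma sets_iid_cylinder:
  assumes "finite J" "\<And>j. j \<in> J \<Longrightarrow> F j \<in> sets borel"
  shows "{\<omega>. \<forall>j\<in>J. \<omega> j \<in> F j} \<in> sets iid"
proof -
  have "{\<omega> \<in> space iid. \<forall>j\<in>J. \<omega> j \<in> F j} \<in> sets iid"
  proof (rule sets.sets_Collect_finite_All[OF _ assms(1)])
    fix j assume "j \<in> J"
    then show "{\<omega> \<in> space iid. \<omega> j \<in> F j} \<in> sets iid"
      using measurable_sets[OF measurable_iid_component assms(2), of j j] by (simp add: vimage_def)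
  qed
  then show ?thesis by simp
qed

lemma emeasure_iid_cylinder:
  assumes "finite J" "\<And>j. j \<in> J \<Longrightarrow> F j \<in> sets borel"
  shows "emeasure iid {\<omega>. \<forall>j\<in>J. \<omega> j \<in> F j} = (\<Prod>j\<in>J. emeasure expo (F j))"
  using iid_factors.emeasure_PiM_Collect[of J F] assms by (simp add: iid_def space_PiM)

lemma measure_iid_greater:
  assumes "finite J"
  shows "measure iid {\<zeta>. \<forall>j\<in>J. c j < \<zeta> j} = exp (- (\<Sum>j\<in>J. max 0 (c j)))"
proof -
  have "emeasure iid {\<zeta>. \<forall>j\<in>J. c j < \<zeta> j} = (\<Prod>j\<in>J. emeasure expo {c j<..})"
    using iid_factors.emeasure_PiM_Collect[of J "\<lambda>j. {c j<..}"] assms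
    by (simp add: iid_def space_PiM)
  also have "\<dots> = ennreal (\<Prod>j\<in>J. exp (- max 0 (c j)))"
    by (simp only: emeasure_expo_greaterThan) (simp add: prod_ennreal)
  also have "(\<Prod>j\<in>J. exp (- max 0 (c j))) = exp (- (\<Sum>j\<in>J. max 0 (c j)))"
    by (simp add: exp_sum assms sum_negf flip: sum_negf)
  finally show ?thesis by (simp add: iid.emeasure_eq_measure)
qed

section \<open>Resampling the costs at one vertex\<close>

text \<open>For \<open>v \<notin> V\<close>, the set \<open>{v, t} - {v}\<close> is the singleton of
  the far endpoint, which is how \<open>\<zeta>\<close>, indexed by vertices, is read off at an
  edge.\<close>

definition star_upd :: "nat \<Rightarrow> nat set \<Rightarrow> (nat \<Rightarrow> real) \<Rightarrow> (nat set \<Rightarrow> real) \<Rightarrow> nat set \<Rightarrow> real" where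
  "star_upd v V \<zeta> \<omega> = (\<lambda>e. if \<exists>t\<in>V. e = {v, t} then \<zeta> (the_elem (e - {v})) else \<omega> e)"

lemma star_upd_edge [simp]: "v \<notin> V \<Longrightarrow> t \<in> V \<Longrightarrow> star_upd v V \<zeta> \<omega> {v, t} = \<zeta> t"
proof -
  assume "v \<notin> V" "t \<in> V"
  then have "{v, t} - {v} = {t}" by auto
  then show ?thesis using \<open>t \<in> V\<close> by (auto simp: star_upd_def)
qed

lemma star_upd_other: "v \<notin> e \<or> \<not> e \<subseteq> insert v V \<Longrightarrow> star_upd v V \<zeta> \<omega> e = \<omega> e"
  by (auto simp: star_upd_def)

lemma measurable_star_upd [measurable]:
  "(\<lambda>(\<omega>, \<zeta>). star_upd v V \<zeta> \<omega>) \<in> measurable (iid \<Otimes>\<^sub>M iid) iid"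
proof -
  have "(\<lambda>x. star_upd v V (snd x) (fst x) e) \<in> borel_measurable (iid \<Otimes>\<^sub>M iid)" for e
    unfolding star_upd_def by (cases "\<exists>t\<in>V. e = {v, t}") simp_all
  then have "(\<lambda>x e. star_upd v V (snd x) (fst x) e) \<in> measurable (iid \<Otimes>\<^sub>M iid) (PiM UNIV (\<lambda>_. borel))"
    by (intro measurable_PiM_single') auto
  then show ?thesis by (simp add: case_prod_beta' measurable_cong_sets[OF refl sets_iid])
qed

text \<open>Conditions on edges from v to V constrain only \<open>\<zeta>\<close>, all other
  conditions only \<open>\<omega>\<close>; the preimage of a cylinder is therefore a rectangle, and
  its measure factors into the required product.\<close>

lemma distr_star_upd:
  assumes "v \<notin> V"
  shows "distr (iid \<Otimes>\<^sub>M iid) iid (\<lambda>(\<omega>, \<zeta>). star_upd v V \<zeta> \<omega>) = iid"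
proof -
  let ?D = "distr (iid \<Otimes>\<^sub>M iid) iid (\<lambda>(\<omega>, \<zeta>). star_upd v V \<zeta> \<omega>)"
  let ?S = "{e. \<exists>t\<in>V. e = {v, t}}" 
  have "?D = PiM UNIV (\<lambda>_. expo)"
  proof (rule iid_factors.PiM_eq)
    show "sets ?D = sets (PiM UNIV (\<lambda>_. expo))" by (simp add: iid_def)
    fix J :: "nat set set" and F assume J: "finite J" "J \<subseteq> UNIV" and F: "\<And>j. j \<in> J \<Longrightarrow> F j \<in> sets expo"
    define J1 where "J1 = J \<inter> ?S"
    define J2 where "J2 = J - ?S"
    define g where "g e = the_elem (e - {v})" for e
    have g: "g {v, t} = t" if "t \<in> V" for t
    proof -
      have "{v, t} - {v} = {t}" using that assms by auto
      then show ?thesis by (simp add: g_def)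
    qed
    have inj: "inj_on g J1" by (auto simp: inj_on_def J1_def g)
    define F' where "F' t = F {v, t}" for t
    have F'g: "F' (g e) = F e" if "e \<in> J1" for e using that by (auto simp: J1_def F'_def g)
    have fin: "finite J1" "finite J2" using J by (auto simp: J1_def J2_def)
    have emb: "prod_emb UNIV (\<lambda>_. expo) J (Pi\<^sub>E J F) = {\<omega>. \<forall>j\<in>J. \<omega> j \<in> F j}"
      by (auto simp: prod_emb_def space_PiM PiE_iff)
    have meas: "{\<omega>. \<forall>j\<in>J. \<omega> j \<in> F j} \<in> sets iid"
      using J(1) F by (intro sets_iid_cylinder) auto
    define A where "A = {\<omega>::nat set \<Rightarrow> real. \<forall>j\<in>J2. \<omega> j \<in> F j}"
    define B where "B = {\<zeta>. \<forall>j\<in>g ` J1. \<zeta> j \<in> F' j}"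
    have F': "F' j \<in> sets borel" if "j \<in> g ` J1" for j
      using that F by (auto simp: J1_def g F'_def)
    have mA: "A \<in> sets iid"
      unfolding A_def using fin(2) F by (intro sets_iid_cylinder) (auto simp: J2_def)
    have mB: "B \<in> sets iid"
      unfolding B_def using fin(1) F' by (intro sets_iid_cylinder) auto
    have "emeasure ?D (prod_emb UNIV (\<lambda>_. expo) J (Pi\<^sub>E J F)) =
        emeasure (iid \<Otimes>\<^sub>M iid) ((\<lambda>(\<omega>, \<zeta>). star_upd v V \<zeta> \<omega>) -` {\<omega>. \<forall>j\<in>J. \<omega> j \<in> F j} \<inter> space (iid \<Otimes>\<^sub>M iid))"
      unfolding emb by (subst emeasure_distr) (use meas in \<open>auto\<close>)
    also have "(\<lambda>(\<omega>, \<zeta>). star_upd v V \<zeta> \<omega>) -` {\<omega>. \<forall>j\<in>J. \<omega> j \<in> F j} \<inter> space (iid \<Otimes>\<^sub>M iid) = A \<times> B"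
    proof -
      have "(\<forall>j\<in>J. star_upd v V \<zeta> \<omega> j \<in> F j) \<longleftrightarrow> (\<forall>j\<in>J2. \<omega> j \<in> F j) \<and> (\<forall>j\<in>g`J1. \<zeta> j \<in> F' j)" for \<omega> \<zeta>
      proof -
        have "J = J1 \<union> J2" by (auto simp: J1_def J2_def)
        moreover have "star_upd v V \<zeta> \<omega> j = \<omega> j" if "j \<in> J2" for j
          using that by (auto simp: star_upd_def J2_def)
        moreover have "star_upd v V \<zeta> \<omega> j = \<zeta> (g j)" if "j \<in> J1" for j
          using that by (auto simp: star_upd_def J1_def g_def)
        ultimately show ?thesis unfolding \<open>J = J1 \<union> J2\<close> ball_Un by (simp add: F'g) blast
      qed
      then show ?thesis by (simp add: set_eq_iff split_beta A_def B_def space_pair_measure)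
    qed
    also have "emeasure (iid \<Otimes>\<^sub>M iid) (A \<times> B) = emeasure iid A * emeasure iid B"
      using mA mB by (intro iid.emeasure_pair_measure_Times)
    also have "emeasure iid A = (\<Prod>j\<in>J2. emeasure expo (F j))"
      unfolding A_def using fin(2) F by (intro emeasure_iid_cylinder) (auto simp: J2_def)
    also have "emeasure iid B = (\<Prod>j\<in>g`J1. emeasure expo (F' j))"
      unfolding B_def using fin(1) F' by (intro emeasure_iid_cylinder) auto
    also have "\<dots> = (\<Prod>j\<in>J1. emeasure expo (F j))"
      by (subst prod.reindex[OF inj]) (auto simp: F'g intro!: prod.cong)
    also have "(\<Prod>j\<in>J2. emeasure expo (F j)) * (\<Prod>j\<in>J1. emeasure expo (F j)) = (\<Prod>j\<in>J. emeasure expo (F j))"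
      using fin by (subst prod.union_disjoint[symmetric]) (auto simp: J1_def J2_def intro!: prod.cong)
    finally show "emeasure ?D (prod_emb UNIV (\<lambda>_. expo) J (Pi\<^sub>E J F)) = (\<Prod>j\<in>J. emeasure expo (F j))" .
  qed
  then show ?thesis by (simp add: iid_def)
qed

interpretation iid_pair: pair_prob_space "iid :: ('i \<Rightarrow> real) measure" "iid :: ('j \<Rightarrow> real) measure" ..

text \<open>Takes the place of conditional expectation: a functional of the costs is averaged over
  the star at v first, with all other costs frozen. Every use of independence between a vertex and
  the rest of the graph goes through it or its single-edge case.\<close>

lemma integrable_resample:
  fixes f :: "(nat set \<Rightarrow> real) \<Rightarrow> real"
  assumes "v \<notin> V" "integrable iid f"
  shows "integrable (iid \<Otimes>\<^sub>M iid) (\<lambda>(\<omega>, \<zeta>). f (star_upd v V \<zeta> \<omega>))"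
    and "integrable iid (\<lambda>\<omega>. \<integral>\<zeta>. f (star_upd v V \<zeta> \<omega>) \<partial>iid)"
    and "(\<integral>\<omega>. f \<omega> \<partial>iid) = (\<integral>\<omega>. (\<integral>\<zeta>. f (star_upd v V \<zeta> \<omega>) \<partial>iid) \<partial>iid)"
proof -
  have i: "integrable (distr (iid \<Otimes>\<^sub>M iid) iid (\<lambda>(\<omega>, \<zeta>). star_upd v V \<zeta> \<omega>)) f"
    using assms by (simp add: distr_star_upd)
  show i': "integrable (iid \<Otimes>\<^sub>M iid) (\<lambda>(\<omega>, \<zeta>). f (star_upd v V \<zeta> \<omega>))"
    using integrable_distr[OF measurable_star_upd i] by (simp add: case_prod_beta')
  show "integrable iid (\<lambda>\<omega>. \<integral>\<zeta>. f (star_upd v V \<zeta> \<omega>) \<partial>iid)"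
    using iid_pair.integrable_fst'[OF i'] by simp
  have "(\<integral>\<omega>. f \<omega> \<partial>iid) = integral\<^sup>L (distr (iid \<Otimes>\<^sub>M iid) iid (\<lambda>(\<omega>, \<zeta>). star_upd v V \<zeta> \<omega>)) f"
    using assms by (simp add: distr_star_upd)
  also have "\<dots> = (\<integral>x. f (case x of (\<omega>, \<zeta>) \<Rightarrow> star_upd v V \<zeta> \<omega>) \<partial>(iid \<Otimes>\<^sub>M iid))"
    using assms by (intro integral_distr measurable_star_upd) auto
  also have "\<dots> = (\<integral>\<omega>. (\<integral>\<zeta>. f (star_upd v V \<zeta> \<omega>) \<partial>iid) \<partial>iid)"
    using iid_pair.integral_fst'[OF i'] by (simp add: case_prod_beta')
  finally show "(\<integral>\<omega>. f \<omega> \<partial>iid) = (\<integral>\<omega>. (\<integral>\<zeta>. f (star_upd v V \<zeta> \<omega>) \<partial>iid) \<partial>iid)" .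
qed

section \<open>Moments from exponential tails\<close>

text \<open>Layer-cake formula: T^p is the integral of p x^(p-1) over [0, T], and Fubini brings in
  the tail. The factor c leaves room for an atom of mass 1 - c at 0, which messages have.\<close>

lemma (in prob_space) moment_of_exp_tail:
  fixes T :: "'a \<Rightarrow> real" and p :: nat
  assumes [measurable]: "T \<in> borel_measurable M" and nonneg: "\<And>\<omega>. 0 \<le> T \<omega>"
    and tail: "\<And>x. 0 \<le> x \<Longrightarrow> prob {\<omega>\<in>space M. x < T \<omega>} = c * exp (- N * x)" and "0 \<le> c" "0 < N" "0 < p"
  shows "integrable M (\<lambda>\<omega>. T \<omega> ^ p)" "expectation (\<lambda>\<omega>. T \<omega> ^ p) = c * fact p / N ^ p"
proof -
  interpret pair_sigma_finite M lborel ..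
  define d where "d x = real p * x ^ (p - 1)" for x :: real
  have [measurable]: "d \<in> borel_measurable borel" unfolding d_def by measurable
  have "ennreal (T \<omega> ^ p) = (\<integral>\<^sup>+x. ennreal (d x) * indicator {0..T \<omega>} x \<partial>lborel)" for \<omega>
  proof -
    have "(\<integral>\<^sup>+x. ennreal (d x) * indicator {0..T \<omega>} x \<partial>lborel) = ennreal (T \<omega> ^ p - 0 ^ p)"
      by (rule nn_integral_FTC_Icc) (use nonneg in \<open>auto simp: d_def intro!: derivative_eq_intros mult_nonneg_nonneg\<close>)
    then show ?thesis using \<open>0 < p\<close> by (simp add: zero_power)
  qed
  \<comment> \<open>The closed interval and the strict inequality \<open>x < T \<omega>\<close>
    differ only at the single point \<open>x = T \<omega>\<close>.\<close>
  also have "(\<integral>\<^sup>+x. ennreal (d x) * indicator {0..T \<omega>} x \<partial>lborel) =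
      (\<integral>\<^sup>+x. ennreal (d x) * (indicator {0..} x * indicator {x<..} (T \<omega>)) \<partial>lborel)" for \<omega>
    by (rule nn_integral_cong_AE, rule AE_mp[OF AE_lborel_singleton[of "T \<omega>"]])
       (auto simp: indicator_def)
  finally have "(\<integral>\<^sup>+\<omega>. ennreal (T \<omega> ^ p) \<partial>M) =
     (\<integral>\<^sup>+\<omega>. (\<integral>\<^sup>+x. ennreal (d x) * (indicator {0..} x * indicator {x<..} (T \<omega>)) \<partial>lborel) \<partial>M)"
    by simp
  also have "\<dots> = (\<integral>\<^sup>+x. (\<integral>\<^sup>+\<omega>. ennreal (d x) * (indicator {0..} x * indicator {x<..} (T \<omega>)) \<partial>M) \<partial>lborel)"
  proof (rule Fubini'[symmetric])
    have "(\<lambda>(\<omega>, x). ennreal (d x) * (indicator {0..} x * (if x < T \<omega> then 1 else 0))) \<in> borel_measurable (M \<Otimes>\<^sub>M lborel)"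
      by measurable
    then show "(\<lambda>(\<omega>, x). ennreal (d x) * (indicator {0..} x * indicator {x<..} (T \<omega>))) \<in> borel_measurable (M \<Otimes>\<^sub>M lborel)"
      by (simp add: indicator_def of_bool_def)
  qed
  \<comment> \<open>On the half line the tail is c/N times the exponential density of rate N, so an
    Erlang moment remains.\<close>
  also have "\<dots> = (\<integral>\<^sup>+x. ennreal (c * p / N) * ennreal (erlang_density 0 N x * x ^ (p - 1)) \<partial>lborel)"
  proof (rule nn_integral_cong)
    fix x :: real
    have "(\<integral>\<^sup>+\<omega>. ennreal (d x) * (indicator {0..} x * indicator {x<..} (T \<omega>)) \<partial>M) =
      ennreal (d x) * indicator {0..} x * (\<integral>\<^sup>+\<omega>. indicator {\<omega>\<in>space M. x < T \<omega>} \<omega> \<partial>M)"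
      unfolding mult.assoc[symmetric]
      by (subst nn_integral_cmult[symmetric]) (auto intro!: nn_integral_cong simp: indicator_def)
    also have "(\<integral>\<^sup>+\<omega>. indicator {\<omega>\<in>space M. x < T \<omega>} \<omega> \<partial>M) = ennreal (prob {\<omega>\<in>space M. x < T \<omega>})"
      by (subst nn_integral_indicator) (auto simp: emeasure_eq_measure)
    also have "ennreal (d x) * indicator {0..} x * ennreal (prob {\<omega>\<in>space M. x < T \<omega>}) =
      ennreal (c * p / N) * ennreal (erlang_density 0 N x * x ^ (p - 1))"
      using \<open>0 \<le> c\<close> \<open>0 < N\<close> 
      by (cases "x \<ge> 0") (auto simp: tail d_def erlang_density_def field_simps simp flip: ennreal_mult)
    finally show "(\<integral>\<^sup>+\<omega>. ennreal (d x) * (indicator {0..} x * indicator {x<..} (T \<omega>)) \<partial>M) =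
       ennreal (c * p / N) * ennreal (erlang_density 0 N x * x ^ (p - 1))" .
  qed
  also have "\<dots> = ennreal (c * p / N) * ennreal (fact (p - 1) / N ^ (p - 1))"
    using \<open>0 < N\<close> nn_integral_erlang_ith_moment[of N 0 "p - 1"]
    by (subst nn_integral_cmult) (auto)
  also have "\<dots> = ennreal (c * fact p / N ^ p)"
    using \<open>0 \<le> c\<close> \<open>0 < N\<close> \<open>0 < p\<close> 
    by (cases p) (auto simp: field_simps simp flip: ennreal_mult)
  finally have *: "(\<integral>\<^sup>+\<omega>. ennreal (T \<omega> ^ p) \<partial>M) = ennreal (c * fact p / N ^ p)" .
  have **: "has_bochner_integral M (\<lambda>\<omega>. T \<omega> ^ p) (c * fact p / N ^ p)"
    using * \<open>0 \<le> c\<close> \<open>0 < N\<close> nonneg by (intro has_bochner_integral_nn_integral) auto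
  then show "integrable M (\<lambda>\<omega>. T \<omega> ^ p)" "expectation (\<lambda>\<omega>. T \<omega> ^ p) = c * fact p / N ^ p"
    by (auto simp: has_bochner_integral_iff)
qed

subsection \<open>Minima of shifted exponential variables\<close>

text \<open>The default 0 on the empty set keeps nonnegativity and antitonicity free of a
  nonemptiness condition.\<close>

definition minmsg :: "'v set \<Rightarrow> ('v \<Rightarrow> real) \<Rightarrow> ('v \<Rightarrow> real) \<Rightarrow> real" where
  "minmsg V a \<zeta> = (if V = {} then 0 else Min ((\<lambda>t. max (\<zeta> t - a t) 0) ` V))"

lemma minmsg_nonneg [simp]: "finite V \<Longrightarrow> 0 \<le> minmsg V a \<zeta>"
  by (auto simp: minmsg_def)

text \<open>At a level x at least 0 the positive part drops out, and the event becomes an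
  intersection of conditions on single coordinates.\<close>

lemma minmsg_greater_iff:
  "finite V \<Longrightarrow> V \<noteq> {} \<Longrightarrow> 0 \<le> x \<Longrightarrow> x < minmsg V a \<zeta> \<longleftrightarrow> (\<forall>t\<in>V. x + a t < \<zeta> t)"
  by (auto simp: minmsg_def)

lemma minmsg_le: "finite V \<Longrightarrow> t \<in> V \<Longrightarrow> minmsg V a \<zeta> \<le> max (\<zeta> t - a t) 0"
  by (auto simp: minmsg_def)

lemma minmsg_ge:
  "finite V \<Longrightarrow> V \<noteq> {} \<Longrightarrow> (\<And>t. t \<in> V \<Longrightarrow> x \<le> max (\<zeta> t - a t) 0) \<Longrightarrow> x \<le> minmsg V a \<zeta>"
  by (auto simp: minmsg_def)

lemma minmsg_attained: "finite V \<Longrightarrow> V \<noteq> {} \<Longrightarrow> \<exists>t\<in>V. minmsg V a \<zeta> = max (\<zeta> t - a t) 0"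
  using Min_in[of "(\<lambda>t. max (\<zeta> t - a t) 0) ` V"] by (simp add: minmsg_def image_iff)

lemma minmsg_antimono:
  assumes "finite V" "\<And>t. t \<in> V \<Longrightarrow> a t \<le> b t"
  shows "minmsg V b \<zeta> \<le> minmsg V a \<zeta>"
proof (cases "V = {}")
  case False
  show ?thesis
  proof (rule minmsg_ge[OF assms(1) False])
    fix t assume "t \<in> V"
    then show "minmsg V b \<zeta> \<le> max (\<zeta> t - a t) 0"
      using minmsg_le[OF assms(1), of t b \<zeta>] assms(2)[of t] by linarith
  qed
qed (simp add: minmsg_def)

lemma minmsg_subset:
  assumes "finite V" "U \<subseteq> V" "U \<noteq> {}"
  shows "minmsg V a \<zeta> \<le> minmsg U a \<zeta>"
  using assms by (intro minmsg_ge minmsg_le) (auto intro: finite_subset)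

lemma minmsg_cong:
  assumes "\<And>t. t \<in> V \<Longrightarrow> a t = b t" "\<And>t. t \<in> V \<Longrightarrow> \<zeta> t = \<eta> t"
  shows "minmsg V a \<zeta> = minmsg V b \<eta>"
proof -
  have "(\<lambda>t. max (\<zeta> t - a t) 0) ` V = (\<lambda>t. max (\<eta> t - b t) 0) ` V"
    using assms by (intro image_cong) auto
  then show ?thesis by (simp add: minmsg_def)
qed

lemma measurable_minmsg [measurable]:
  assumes [measurable]: "\<And>t. t \<in> V \<Longrightarrow> (\<lambda>\<omega>. a \<omega> t) \<in> borel_measurable M"
    "\<And>t. t \<in> V \<Longrightarrow> (\<lambda>\<omega>. \<zeta> \<omega> t) \<in> borel_measurable M" and "finite V"
  shows "(\<lambda>\<omega>. minmsg V (a \<omega>) (\<zeta> \<omega>)) \<in> borel_measurable M"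
proof (cases "V = {}")
  case False
  have "(\<lambda>\<omega>. Min ((\<lambda>t. max (\<zeta> \<omega> t - a \<omega> t) 0) ` V)) \<in> borel_measurable M"
    using \<open>finite V\<close> by (intro borel_measurable_Min) auto
  then show ?thesis using False by (simp add: minmsg_def)
qed (simp add: minmsg_def)

lemma measurable_minmsg_iid [measurable]: "finite V \<Longrightarrow> minmsg V a \<in> borel_measurable iid"
  using measurable_minmsg[of V "\<lambda>_. a" iid "\<lambda>\<zeta>. \<zeta>"] by simp

text \<open>Two minima over the same costs \<open>\<zeta>\<close> exceed their levels iff each
  \<open>\<zeta> t\<close> exceeds the larger of two thresholds, so the joint tail is still a single
  exponential. A negative level is no condition at all, since messages are nonnegative; it is
  encoded as threshold 0, which an exponential cost exceeds almost surely.\<close>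

lemma measure_minmsg_greater2:
  assumes "finite V" "V \<noteq> {}" "\<And>t. t \<in> V \<Longrightarrow> 0 \<le> a t" "\<And>t. t \<in> V \<Longrightarrow> 0 \<le> b t"
  shows "measure iid {\<zeta>. x < minmsg V a \<zeta> \<and> y < minmsg V b \<zeta>} =
    exp (- (\<Sum>t\<in>V. max (if x < 0 then 0 else x + a t) (if y < 0 then 0 else y + b t)))"
proof -
  let ?c = "\<lambda>t. max (if x < 0 then 0 else x + a t) (if y < 0 then 0 else y + b t)"
  have neg: "z < minmsg V c \<zeta>" if "z < 0" for z c \<zeta>
    using minmsg_nonneg[OF assms(1), of c \<zeta>] that by linarith
  show ?thesis
  proof (cases "x < 0 \<and> y < 0")
    case True
    then have "{\<zeta>. x < minmsg V a \<zeta> \<and> y < minmsg V b \<zeta>} = UNIV" by (auto intro: neg)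
    then show ?thesis using True iid.prob_space by simp
  next
    case False
    have "{\<zeta>. x < minmsg V a \<zeta> \<and> y < minmsg V b \<zeta>} = {\<zeta>. \<forall>t\<in>V. ?c t < \<zeta> t}"
    proof -
      have "x < minmsg V a \<zeta> \<and> y < minmsg V b \<zeta> \<longleftrightarrow> (\<forall>t\<in>V. ?c t < \<zeta> t)" for \<zeta>
      proof (cases "x < 0"; cases "y < 0")
        assume "x < 0" "\<not> y < 0"
        moreover from this have "(\<forall>t\<in>V. ?c t < \<zeta> t) \<longleftrightarrow> (\<forall>t\<in>V. y + b t < \<zeta> t)"
          using assms(4) by (intro ball_cong refl) simp
        ultimately show ?thesis using minmsg_greater_iff[OF assms(1,2), of y b \<zeta>] neg[of x a \<zeta>] by simp
      next
        assume "\<not> x < 0" "y < 0"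
        moreover from this have "(\<forall>t\<in>V. ?c t < \<zeta> t) \<longleftrightarrow> (\<forall>t\<in>V. x + a t < \<zeta> t)"
          using assms(3) by (intro ball_cong refl) simp
        ultimately show ?thesis using minmsg_greater_iff[OF assms(1,2), of x a \<zeta>] neg[of y b \<zeta>] by simp
      next
        assume "\<not> x < 0" "\<not> y < 0"
        then show ?thesis using minmsg_greater_iff[OF assms(1,2), of x a \<zeta>] minmsg_greater_iff[OF assms(1,2), of y b \<zeta>]
          by auto
      qed (use False in auto)
      then show ?thesis by auto
    qed
    moreover have "max 0 (?c t) = ?c t" if "t \<in> V" for t
      using assms(3,4)[OF that] by auto
    then have "(\<Sum>t\<in>V. max 0 (?c t)) = (\<Sum>t\<in>V. ?c t)" by (rule sum.cong[OF refl])
    ultimately show ?thesis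
      by (simp only: measure_iid_greater[OF assms(1)])
  qed
qed

lemma measure_minmsg_greater:
  assumes "finite V" "V \<noteq> {}" "\<And>t. t \<in> V \<Longrightarrow> 0 \<le> a t" "0 \<le> x"
  shows "measure iid {\<zeta>. x < minmsg V a \<zeta>} = exp (- (\<Sum>t\<in>V. a t)) * exp (- (real (card V) * x))"
proof -
  have "measure iid {\<zeta>. x < minmsg V a \<zeta>} = exp (- (\<Sum>t\<in>V. x + a t))"
    using measure_minmsg_greater2[of V a a x x] assms by simp
  then show ?thesis by (simp add: sum.distrib flip: exp_add)
qed

text \<open>The tail formula says that the minimum is 0 except with probability
  \<open>exp (- (\<Sum>t\<in>V. a t))\<close>, and is then exponential of rate
  \<open>card V\<close>.\<close>

lemma minmsg_moment:
  assumes "finite V" "V \<noteq> {}" "\<And>t. t \<in> V \<Longrightarrow> 0 \<le> a t" "0 < p"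
  shows "integrable iid (\<lambda>\<zeta>. minmsg V a \<zeta> ^ p)"
    and "(\<integral>\<zeta>. minmsg V a \<zeta> ^ p \<partial>iid) = exp (- (\<Sum>t\<in>V. a t)) * fact p / real (card V) ^ p"
  using iid.moment_of_exp_tail[where T = "minmsg V a" and c = "exp (- (\<Sum>t\<in>V. a t))" and N = "real (card V)" and p = p]
    measure_minmsg_greater[OF assms(1-3)] assms by (auto simp: card_gt_0_iff)

lemma minmsg_integrable:
  assumes "finite V" "V \<noteq> {}" "\<And>t. t \<in> V \<Longrightarrow> 0 \<le> a t"
  shows "integrable iid (minmsg V a)"
  using minmsg_moment(1)[OF assms, where p = 1] by simp

lemma minmsg_expectation:
  assumes "finite V" "V \<noteq> {}" "\<And>t. t \<in> V \<Longrightarrow> 0 \<le> a t"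
  shows "(\<integral>\<zeta>. minmsg V a \<zeta> \<partial>iid) = exp (- (\<Sum>t\<in>V. a t)) / card V"
  using minmsg_moment(2)[OF assms, where p = 1] by simp

lemma exp_minus_diff_le:
  fixes x y :: real
  assumes "0 \<le> x" "x \<le> y"
  shows "exp (- x) - exp (- y) \<le> y - x"
proof -
  have "exp (- x) - exp (- y) = exp (- x) * (1 - exp (x - y))"
    by (simp add: right_diff_distrib flip: exp_add)
  also have "\<dots> \<le> 1 * (1 - exp (x - y))"
    using \<open>0 \<le> x\<close> \<open>x \<le> y\<close> by (intro mult_right_mono) auto
  also have "\<dots> \<le> y - x" using exp_ge_add_one_self[of "x - y"] by (simp only: mult_1)
  finally show ?thesis .
qed

text \<open>Both minima lie between those for the pointwise maximum and the pointwise minimum of a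
  and b. By monotonicity the mean distance is at most a difference of two explicit means, and exp
  (-x) is 1-Lipschitz on the half line.\<close>

lemma minmsg_L1:
  assumes "finite V" "V \<noteq> {}" "\<And>t. t \<in> V \<Longrightarrow> 0 \<le> a t" "\<And>t. t \<in> V \<Longrightarrow> 0 \<le> b t"
  shows "(\<integral>\<zeta>. \<bar>minmsg V a \<zeta> - minmsg V b \<zeta>\<bar> \<partial>iid) \<le> (\<Sum>t\<in>V. \<bar>a t - b t\<bar>) / card V"
proof -
  define lo where "lo t = min (a t) (b t)" for t
  define hi where "hi t = max (a t) (b t)" for t
  have nn: "\<And>t. t \<in> V \<Longrightarrow> 0 \<le> lo t" "\<And>t. t \<in> V \<Longrightarrow> 0 \<le> hi t"
    using assms(3,4) by (fastforce simp: lo_def hi_def)+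
  note int = minmsg_integrable[OF assms(1,2,3)] minmsg_integrable[OF assms(1,2,4)] 
    minmsg_integrable[OF assms(1,2) nn(1)] minmsg_integrable[OF assms(1,2) nn(2)]
  have "(\<integral>\<zeta>. \<bar>minmsg V a \<zeta> - minmsg V b \<zeta>\<bar> \<partial>iid) \<le> (\<integral>\<zeta>. minmsg V lo \<zeta> - minmsg V hi \<zeta> \<partial>iid)"
  proof (rule integral_mono)
    fix \<zeta>
    have "minmsg V hi \<zeta> \<le> minmsg V a \<zeta>" "minmsg V a \<zeta> \<le> minmsg V lo \<zeta>"
         "minmsg V hi \<zeta> \<le> minmsg V b \<zeta>" "minmsg V b \<zeta> \<le> minmsg V lo \<zeta>"
      by (rule minmsg_antimono; use assms in \<open>simp add: lo_def hi_def\<close>)+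
    then show "\<bar>minmsg V a \<zeta> - minmsg V b \<zeta>\<bar> \<le> minmsg V lo \<zeta> - minmsg V hi \<zeta>" by linarith
  qed (use int in auto)
  also have "\<dots> = (exp (- (\<Sum>t\<in>V. lo t)) - exp (- (\<Sum>t\<in>V. hi t))) / card V"
    using int nn assms by (simp add: minmsg_expectation diff_divide_distrib)
  also have "\<dots> \<le> ((\<Sum>t\<in>V. hi t) - (\<Sum>t\<in>V. lo t)) / card V"
    by (intro divide_right_mono exp_minus_diff_le sum_nonneg sum_mono)
       (use nn in \<open>auto simp: lo_def hi_def\<close>)
  also have "(\<Sum>t\<in>V. hi t) - (\<Sum>t\<in>V. lo t) = (\<Sum>t\<in>V. \<bar>a t - b t\<bar>)"
    by (simp add: sum_subtractf[symmetric] lo_def hi_def max_def min_def abs_if)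
       (intro sum.cong; auto)
  finally show ?thesis .
qed

text \<open>Removing a candidate can only raise the minimum, so the distance is a difference of
  means. The term with \<open>a u\<close> comes from the exponent, the other from 1/N -
  1/(N+1).\<close>

lemma minmsg_remove_L1:
  assumes "finite V" "V \<noteq> {}" "u \<notin> V" "\<And>t. t \<in> insert u V \<Longrightarrow> 0 \<le> a t"
  shows "(\<integral>\<zeta>. \<bar>minmsg (insert u V) a \<zeta> - minmsg V a \<zeta>\<bar> \<partial>iid) \<le> a u / card V + 1 / (real (card V))\<^sup>2"
proof -
  define N where "N = real (card V)"
  have N: "N \<ge> 1" using assms(1,2) by (simp add: N_def Suc_le_eq card_gt_0_iff)
  define s where "s = (\<Sum>t\<in>V. a t)"
  have s: "s \<ge> 0" using assms(4) by (auto simp: s_def intro!: sum_nonneg)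
  have au: "a u \<ge> 0" using assms(4) by auto
  have int: "integrable iid (minmsg V a)" "integrable iid (minmsg (insert u V) a)"
    using assms by (auto intro!: minmsg_integrable)
  have "\<bar>minmsg (insert u V) a \<zeta> - minmsg V a \<zeta>\<bar> = minmsg V a \<zeta> - minmsg (insert u V) a \<zeta>" for \<zeta>
    using minmsg_subset[of "insert u V" V a \<zeta>] assms(1,2) by (simp add: subset_insertI)
  then have "(\<integral>\<zeta>. \<bar>minmsg (insert u V) a \<zeta> - minmsg V a \<zeta>\<bar> \<partial>iid) = exp (- s) / N - exp (- (a u + s)) / (N + 1)"
    using int assms(1,2,3) minmsg_expectation[OF assms(1,2), of a] minmsg_expectation[of "insert u V" a] assms(4)
    by (simp add: s_def N_def add.commute)
  also have "\<dots> = exp (- s) * (1 / N - exp (- a u) / (N + 1))"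
    by (simp add: right_diff_distrib flip: exp_add)
  also have "\<dots> \<le> 1 * (1 / N - exp (- a u) / (N + 1))"
  proof (rule mult_right_mono)
    have "exp (- a u) / (N + 1) \<le> 1 / N" using au N by (intro frac_le) auto
    then show "0 \<le> 1 / N - exp (- a u) / (N + 1)" by simp
  qed (use s in auto)
  also have "\<dots> \<le> 1 / N - (1 - a u) / (N + 1)"
    using exp_ge_add_one_self[of "- a u"] N by (auto intro!: divide_right_mono)
  also have "\<dots> = a u / (N + 1) + (1 / N - 1 / (N + 1))" by (simp add: diff_divide_distrib)
  also have "1 / N - 1 / (N + 1) = 1 / (N * (N + 1))"
    using N by (simp add: divide_simps)
  also have "a u / (N + 1) + 1 / (N * (N + 1)) \<le> a u / N + 1 / N\<^sup>2"
    unfolding power2_eq_square using N au by (intro add_mono divide_left_mono mult_left_mono) auto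
  finally show ?thesis by (simp add: N_def)
qed

text \<open>Belief propagation along self-avoiding walks: the recursion never returns to a visited
  vertex, so the costs at \<open>v\<close> are independent of the messages in \<open>V - {v}\<close> that enter the minimum.\<close>

primrec samsg :: "(nat set \<Rightarrow> real) \<Rightarrow> nat \<Rightarrow> nat set \<Rightarrow> nat \<Rightarrow> real" where
  "samsg \<omega> 0 = (\<lambda>V v. 0)"
| "samsg \<omega> (Suc k) = (\<lambda>V v. minmsg (V - {v}) (samsg \<omega> k (V - {v})) (\<lambda>t. \<omega> {v, t}))"

lemma samsg_nonneg [simp]: "finite V \<Longrightarrow> 0 \<le> samsg \<omega> k V v"
  by (cases k) auto

lemma measurable_samsg [measurable]:
  "finite V \<Longrightarrow> (\<lambda>\<omega>. samsg \<omega> k V v) \<in> borel_measurable iid"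
  by (induction k arbitrary: V v) (auto intro!: measurable_minmsg)

lemma samsg_cong:
  assumes "\<And>x y. x \<in> V \<Longrightarrow> y \<in> V \<Longrightarrow> x \<noteq> y \<Longrightarrow> \<omega> {x, y} = \<omega>' {x, y}" "u \<in> V"
  shows "samsg \<omega> k V u = samsg \<omega>' k V u"
  using assms
proof (induction k arbitrary: V u)
  case (Suc k)
  show ?case unfolding samsg.simps
    by (intro minmsg_cong Suc.IH) (use Suc.prems in auto)
qed simp

lemma samsg_star_other:
  "v \<notin> U \<Longrightarrow> u \<in> U \<Longrightarrow> samsg (star_upd v V \<zeta> \<omega>) k U u = samsg \<omega> k U u"
  by (intro samsg_cong star_upd_other) auto

text \<open>After resampling the star at v, the message out of v is a minimum over fresh costs whose
  offsets do not involve those costs. This is the shape to which the explicit law of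
  \<open>minmsg\<close> applies.\<close>

lemma samsg_star:
  assumes "v \<notin> V" "U \<subseteq> V"
  shows "samsg (star_upd v V \<zeta> \<omega>) (Suc k) (insert v U) v = minmsg U (samsg \<omega> k U) \<zeta>"
proof -
  have "insert v U - {v} = U" using assms by auto
  moreover have "minmsg U (samsg (star_upd v V \<zeta> \<omega>) k U) (\<lambda>t. star_upd v V \<zeta> \<omega> {v, t}) = minmsg U (samsg \<omega> k U) \<zeta>"
    using assms by (intro minmsg_cong samsg_star_other star_upd_edge) auto
  ultimately show ?thesis by simp
qed

section \<open>Moments, sensitivity and monotonicity of self-avoiding messages\<close>

text \<open>With zero offsets the minimum is as large as it can be, so these moments dominate those
  of all messages out of v, uniformly in the number of iterations.\<close>

lemma star_min_moment:
  assumes "finite U" "U \<noteq> {}" "v \<notin> U" "0 < p"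
  shows "integrable iid (\<lambda>\<omega>. minmsg U (\<lambda>_. 0) (\<lambda>t. \<omega> {v, t}) ^ p)"
    and "(\<integral>\<omega>. minmsg U (\<lambda>_. 0) (\<lambda>t. \<omega> {v, t}) ^ p \<partial>iid) = fact p / real (card U) ^ p"
proof -
  have inj: "inj_on (\<lambda>t. {v, t}) U" using assms(3) by (auto simp: inj_on_def doubleton_eq_iff)
  have tail: "measure iid {\<omega>. x < minmsg U (\<lambda>_. 0) (\<lambda>t. \<omega> {v, t})} = 1 * exp (- real (card U) * x)"
    if "0 \<le> x" for x
  proof -
    have "{\<omega>. x < minmsg U (\<lambda>_. 0) (\<lambda>t. \<omega> {v, t})} = {\<omega>. \<forall>e\<in>(\<lambda>t. {v, t}) ` U. x < \<omega> e}"
      using minmsg_greater_iff[OF assms(1,2) that, of "\<lambda>_. 0"] by auto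
    then show ?thesis
      using that assms(1) by (simp only: measure_iid_greater finite_imageI) (simp add: card_image[OF inj])
  qed
  have "(\<lambda>\<omega>. minmsg U (\<lambda>_. 0) (\<lambda>t. \<omega> {v, t})) \<in> borel_measurable iid"
    using assms(1) by (intro measurable_minmsg) auto
  note m = iid.moment_of_exp_tail[OF this, where c = 1 and N = "real (card U)" and p = p]
  show "integrable iid (\<lambda>\<omega>. minmsg U (\<lambda>_. 0) (\<lambda>t. \<omega> {v, t}) ^ p)"
    by (rule m(1)) (use tail assms in \<open>auto simp: card_gt_0_iff\<close>)
  show "(\<integral>\<omega>. minmsg U (\<lambda>_. 0) (\<lambda>t. \<omega> {v, t}) ^ p \<partial>iid) = fact p / real (card U) ^ p"
    by (subst m(2)) (use tail assms in \<open>auto simp: card_gt_0_iff\<close>)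
qed

lemma samsg_le_star_min:
  "finite V \<Longrightarrow> samsg \<omega> k V v \<le> minmsg (V - {v}) (\<lambda>_. 0) (\<lambda>t. \<omega> {v, t})"
  by (cases k) (auto intro!: minmsg_antimono)

lemma samsg_moment:
  assumes "finite V" "V - {v} \<noteq> {}" "0 < p"
  shows "integrable iid (\<lambda>\<omega>. samsg \<omega> k V v ^ p)"
    and "(\<integral>\<omega>. samsg \<omega> k V v ^ p \<partial>iid) \<le> fact p / real (card (V - {v})) ^ p"
proof -
  have m: "integrable iid (\<lambda>\<omega>. minmsg (V - {v}) (\<lambda>_. 0) (\<lambda>t. \<omega> {v, t}) ^ p)"
    "(\<integral>\<omega>. minmsg (V - {v}) (\<lambda>_. 0) (\<lambda>t. \<omega> {v, t}) ^ p \<partial>iid) = fact p / real (card (V - {v})) ^ p"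
    using assms by (intro star_min_moment; simp)+
  have le: "samsg \<omega> k V v ^ p \<le> minmsg (V - {v}) (\<lambda>_. 0) (\<lambda>t. \<omega> {v, t}) ^ p" for \<omega>
    using assms by (intro power_mono samsg_le_star_min) auto
  show i: "integrable iid (\<lambda>\<omega>. samsg \<omega> k V v ^ p)"
    by (rule Bochner_Integration.integrable_bound[OF m(1)]) (use assms le in auto)
  show "(\<integral>\<omega>. samsg \<omega> k V v ^ p \<partial>iid) \<le> fact p / real (card (V - {v})) ^ p"
    unfolding m(2)[symmetric] using i m(1) le by (rule integral_mono)
qed

lemma samsg_integrable:
  assumes "finite V" "V - {v} \<noteq> {}"
  shows "integrable iid (\<lambda>\<omega>. samsg \<omega> k V v)" "(\<integral>\<omega>. samsg \<omega> k V v \<partial>iid) \<le> 1 / card (V - {v})"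
  using samsg_moment[OF assms, where p = 1] by auto

lemma (in prob_space) expectation_affine_sum:
  fixes A :: "'a \<Rightarrow> real"
  assumes A: "integrable M A" and D: "\<And>t. t \<in> U \<Longrightarrow> integrable M (D t)"
  shows "integrable M (\<lambda>\<omega>. (A \<omega> / c + d) + (\<Sum>t\<in>U. D t \<omega>) / c)"
    and "expectation (\<lambda>\<omega>. (A \<omega> / c + d) + (\<Sum>t\<in>U. D t \<omega>) / c) =
      (expectation A / c + d) + (\<Sum>t\<in>U. expectation (D t)) / c"
proof -
  have i: "integrable M (\<lambda>\<omega>. A \<omega> / c)" "integrable M (\<lambda>\<omega>. (\<Sum>t\<in>U. D t \<omega>))"
    using A D by auto
  show "integrable M (\<lambda>\<omega>. (A \<omega> / c + d) + (\<Sum>t\<in>U. D t \<omega>) / c)"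
    using i by auto
  show "expectation (\<lambda>\<omega>. (A \<omega> / c + d) + (\<Sum>t\<in>U. D t \<omega>) / c) =
      (expectation A / c + d) + (\<Sum>t\<in>U. expectation (D t)) / c"
    using i A D by (simp add: prob_space)
qed

text \<open>Resample the star at u. Losing the candidate u' costs two terms of size
  \<open>1 / (card U)^2\<close>, the first because the message out of u' has mean at most
  \<open>1 / card U\<close>; the changed offsets cost only the average of the errors one step
  earlier. So the error grows linearly in k, and the shift by k in the denominator absorbs the
  shrinking of the vertex set.\<close>

lemma samsg_sensitivity:
  assumes "finite V" "u \<in> V" "u' \<in> V" "u \<noteq> u'" "k + 2 \<le> card V"
  shows "(\<integral>\<omega>. \<bar>samsg \<omega> k V u - samsg \<omega> k (V - {u'}) u\<bar> \<partial>iid) \<le> 2 * k / (real (card V) - 1 - k)\<^sup>2"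
  using assms
proof (induction k arbitrary: V u u')
  case (Suc k)
  define U where "U = V - {u, u'}"
  define W where "W = V - {u}"
  define N where "N = card V"
  have fin: "finite U" "finite W" using Suc.prems by (auto simp: U_def W_def)
  have card: "card W = N - 1" "card U = N - 2" "k + 3 \<le> N"
    using Suc.prems by (auto simp: U_def W_def N_def card_Diff_subset card_Diff_singleton)
  have sub: "u \<notin> W" "U \<subseteq> W" "insert u W = V" "insert u U = V - {u'}" "insert u' U = W" "u' \<notin> U" "U = W - {u'}" "u' \<in> W"
    using Suc.prems by (auto simp: U_def W_def)
  have "U \<noteq> {}" "W \<noteq> {}" using card by auto
  have Vu: "V - {u} \<noteq> {}" "V - {u'} - {u} \<noteq> {}" using \<open>U \<noteq> {}\<close> by (auto simp: U_def)
  have int: "integrable iid (\<lambda>\<omega>. \<bar>samsg \<omega> (Suc k) V u - samsg \<omega> (Suc k) (V - {u'}) u\<bar>)"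
    using Suc.prems Vu by (intro integrable_abs Bochner_Integration.integrable_diff samsg_integrable) auto
  have intU: "integrable iid (\<lambda>\<omega>. samsg \<omega> k W t)" if "t \<in> W" for t
  proof -
    have "card (W - {t}) > 0" using that card fin by (simp add: card_Diff_singleton)
    then show ?thesis using fin by (intro samsg_integrable) (auto simp: card_gt_0_iff)
  qed
  have intU': "integrable iid (\<lambda>\<omega>. samsg \<omega> k U t)" if "t \<in> U" for t
  \<comment> \<open>For \<open>k = 0\<close> the set U may be a singleton, out of reach of the
    moment bound, but then the message is constantly 0.\<close>
  proof (cases k)
    case k: (Suc j)
    then have "card (U - {t}) > 0" using that card fin Suc.prems by (simp add: card_Diff_singleton)
    then show ?thesis using fin by (intro samsg_integrable) (auto simp: card_gt_0_iff)
  qed simp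
  have "(\<integral>\<omega>. \<bar>samsg \<omega> (Suc k) V u - samsg \<omega> (Suc k) (V - {u'}) u\<bar> \<partial>iid) =
     (\<integral>\<omega>. (\<integral>\<zeta>. \<bar>minmsg W (samsg \<omega> k W) \<zeta> - minmsg U (samsg \<omega> k U) \<zeta>\<bar> \<partial>iid) \<partial>iid)"
    by (subst integrable_resample(3)[OF sub(1) int])
      (simp only: samsg_star[OF sub(1,2), unfolded sub(4)] samsg_star[OF sub(1) subset_refl, unfolded sub(3)])
  also have "\<dots> \<le> (\<integral>\<omega>. (samsg \<omega> k W u' / card U + 1 / (real (card U))\<^sup>2) +
     (\<Sum>t\<in>U. \<bar>samsg \<omega> k W t - samsg \<omega> k U t\<bar>) / card U \<partial>iid)"
  proof (rule integral_mono)
    show "integrable iid (\<lambda>\<omega>. \<integral>\<zeta>. \<bar>minmsg W (samsg \<omega> k W) \<zeta> - minmsg U (samsg \<omega> k U) \<zeta>\<bar> \<partial>iid)"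
      using integrable_resample(2)[OF sub(1) int]
      by (simp only: samsg_star[OF sub(1,2), unfolded sub(4)] samsg_star[OF sub(1) subset_refl, unfolded sub(3)])
    show "integrable iid (\<lambda>\<omega>. (samsg \<omega> k W u' / card U + 1 / (real (card U))\<^sup>2) +
     (\<Sum>t\<in>U. \<bar>samsg \<omega> k W t - samsg \<omega> k U t\<bar>) / card U)"
      using intU intU' sub by (intro iid.expectation_affine_sum(1)) auto
    fix \<omega>
    have i: "integrable iid (minmsg W (samsg \<omega> k W))" "integrable iid (minmsg U (samsg \<omega> k W))" "integrable iid (minmsg U (samsg \<omega> k U))"
      using fin \<open>U \<noteq> {}\<close> \<open>W \<noteq> {}\<close> by (auto intro!: minmsg_integrable)
    \<comment> \<open>The intermediate term drops the candidate u' but keeps the messages computed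
      in W, which separates the two sources of error.\<close>
    have "(\<integral>\<zeta>. \<bar>minmsg W (samsg \<omega> k W) \<zeta> - minmsg U (samsg \<omega> k U) \<zeta>\<bar> \<partial>iid) \<le>
      (\<integral>\<zeta>. \<bar>minmsg W (samsg \<omega> k W) \<zeta> - minmsg U (samsg \<omega> k W) \<zeta>\<bar> + \<bar>minmsg U (samsg \<omega> k W) \<zeta> - minmsg U (samsg \<omega> k U) \<zeta>\<bar> \<partial>iid)"
      using i by (intro integral_mono) auto
    also have "\<dots> = (\<integral>\<zeta>. \<bar>minmsg W (samsg \<omega> k W) \<zeta> - minmsg U (samsg \<omega> k W) \<zeta>\<bar> \<partial>iid) + (\<integral>\<zeta>. \<bar>minmsg U (samsg \<omega> k W) \<zeta> - minmsg U (samsg \<omega> k U) \<zeta>\<bar> \<partial>iid)"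
      using i by (intro Bochner_Integration.integral_add) auto
    also have "\<dots> \<le> (samsg \<omega> k W u' / card U + 1 / (real (card U))\<^sup>2) + (\<Sum>t\<in>U. \<bar>samsg \<omega> k W t - samsg \<omega> k U t\<bar>) / card U"
      using minmsg_remove_L1[OF fin(1) \<open>U \<noteq> {}\<close> sub(6), of "samsg \<omega> k W"] 
        minmsg_L1[OF fin(1) \<open>U \<noteq> {}\<close>, of "samsg \<omega> k W" "samsg \<omega> k U"] fin
      by (intro add_mono) (auto simp: sub(5))
    finally show "(\<integral>\<zeta>. \<bar>minmsg W (samsg \<omega> k W) \<zeta> - minmsg U (samsg \<omega> k U) \<zeta>\<bar> \<partial>iid) \<le> (samsg \<omega> k W u' / card U + 1 / (real (card U))\<^sup>2) + (\<Sum>t\<in>U. \<bar>samsg \<omega> k W t - samsg \<omega> k U t\<bar>) / card U" .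
  qed
  also have "\<dots> = ((\<integral>\<omega>. samsg \<omega> k W u' \<partial>iid) / card U + 1 / (real (card U))\<^sup>2) + (\<Sum>t\<in>U. (\<integral>\<omega>. \<bar>samsg \<omega> k W t - samsg \<omega> k U t\<bar> \<partial>iid)) / card U"
    using intU intU' sub by (intro iid.expectation_affine_sum(2)) auto
  also have "\<dots> \<le> ((1 / card U) / card U + 1 / (real (card U))\<^sup>2) + (\<Sum>t\<in>U. 2 * k / (real (card W) - 1 - k)\<^sup>2) / card U"
  proof (intro add_mono divide_right_mono sum_mono)
    show "(\<integral>\<omega>. samsg \<omega> k W u' \<partial>iid) \<le> 1 / card U"
      unfolding sub(7) using fin \<open>U \<noteq> {}\<close> sub(7) by (intro samsg_integrable) auto
    fix t assume "t \<in> U"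
    then show "(\<integral>\<omega>. \<bar>samsg \<omega> k W t - samsg \<omega> k U t\<bar> \<partial>iid) \<le> 2 * k / (real (card W) - 1 - k)\<^sup>2"
      using Suc.IH[of W t u'] fin sub card by auto
  qed auto
  also have "\<dots> = 2 / (real N - 2)\<^sup>2 + 2 * k / (real N - 2 - k)\<^sup>2"
  proof -
    have "(\<Sum>t\<in>U. 2 * real k / (real (card W) - 1 - real k)\<^sup>2) / card U = 2 * real k / (real (card W) - 1 - real k)\<^sup>2"
      using \<open>U \<noteq> {}\<close> fin by simp
    moreover have "real (card U) = real N - 2" "real (card W) = real N - 1" using card by (auto simp: of_nat_diff)
    ultimately show ?thesis by (simp add: power2_eq_square add_divide_distrib[symmetric] del: sum_constant)
  qed
  also have "\<dots> \<le> 2 / (real N - 2 - k)\<^sup>2 + 2 * k / (real N - 2 - k)\<^sup>2"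
    using card(3) by (intro add_mono divide_left_mono power_mono) auto
  also have "\<dots> = 2 * (Suc k) / (real N - 1 - Suc k)\<^sup>2" by (simp add: algebra_simps add_divide_distrib)
  finally show ?case by (simp add: N_def)
qed simp

text \<open>Message 0 is the least possible one, and each step of the recursion is antitone in the
  incoming messages, so the direction of the inequality flips with k.\<close>

lemma samsg_alternating:
  assumes "finite V"
  shows "if even k then samsg \<omega> k V v \<le> samsg \<omega> (Suc k) V v else samsg \<omega> (Suc k) V v \<le> samsg \<omega> k V v"
  using assms
proof (induction k arbitrary: V v)
  case (Suc k)
  show ?case
  proof (cases "even k")
    case True
    then have "minmsg (V - {v}) (samsg \<omega> (Suc k) (V - {v})) \<zeta> \<le> minmsg (V - {v}) (samsg \<omega> k (V - {v})) \<zeta>" for \<zeta>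
      using Suc.IH[of "V - {v}"] Suc.prems by (intro minmsg_antimono) (auto simp del: samsg.simps)
    then show ?thesis using True by simp
  next
    case False
    then have "minmsg (V - {v}) (samsg \<omega> k (V - {v})) \<zeta> \<le> minmsg (V - {v}) (samsg \<omega> (Suc k) (V - {v})) \<zeta>" for \<zeta>
      using Suc.IH[of "V - {v}"] Suc.prems by (intro minmsg_antimono) (auto simp del: samsg.simps)
    then show ?thesis using False by simp
  qed
qed simp

subsection \<open>Uniform convergence in mean\<close>

lemma measure_iid_UNIV [simp]: "measure iid UNIV = 1"
  using iid.prob_space by simp

text \<open>Limits along this filter are uniform over all vertex sets that miss at most \<open>c\<close> of \<open>n\<close>
  vertices, where \<open>n\<close> remains the scaling factor.\<close>

definition nearly_full :: "nat \<Rightarrow> (nat \<times> nat set) filter" where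
  "nearly_full c = (INF n0. principal {(n, V). n0 \<le> n \<and> finite V \<and> card V \<le> n \<and> n \<le> card V + c})"

lemma eventually_nearly_full:
  "eventually P (nearly_full c) \<longleftrightarrow>
    (\<exists>n0. \<forall>n V. n0 \<le> n \<longrightarrow> finite V \<longrightarrow> card V \<le> n \<longrightarrow> n \<le> card V + c \<longrightarrow> P (n, V))"
proof -
  have "eventually P (nearly_full c) \<longleftrightarrow> (\<exists>n0\<in>UNIV. eventually P (principal {(n, V). n0 \<le> n \<and> finite V \<and> card V \<le> n \<and> n \<le> card V + c}))"
    unfolding nearly_full_def
  proof (rule eventually_INF_base)
    fix a b :: nat
    show "\<exists>x\<in>UNIV. principal {(n, V). x \<le> n \<and> finite V \<and> card V \<le> n \<and> n \<le> card V + c}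
        \<le> inf (principal {(n, V). a \<le> n \<and> finite V \<and> card V \<le> n \<and> n \<le> card V + c})
            (principal {(n, V). b \<le> n \<and> finite V \<and> card V \<le> n \<and> n \<le> card V + c})"
      by (intro bexI[of _ "max a b"]) auto
  qed auto
  then show ?thesis by (auto simp: eventually_principal)
qed

lemma nearly_full_nontrivial [simp]: "nearly_full c \<noteq> bot"
proof
  assume "nearly_full c = bot"
  then have "eventually (\<lambda>_. False) (nearly_full c)" by simp
  then obtain n0 where "\<And>n V. n0 \<le> n \<Longrightarrow> finite V \<Longrightarrow> card (V :: nat set) \<le> n \<Longrightarrow> n \<le> card V + c \<Longrightarrow> False"
    by (auto simp: eventually_nearly_full)
  from this[of n0 "{..<n0}"] show False by simp
qed

lemma nearly_full_fst: "filterlim fst at_top (nearly_full c)"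
  unfolding filterlim_at_top eventually_nearly_full by auto

lemma tendsto_nearly_full: "f \<longlonglongrightarrow> l \<Longrightarrow> ((\<lambda>(n, V). f n) \<longlongrightarrow> l) (nearly_full c)"
  using filterlim_compose[OF _ nearly_full_fst, of f "nhds l" c] by (simp add: case_prod_beta')

lemma eventually_nearly_full_finite:
  "eventually (\<lambda>(n, V). finite V \<and> m \<le> card V \<and> card V \<le> n \<and> n \<le> card V + c \<and> n \<le> 2 * card V \<and> 0 < n) (nearly_full c)"
  unfolding eventually_nearly_full by (intro exI[of _ "2 * c + m + 1"]) auto

text \<open>Deleting a pair raises the number of missing vertices from c to c + 2; hence convergence
  is demanded for all c at once.\<close>

lemma eventually_nearly_full_remove:
  assumes "eventually P (nearly_full (c + 2))"
  shows "eventually (\<lambda>(n, V). \<forall>u\<in>V. \<forall>u'\<in>V. u \<noteq> u' \<longrightarrow> P (n, V - {u, u'})) (nearly_full c)"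
proof -
  obtain n0 where n0: "\<And>n V. n0 \<le> n \<Longrightarrow> finite V \<Longrightarrow> card V \<le> n \<Longrightarrow> n \<le> card V + (c + 2) \<Longrightarrow> P (n, V)"
    using assms by (auto simp: eventually_nearly_full)
  show ?thesis unfolding eventually_nearly_full split
  proof (intro exI[of _ n0] allI impI ballI)
    fix n and V :: "nat set" and u u'
    assume *: "n0 \<le> n" "finite V" "card V \<le> n" "n \<le> card V + c" "u \<in> V" "u' \<in> V" "u \<noteq> u'"
    then have "card (V - {u, u'}) = card V - 2" by (simp add: card_Diff_subset)
    with * show "P (n, V - {u, u'})" by (intro n0) auto
  qed
qed

section \<open>Convergence in mean to a constant\<close>

text \<open>Integrability is a separate clause because the integral of a non-integrable function is
  0 by convention, which would make the second clause empty for it.\<close>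

definition conv1 :: "(nat \<Rightarrow> nat set \<Rightarrow> (nat set \<Rightarrow> real) \<Rightarrow> real) \<Rightarrow> real \<Rightarrow> bool" where
  "conv1 g q \<longleftrightarrow> (\<forall>c. (\<forall>\<^sub>F (n, V) in nearly_full c. integrable iid (g n V)) \<and>
    ((\<lambda>(n, V). \<integral>\<omega>. \<bar>g n V \<omega> - q\<bar> \<partial>iid) \<longlongrightarrow> 0) (nearly_full c))"

lemma conv1D:
  assumes "conv1 g q"
  shows "\<forall>\<^sub>F (n, V) in nearly_full c. integrable iid (g n V)"
    and "((\<lambda>(n, V). \<integral>\<omega>. \<bar>g n V \<omega> - q\<bar> \<partial>iid) \<longlongrightarrow> 0) (nearly_full c)"
  using assms by (auto simp: conv1_def)

lemma conv1I:
  assumes "\<And>c. \<forall>\<^sub>F (n, V) in nearly_full c. integrable iid (g n V) \<and> (\<integral>\<omega>. \<bar>g n V \<omega> - q\<bar> \<partial>iid) \<le> b n V"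
    and "\<And>c. ((\<lambda>(n, V). b n V) \<longlongrightarrow> 0) (nearly_full c)"
  shows "conv1 g q"
  unfolding conv1_def
proof (intro allI conjI)
  fix c
  show "\<forall>\<^sub>F (n, V) in nearly_full c. integrable iid (g n V)"
    using assms(1)[of c] by eventually_elim auto
  show "((\<lambda>(n, V). \<integral>\<omega>. \<bar>g n V \<omega> - q\<bar> \<partial>iid) \<longlongrightarrow> 0) (nearly_full c)"
  proof (rule tendsto_sandwich[OF _ _ tendsto_const assms(2)])
    show "\<forall>\<^sub>F x in nearly_full c. (case x of (n, V) \<Rightarrow> \<integral>\<omega>. \<bar>g n V \<omega> - q\<bar> \<partial>iid) \<le> (case x of (n, V) \<Rightarrow> b n V)"
      using assms(1)[of c] by eventually_elim auto
    show "\<forall>\<^sub>F x in nearly_full c. 0 \<le> (case x of (n, V) \<Rightarrow> \<integral>\<omega>. \<bar>g n V \<omega> - q\<bar> \<partial>iid)"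
      by (intro always_eventually) auto
  qed
qed

lemma conv1_const: "conv1 (\<lambda>_ _ _. q) q"
  by (rule conv1I[of _ _ "\<lambda>_ _. 0"]) (auto simp: case_prod_unfold)

lemma conv1_cong:
  assumes "conv1 g q" "\<And>c. \<forall>\<^sub>F (n, V) in nearly_full c. \<forall>\<omega>. g' n V \<omega> = g n V \<omega>"
  shows "conv1 g' q"
proof (rule conv1I[where b = "\<lambda>n V. \<integral>\<omega>. \<bar>g n V \<omega> - q\<bar> \<partial>iid"])
  fix c
  show "\<forall>\<^sub>F (n, V) in nearly_full c. integrable iid (g' n V) \<and> (\<integral>\<omega>. \<bar>g' n V \<omega> - q\<bar> \<partial>iid) \<le> (\<integral>\<omega>. \<bar>g n V \<omega> - q\<bar> \<partial>iid)"
    using assms(2)[of c] conv1D(1)[OF assms(1), of c]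
  proof eventually_elim
    case (elim x)
    obtain n V where "x = (n, V)" by (cases x)
    moreover from this elim have "g' n V = g n V" by auto
    ultimately show ?case using elim by simp
  qed
  show "((\<lambda>(n, V). \<integral>\<omega>. \<bar>g n V \<omega> - q\<bar> \<partial>iid) \<longlongrightarrow> 0) (nearly_full c)" by (rule conv1D(2)[OF assms(1)])
qed

lemma conv1_dominated:
  assumes "conv1 g q" 
    and "\<And>c. \<forall>\<^sub>F (n, V) in nearly_full c. g' n V \<in> borel_measurable iid \<and> (\<forall>\<omega>. \<bar>g' n V \<omega> - q'\<bar> \<le> C * \<bar>g n V \<omega> - q\<bar>)"
  shows "conv1 g' q'"
proof (rule conv1I[where b = "\<lambda>n V. C * (\<integral>\<omega>. \<bar>g n V \<omega> - q\<bar> \<partial>iid)"])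
  fix c
  show "\<forall>\<^sub>F (n, V) in nearly_full c. integrable iid (g' n V) \<and> (\<integral>\<omega>. \<bar>g' n V \<omega> - q'\<bar> \<partial>iid) \<le> C * (\<integral>\<omega>. \<bar>g n V \<omega> - q\<bar> \<partial>iid)"
    using assms(2)[of c] conv1D(1)[OF assms(1), of c]
  proof (eventually_elim, unfold split_beta)
    fix x assume 1: "g' (fst x) (snd x) \<in> borel_measurable iid \<and> (\<forall>\<omega>. \<bar>g' (fst x) (snd x) \<omega> - q'\<bar> \<le> C * \<bar>g (fst x) (snd x) \<omega> - q\<bar>)"
      and 2: "integrable iid (g (fst x) (snd x))"
    let ?g = "g (fst x) (snd x)" and ?g' = "g' (fst x) (snd x)"
    have i: "integrable iid (\<lambda>\<omega>. C * \<bar>?g \<omega> - q\<bar>)" using 2 by auto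
    have le: "\<bar>?g' \<omega> - q'\<bar> \<le> \<bar>C * \<bar>?g \<omega> - q\<bar>\<bar>" for \<omega> using 1 abs_ge_self order_trans by blast
    have i': "integrable iid (\<lambda>\<omega>. ?g' \<omega> - q')"
      by (rule Bochner_Integration.integrable_bound[OF i]) (use 1 le in auto)
    then have "integrable iid (\<lambda>\<omega>. (?g' \<omega> - q') + q')" by (intro Bochner_Integration.integrable_add) auto
    then have "integrable iid ?g'" by simp
    moreover have "(\<integral>\<omega>. \<bar>?g' \<omega> - q'\<bar> \<partial>iid) \<le> (\<integral>\<omega>. C * \<bar>?g \<omega> - q\<bar> \<partial>iid)"
      using i i' 1 by (intro integral_mono) auto
    ultimately show "integrable iid ?g' \<and> (\<integral>\<omega>. \<bar>?g' \<omega> - q'\<bar> \<partial>iid) \<le> C * (\<integral>\<omega>. \<bar>?g \<omega> - q\<bar> \<partial>iid)" by simp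
  qed
  show "((\<lambda>(n, V). C * (\<integral>\<omega>. \<bar>g n V \<omega> - q\<bar> \<partial>iid)) \<longlongrightarrow> 0) (nearly_full c)"
    using tendsto_mult_left[OF conv1D(2)[OF assms(1)], of C c] by (simp add: case_prod_unfold)
qed

lemma conv1_add:
  assumes "conv1 g q" "conv1 g' q'"
  shows "conv1 (\<lambda>n V \<omega>. g n V \<omega> + g' n V \<omega>) (q + q')"
proof (rule conv1I[where b = "\<lambda>n V. (\<integral>\<omega>. \<bar>g n V \<omega> - q\<bar> \<partial>iid) + (\<integral>\<omega>. \<bar>g' n V \<omega> - q'\<bar> \<partial>iid)"])
  fix c
  show "\<forall>\<^sub>F (n, V) in nearly_full c. integrable iid (\<lambda>\<omega>. g n V \<omega> + g' n V \<omega>) \<and>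
     (\<integral>\<omega>. \<bar>g n V \<omega> + g' n V \<omega> - (q + q')\<bar> \<partial>iid) \<le> (\<integral>\<omega>. \<bar>g n V \<omega> - q\<bar> \<partial>iid) + (\<integral>\<omega>. \<bar>g' n V \<omega> - q'\<bar> \<partial>iid)"
    using conv1D(1)[OF assms(1), of c] conv1D(1)[OF assms(2), of c]
  proof (eventually_elim, unfold split_beta)
    fix x let ?g = "g (fst x) (snd x)" and ?g' = "g' (fst x) (snd x)"
    assume i: "integrable iid ?g" "integrable iid ?g'"
    have "(\<integral>\<omega>. \<bar>?g \<omega> + ?g' \<omega> - (q + q')\<bar> \<partial>iid) \<le> (\<integral>\<omega>. \<bar>?g \<omega> - q\<bar> + \<bar>?g' \<omega> - q'\<bar> \<partial>iid)"
      using i by (intro integral_mono) auto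
    also have "\<dots> = (\<integral>\<omega>. \<bar>?g \<omega> - q\<bar> \<partial>iid) + (\<integral>\<omega>. \<bar>?g' \<omega> - q'\<bar> \<partial>iid)"
      using i by (intro Bochner_Integration.integral_add) auto
    finally show "integrable iid (\<lambda>\<omega>. ?g \<omega> + ?g' \<omega>) \<and> (\<integral>\<omega>. \<bar>?g \<omega> + ?g' \<omega> - (q + q')\<bar> \<partial>iid) \<le> (\<integral>\<omega>. \<bar>?g \<omega> - q\<bar> \<partial>iid) + (\<integral>\<omega>. \<bar>?g' \<omega> - q'\<bar> \<partial>iid)"
      using i by simp
  qed
  show "((\<lambda>(n, V). (\<integral>\<omega>. \<bar>g n V \<omega> - q\<bar> \<partial>iid) + (\<integral>\<omega>. \<bar>g' n V \<omega> - q'\<bar> \<partial>iid)) \<longlongrightarrow> 0) (nearly_full c)"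
    using tendsto_add[OF conv1D(2)[OF assms(1)] conv1D(2)[OF assms(2)], of c] by (simp add: case_prod_unfold)
qed

lemma conv1_measurable:
  assumes "conv1 g q" shows "\<forall>\<^sub>F (n, V) in nearly_full c. g n V \<in> borel_measurable iid"
  using conv1D(1)[OF assms, of c] by eventually_elim auto

lemma conv1_cmult:
  assumes "conv1 g q" shows "conv1 (\<lambda>n V \<omega>. C * g n V \<omega>) (C * q)"
proof (rule conv1_dominated[OF assms, where C = "\<bar>C\<bar>"])
  fix c
  show "\<forall>\<^sub>F (n, V) in nearly_full c. (\<lambda>\<omega>. C * g n V \<omega>) \<in> borel_measurable iid \<and> (\<forall>\<omega>. \<bar>C * g n V \<omega> - C * q\<bar> \<le> \<bar>C\<bar> * \<bar>g n V \<omega> - q\<bar>)"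
    using conv1_measurable[OF assms, of c]
    by eventually_elim (auto simp flip: right_diff_distrib abs_mult)
qed

lemma conv1_diff:
  assumes "conv1 g q" "conv1 g' q'"
  shows "conv1 (\<lambda>n V \<omega>. g n V \<omega> - g' n V \<omega>) (q - q')"
  using conv1_add[OF assms(1) conv1_cmult[OF assms(2), of "-1"]] by simp

lemma conv1_sum:
  assumes "finite I" "\<And>i. i \<in> I \<Longrightarrow> conv1 (g i) (q i)"
  shows "conv1 (\<lambda>n V \<omega>. \<Sum>i\<in>I. g i n V \<omega>) (\<Sum>i\<in>I. q i)"
  using assms
proof (induction I rule: finite_induct)
  case empty
  then show ?case using conv1_const[of 0] by simp
next
  case (insert i I)
  then show ?case using conv1_add[of "g i" "q i"] by simp
qed

text \<open>Follows from g g' - q q' = q' (g - q) + g (g' - q'). The bound on g is what prevents the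
  product from leaving the space of integrable functions.\<close>

lemma conv1_mult:
  assumes "conv1 g q" "conv1 g' q'"
    and "\<And>c. \<forall>\<^sub>F (n, V) in nearly_full c. \<forall>\<omega>. \<bar>g n V \<omega>\<bar> \<le> 1 \<and> \<bar>g' n V \<omega>\<bar> \<le> 1"
  shows "conv1 (\<lambda>n V \<omega>. g n V \<omega> * g' n V \<omega>) (q * q')"
proof (rule conv1I[where b = "\<lambda>n V. \<bar>q'\<bar> * (\<integral>\<omega>. \<bar>g n V \<omega> - q\<bar> \<partial>iid) + (\<integral>\<omega>. \<bar>g' n V \<omega> - q'\<bar> \<partial>iid)"])
  fix c
  show "\<forall>\<^sub>F (n, V) in nearly_full c. integrable iid (\<lambda>\<omega>. g n V \<omega> * g' n V \<omega>) \<and>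
     (\<integral>\<omega>. \<bar>g n V \<omega> * g' n V \<omega> - q * q'\<bar> \<partial>iid) \<le> \<bar>q'\<bar> * (\<integral>\<omega>. \<bar>g n V \<omega> - q\<bar> \<partial>iid) + (\<integral>\<omega>. \<bar>g' n V \<omega> - q'\<bar> \<partial>iid)"
    using conv1D(1)[OF assms(1), of c] conv1D(1)[OF assms(2), of c] assms(3)[of c]
  proof (eventually_elim, unfold split_beta)
    fix x let ?g = "g (fst x) (snd x)" and ?g' = "g' (fst x) (snd x)"
    assume i: "integrable iid ?g" "integrable iid ?g'" and b: "\<forall>\<omega>. \<bar>?g \<omega>\<bar> \<le> 1 \<and> \<bar>?g' \<omega>\<bar> \<le> 1"
    have i2: "integrable iid (\<lambda>\<omega>. ?g \<omega> * ?g' \<omega>)"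
      by (rule Bochner_Integration.integrable_bound[OF i(1)])
         (use i b in \<open>auto simp: abs_mult mult_left_le\<close>)
    have "(\<integral>\<omega>. \<bar>?g \<omega> * ?g' \<omega> - q * q'\<bar> \<partial>iid) \<le> (\<integral>\<omega>. \<bar>q'\<bar> * \<bar>?g \<omega> - q\<bar> + \<bar>?g' \<omega> - q'\<bar> \<partial>iid)"
    proof (rule integral_mono)
      fix \<omega>
      have "?g \<omega> * ?g' \<omega> - q * q' = q' * (?g \<omega> - q) + ?g \<omega> * (?g' \<omega> - q')" by (simp add: algebra_simps)
      then have "\<bar>?g \<omega> * ?g' \<omega> - q * q'\<bar> \<le> \<bar>q'\<bar> * \<bar>?g \<omega> - q\<bar> + \<bar>?g \<omega>\<bar> * \<bar>?g' \<omega> - q'\<bar>"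
        by (metis abs_mult abs_triangle_ineq)
      also have "\<bar>?g \<omega>\<bar> * \<bar>?g' \<omega> - q'\<bar> \<le> 1 * \<bar>?g' \<omega> - q'\<bar>" using b by (intro mult_right_mono) auto
      finally show "\<bar>?g \<omega> * ?g' \<omega> - q * q'\<bar> \<le> \<bar>q'\<bar> * \<bar>?g \<omega> - q\<bar> + \<bar>?g' \<omega> - q'\<bar>" by simp
    qed (use i i2 in auto)
    also have "\<dots> = \<bar>q'\<bar> * (\<integral>\<omega>. \<bar>?g \<omega> - q\<bar> \<partial>iid) + (\<integral>\<omega>. \<bar>?g' \<omega> - q'\<bar> \<partial>iid)"
      using i by simp
    finally show "integrable iid (\<lambda>\<omega>. ?g \<omega> * ?g' \<omega>) \<and> (\<integral>\<omega>. \<bar>?g \<omega> * ?g' \<omega> - q * q'\<bar> \<partial>iid) \<le> \<bar>q'\<bar> * (\<integral>\<omega>. \<bar>?g \<omega> - q\<bar> \<partial>iid) + (\<integral>\<omega>. \<bar>?g' \<omega> - q'\<bar> \<partial>iid)"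
      using i2 by simp
  qed
  show "((\<lambda>(n, V). \<bar>q'\<bar> * (\<integral>\<omega>. \<bar>g n V \<omega> - q\<bar> \<partial>iid) + (\<integral>\<omega>. \<bar>g' n V \<omega> - q'\<bar> \<partial>iid)) \<longlongrightarrow> 0) (nearly_full c)"
    using tendsto_add[OF tendsto_mult_left[OF conv1D(2)[OF assms(1)]] conv1D(2)[OF assms(2)], of "\<bar>q'\<bar>" c] by (simp add: case_prod_unfold)
qed

lemma conv1_expectation:
  assumes "conv1 g q"
  shows "((\<lambda>(n, V). \<integral>\<omega>. g n V \<omega> \<partial>iid) \<longlongrightarrow> q) (nearly_full c)"
proof (rule LIM_zero_cancel, rule Lim_null_comparison)
  show "((\<lambda>(n, V). \<integral>\<omega>. \<bar>g n V \<omega> - q\<bar> \<partial>iid) \<longlongrightarrow> 0) (nearly_full c)" by (rule conv1D(2)[OF assms])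
  show "\<forall>\<^sub>F x in nearly_full c. norm ((case x of (n, V) \<Rightarrow> \<integral>\<omega>. g n V \<omega> \<partial>iid) - q) \<le> (case x of (n, V) \<Rightarrow> \<integral>\<omega>. \<bar>g n V \<omega> - q\<bar> \<partial>iid)"
    using conv1D(1)[OF assms, of c]
  proof (eventually_elim, unfold split_beta)
    fix x assume i: "integrable iid (g (fst x) (snd x))"
    then have "(\<integral>\<omega>. g (fst x) (snd x) \<omega> \<partial>iid) - q = (\<integral>\<omega>. g (fst x) (snd x) \<omega> - q \<partial>iid)"
      by simp
    then show "norm ((\<integral>\<omega>. g (fst x) (snd x) \<omega> \<partial>iid) - q) \<le> (\<integral>\<omega>. \<bar>g (fst x) (snd x) \<omega> - q\<bar> \<partial>iid)"
      by simp
  qed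
qed

text \<open>A completeness principle: approximants with errors 1/(m+1) have limits that form a
  Cauchy sequence, because they can be compared through g at one common pair (n, V). It yields the
  existence of a limit without naming it.\<close>

lemma conv1_approx:
  assumes int: "\<And>c. \<forall>\<^sub>F (n, V) in nearly_full c. integrable iid (g n V)"
    and ap: "\<And>\<epsilon>. 0 < \<epsilon> \<Longrightarrow> \<exists>g' q'. conv1 g' q' \<and> (\<forall>c. \<forall>\<^sub>F (n, V) in nearly_full c. (\<integral>\<omega>. \<bar>g n V \<omega> - g' n V \<omega>\<bar> \<partial>iid) \<le> \<epsilon>)"
  shows "\<exists>q. conv1 g q"
proof -
  have "\<exists>G Q. \<forall>m::nat. conv1 (G m) (Q m) \<and> (\<forall>c. \<forall>\<^sub>F (n, V) in nearly_full c. (\<integral>\<omega>. \<bar>g n V \<omega> - G m n V \<omega>\<bar> \<partial>iid) \<le> 1 / Suc m)"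
  proof -
    have "\<forall>m::nat. \<exists>g' q'. conv1 g' q' \<and> (\<forall>c. \<forall>\<^sub>F (n, V) in nearly_full c. (\<integral>\<omega>. \<bar>g n V \<omega> - g' n V \<omega>\<bar> \<partial>iid) \<le> 1 / Suc m)"
      using ap by simp
    then show ?thesis unfolding choice_iff .
  qed
  then obtain G Q where conv: "\<And>m. conv1 (G m) (Q m)"
    and close: "\<And>m c. \<forall>\<^sub>F (n, V) in nearly_full c. (\<integral>\<omega>. \<bar>g n V \<omega> - G m n V \<omega>\<bar> \<partial>iid) \<le> 1 / Suc m" by blast
  have gQ: "\<forall>\<^sub>F (n, V) in nearly_full c. (\<integral>\<omega>. \<bar>g n V \<omega> - Q m\<bar> \<partial>iid) \<le> 1 / Suc m + \<delta>" if "\<delta> > 0" for m c \<delta>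
  proof -
    have "\<forall>\<^sub>F x in nearly_full c. dist (case x of (n, V) \<Rightarrow> \<integral>\<omega>. \<bar>G m n V \<omega> - Q m\<bar> \<partial>iid) 0 < \<delta>"
      using conv1D(2)[OF conv] that by (rule tendstoD)
    then show ?thesis using int[of c] close[where c = c and m = m] conv1D(1)[OF conv, of m c]
    proof (eventually_elim, unfold split_beta)
      fix x let ?g = "g (fst x) (snd x)" and ?G = "G m (fst x) (snd x)"
      assume *: "dist (\<integral>\<omega>. \<bar>?G \<omega> - Q m\<bar> \<partial>iid) 0 < \<delta>" "(\<integral>\<omega>. \<bar>?g \<omega> - ?G \<omega>\<bar> \<partial>iid) \<le> 1 / Suc m"
       "integrable iid ?g" "integrable iid ?G"
      have "(\<integral>\<omega>. \<bar>?g \<omega> - Q m\<bar> \<partial>iid) \<le> (\<integral>\<omega>. \<bar>?g \<omega> - ?G \<omega>\<bar> + \<bar>?G \<omega> - Q m\<bar> \<partial>iid)"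
        using * by (intro integral_mono) auto
      also have "\<dots> = (\<integral>\<omega>. \<bar>?g \<omega> - ?G \<omega>\<bar> \<partial>iid) + (\<integral>\<omega>. \<bar>?G \<omega> - Q m\<bar> \<partial>iid)"
        using * by (intro Bochner_Integration.integral_add) auto
      finally show "(\<integral>\<omega>. \<bar>?g \<omega> - Q m\<bar> \<partial>iid) \<le> 1 / Suc m + \<delta>" using * by (simp add: dist_real_def)
    qed
  qed
  have QQ: "\<bar>Q m - Q l\<bar> \<le> 1 / Suc m + 1 / Suc l" for m l
  proof (rule field_le_epsilon)
    fix \<delta> :: real assume "0 < \<delta>"
    then have "\<delta> / 2 > 0" by simp
    \<comment> \<open>The statement does not depend on x, so that it holds eventually along a
      nontrivial filter makes it true.\<close>
    have "\<forall>\<^sub>F x in nearly_full 0. \<bar>Q m - Q l\<bar> \<le> 1 / Suc m + 1 / Suc l + \<delta>"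
      using gQ[OF \<open>\<delta> / 2 > 0\<close>, where m = m and c = 0] gQ[OF \<open>\<delta> / 2 > 0\<close>, where m = l and c = 0] int[of 0]
    proof (eventually_elim, unfold split_beta)
      fix x let ?g = "g (fst x) (snd x)"
      assume *: "(\<integral>\<omega>. \<bar>?g \<omega> - Q m\<bar> \<partial>iid) \<le> 1 / Suc m + \<delta> / 2" "(\<integral>\<omega>. \<bar>?g \<omega> - Q l\<bar> \<partial>iid) \<le> 1 / Suc l + \<delta> / 2"
       "integrable iid ?g"
      have "\<bar>Q m - Q l\<bar> = (\<integral>\<omega>. \<bar>Q m - Q l\<bar> \<partial>(iid :: (nat set \<Rightarrow> real) measure))" by simp
      also have "\<dots> \<le> (\<integral>\<omega>. \<bar>?g \<omega> - Q m\<bar> + \<bar>?g \<omega> - Q l\<bar> \<partial>iid)"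
        using * by (intro integral_mono) auto
      also have "\<dots> = (\<integral>\<omega>. \<bar>?g \<omega> - Q m\<bar> \<partial>iid) + (\<integral>\<omega>. \<bar>?g \<omega> - Q l\<bar> \<partial>iid)"
        using * by (intro Bochner_Integration.integral_add) auto
      finally show "\<bar>Q m - Q l\<bar> \<le> 1 / Suc m + 1 / Suc l + \<delta>" using * by simp
    qed
    then show "\<bar>Q m - Q l\<bar> \<le> 1 / Suc m + 1 / Suc l + \<delta>" by simp
  qed
  have lim0: "(\<lambda>m. 1 / real (Suc m)) \<longlonglongrightarrow> 0" by real_asymp
  have "Cauchy Q"
  proof (rule CauchyI)
    fix e :: real assume "0 < e"
    then obtain M where M: "\<And>m. m \<ge> M \<Longrightarrow> 1 / real (Suc m) < e / 2"
      using order_tendstoD(2)[OF lim0, of "e / 2"] by (auto simp: eventually_sequentially)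
    show "\<exists>M. \<forall>m\<ge>M. \<forall>n\<ge>M. norm (Q m - Q n) < e"
    proof (intro exI[of _ M] allI impI)
      fix m l assume "m \<ge> M" "l \<ge> M"
      then show "norm (Q m - Q l) < e" using QQ[of m l] M[of m] M[of l] by simp
    qed
  qed
  then obtain q where q: "Q \<longlonglongrightarrow> q" using Cauchy_convergent convergent_def by blast
  have Qq: "\<bar>Q m - q\<bar> \<le> 1 / Suc m" for m
  proof (rule LIMSEQ_le)
    show "(\<lambda>l. \<bar>Q m - Q l\<bar>) \<longlonglongrightarrow> \<bar>Q m - q\<bar>" by (intro tendsto_intros q)
    show "(\<lambda>l. 1 / Suc m + 1 / real (Suc l)) \<longlonglongrightarrow> 1 / Suc m"
      using tendsto_add[OF tendsto_const lim0, of "1 / real (Suc m)"] by simp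
  qed (use QQ in auto)
  have "conv1 g q" unfolding conv1_def
  proof (intro allI conjI int)
    fix c
    show "((\<lambda>(n, V). \<integral>\<omega>. \<bar>g n V \<omega> - q\<bar> \<partial>iid) \<longlongrightarrow> 0) (nearly_full c)"
    proof (rule tendstoI)
      fix e :: real assume "0 < e"
      then obtain m where m: "1 / real (Suc m) < e / 3"
        using order_tendstoD(2)[OF lim0, of "e / 3"] by (auto simp: eventually_sequentially)
      have "e / 3 > 0" using \<open>0 < e\<close> by simp
      show "\<forall>\<^sub>F x in nearly_full c. dist (case x of (n, V) \<Rightarrow> \<integral>\<omega>. \<bar>g n V \<omega> - q\<bar> \<partial>iid) 0 < e"
        using gQ[OF \<open>e / 3 > 0\<close>, where m = m and c = c] int[of c]
      proof (eventually_elim, unfold split_beta)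
        fix x let ?g = "g (fst x) (snd x)"
        assume *: "(\<integral>\<omega>. \<bar>?g \<omega> - Q m\<bar> \<partial>iid) \<le> 1 / Suc m + e / 3" "integrable iid ?g"
        have "(\<integral>\<omega>. \<bar>?g \<omega> - q\<bar> \<partial>iid) \<le> (\<integral>\<omega>. \<bar>?g \<omega> - Q m\<bar> + \<bar>Q m - q\<bar> \<partial>iid)"
          using * by (intro integral_mono) auto
        also have "\<dots> = (\<integral>\<omega>. \<bar>?g \<omega> - Q m\<bar> \<partial>iid) + \<bar>Q m - q\<bar>"
          using * by simp
        also have "\<dots> < e" using * Qq[of m] m by linarith
        finally show "dist (\<integral>\<omega>. \<bar>?g \<omega> - q\<bar> \<partial>iid) 0 < e" by (simp add: dist_real_def)
      qed
    qed
  qed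
  then show ?thesis ..
qed

subsection \<open>Discretisation of the joint law of two consecutive messages\<close>

lemma measure_iid_pair_space [simp]:
  "measure ((iid :: ('i \<Rightarrow> real) measure) \<Otimes>\<^sub>M (iid :: ('j \<Rightarrow> real) measure)) (space (iid \<Otimes>\<^sub>M iid)) = 1"
  using iid_pair.P.prob_space .

text \<open>The \<open>k\<close>-th message out of a vertex attached to \<open>V\<close> by fresh edges with costs \<open>\<zeta>\<close>.\<close>

definition nextmsg :: "(nat set \<Rightarrow> real) \<Rightarrow> nat \<Rightarrow> nat set \<Rightarrow> (nat \<Rightarrow> real) \<Rightarrow> real" where
  "nextmsg \<omega> k V \<zeta> = (case k of 0 \<Rightarrow> 0 | Suc j \<Rightarrow> minmsg V (samsg \<omega> j V) \<zeta>)"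

lemma samsg_star_nextmsg:
  "v \<notin> V \<Longrightarrow> U \<subseteq> V \<Longrightarrow> samsg (star_upd v V \<zeta> \<omega>) k (insert v U) v = nextmsg \<omega> k U \<zeta>"
  by (cases k) (simp_all add: nextmsg_def samsg_star del: samsg.simps(2))

lemma nextmsg_nonneg [simp]: "finite V \<Longrightarrow> 0 \<le> nextmsg \<omega> k V \<zeta>"
  by (cases k) (auto simp: nextmsg_def)

lemma measurable_nextmsg [measurable (raw)]:
  assumes [measurable]: "W \<in> measurable M iid" "Z \<in> measurable M iid" and "finite V"
  shows "(\<lambda>x. nextmsg (W x) k V (Z x)) \<in> borel_measurable M"
proof (cases k)
  case (Suc j)
  have "(\<lambda>x. minmsg V (samsg (W x) j V) (Z x)) \<in> borel_measurable M"
  proof (rule measurable_minmsg[OF _ _ \<open>finite V\<close>])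
    fix t
    show "(\<lambda>x. samsg (W x) j V t) \<in> borel_measurable M"
      using measurable_compose[OF assms(1) measurable_samsg[OF \<open>finite V\<close>]] .
    show "(\<lambda>x. Z x t) \<in> borel_measurable M"
      using measurable_compose[OF assms(2) measurable_iid_component] .
  qed
  then show ?thesis by (simp add: nextmsg_def Suc)
qed (simp add: nextmsg_def)

lemma nextmsg_moment:
  assumes "finite V" "V \<noteq> {}" "0 < p"
  shows "integrable iid (\<lambda>\<zeta>. nextmsg \<omega> k V \<zeta> ^ p)"
    and "(\<integral>\<zeta>. nextmsg \<omega> k V \<zeta> ^ p \<partial>iid) \<le> fact p / real (card V) ^ p"
proof -
  have "integrable iid (\<lambda>\<zeta>. nextmsg \<omega> k V \<zeta> ^ p) \<and> (\<integral>\<zeta>. nextmsg \<omega> k V \<zeta> ^ p \<partial>iid) \<le> fact p / real (card V) ^ p"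
  proof (cases k)
    case 0
    then show ?thesis using assms by (simp add: nextmsg_def zero_power)
  next
    case (Suc j)
    have "exp (- (\<Sum>t\<in>V. samsg \<omega> j V t)) * fact p / real (card V) ^ p \<le> 1 * fact p / real (card V) ^ p"
      using assms by (intro divide_right_mono mult_right_mono) (auto intro!: sum_nonneg)
    then show ?thesis
      using minmsg_moment[OF assms(1,2), of "samsg \<omega> j V" p] assms by (simp add: nextmsg_def Suc)
  qed
  then show "integrable iid (\<lambda>\<zeta>. nextmsg \<omega> k V \<zeta> ^ p)"
    "(\<integral>\<zeta>. nextmsg \<omega> k V \<zeta> ^ p \<partial>iid) \<le> fact p / real (card V) ^ p" by auto
qed

definition exceeds :: "real \<Rightarrow> real \<Rightarrow> real" where
  "exceeds x a = (if x < a then 1 else 0)"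

lemma exceeds_nonneg [simp]: "0 \<le> exceeds x a" and exceeds_le_1 [simp]: "exceeds x a \<le> 1"
  by (auto simp: exceeds_def)

lemma measurable_exceeds [measurable (raw)]:
  assumes [measurable]: "f \<in> borel_measurable M"
  shows "(\<lambda>x. exceeds c (f x)) \<in> borel_measurable M"
  unfolding exceeds_def by measurable

text \<open>The rate of the scaled message is card V / n, at least 1/2 by hypothesis; hence x/2 in
  the exponent.\<close>

lemma nextmsg_exceeds:
  assumes "finite V" "V \<noteq> {}" "0 \<le> x" "0 < n" "n \<le> 2 * card V"
  shows "(\<integral>\<zeta>. exceeds x (real n * nextmsg \<omega> k V \<zeta>) \<partial>iid) \<le> exp (- x / 2)"
proof (cases k)
  case 0
  then show ?thesis using assms by (simp add: nextmsg_def exceeds_def)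
next
  case (Suc j)
  have [measurable]: "minmsg V (samsg \<omega> j V) \<in> borel_measurable iid" using assms by measurable
  have "(\<integral>\<zeta>. exceeds x (real n * nextmsg \<omega> k V \<zeta>) \<partial>iid) = (\<integral>\<zeta>. indicator {\<zeta>. x / n < minmsg V (samsg \<omega> j V) \<zeta>} \<zeta> \<partial>iid)"
    using assms by (intro Bochner_Integration.integral_cong)
      (auto simp: exceeds_def Suc nextmsg_def field_simps indicator_def)
  also have "\<dots> = measure iid {\<zeta>. x / n < minmsg V (samsg \<omega> j V) \<zeta>}" by simp
  also have "\<dots> = exp (- (\<Sum>t\<in>V. samsg \<omega> j V t)) * exp (- (real (card V) * (x / n)))"
    using assms by (intro measure_minmsg_greater) auto
  also have "\<dots> \<le> 1 * exp (- (real (card V) * (x / n)))"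
    using assms by (intro mult_right_mono) (auto intro!: sum_nonneg)
  also have "\<dots> \<le> exp (- x / 2)"
  proof -
    have "real n \<le> 2 * real (card V)" using assms by linarith
    then have "real n * x \<le> 2 * real (card V) * x" using assms by (intro mult_right_mono) auto
    then show ?thesis using assms by (simp add: field_simps)
  qed
  finally show ?thesis .
qed

text \<open>A random variable in \<open>\<omega>\<close>: the conditional joint tail given the costs
  inside V. Both factors use the same \<open>\<zeta>\<close>, so it is not the product of the two
  marginal tails.\<close>

definition pair_tail :: "nat \<Rightarrow> real \<Rightarrow> real \<Rightarrow> nat \<Rightarrow> nat set \<Rightarrow> (nat set \<Rightarrow> real) \<Rightarrow> real" where
  "pair_tail k x y n V \<omega> = (\<integral>\<zeta>. exceeds x (real n * nextmsg \<omega> k V \<zeta>) * exceeds y (real n * nextmsg \<omega> (Suc k) V \<zeta>) \<partial>iid)"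

text \<open>Given the costs \<open>\<omega>\<close> inside \<open>V\<close>, the messages out of two further vertices are independent
  with the same law; \<open>f\<close> sees the \<open>k\<close>-th and \<open>(k + 1)\<close>-st message out of each of them.\<close>

definition quadexp :: "(real \<Rightarrow> real \<Rightarrow> real \<Rightarrow> real \<Rightarrow> real) \<Rightarrow> nat \<Rightarrow> nat \<Rightarrow> nat set \<Rightarrow> (nat set \<Rightarrow> real) \<Rightarrow> real" where
  "quadexp f k n V \<omega> = (\<integral>\<zeta>. (\<integral>\<eta>. f (real n * nextmsg \<omega> k V \<zeta>) (real n * nextmsg \<omega> (Suc k) V \<zeta>)
     (real n * nextmsg \<omega> k V \<eta>) (real n * nextmsg \<omega> (Suc k) V \<eta>) \<partial>iid) \<partial>iid)"

definition lip4 :: "real \<Rightarrow> (real \<Rightarrow> real \<Rightarrow> real \<Rightarrow> real \<Rightarrow> real) \<Rightarrow> bool" where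
  "lip4 L f \<longleftrightarrow> (\<forall>a b c d a' b' c' d'. \<bar>f a b c d - f a' b' c' d'\<bar> \<le> L * (\<bar>a - a'\<bar> + \<bar>b - b'\<bar> + \<bar>c - c'\<bar> + \<bar>d - d'\<bar>))"

lemma lip4_measurable:
  assumes "lip4 L f"
    and [measurable]: "A \<in> borel_measurable M" "B \<in> borel_measurable M" "C \<in> borel_measurable M" "D \<in> borel_measurable M"
  shows "(\<lambda>x. f (A x) (B x) (C x) (D x)) \<in> borel_measurable M"
proof -
  define F where "F = (\<lambda>p. f (fst p) (fst (snd p)) (fst (snd (snd p))) (snd (snd (snd p))))"
  have "continuous_on UNIV F"
    unfolding continuous_on_eq_continuous_at[OF open_UNIV] isCont_def
  proof (rule ballI, rule LIM_zero_cancel, rule Lim_null_comparison)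
    fix p :: "real \<times> real \<times> real \<times> real"
    let ?g = "\<lambda>x. L * (\<bar>fst x - fst p\<bar> + \<bar>fst (snd x) - fst (snd p)\<bar> + \<bar>fst (snd (snd x)) - fst (snd (snd p))\<bar> + \<bar>snd (snd (snd x)) - snd (snd (snd p))\<bar>)"
    show "\<forall>\<^sub>F x in at p. norm (F x - F p) \<le> ?g x"
      using assms(1) by (intro always_eventually) (auto simp: F_def lip4_def)
    have "(?g \<longlongrightarrow> L * (\<bar>fst p - fst p\<bar> + \<bar>fst (snd p) - fst (snd p)\<bar> + \<bar>fst (snd (snd p)) - fst (snd (snd p))\<bar> + \<bar>snd (snd (snd p)) - snd (snd (snd p))\<bar>)) (at p)"
      by (intro tendsto_intros)
    then show "(?g \<longlongrightarrow> 0) (at p)" by simp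
  qed
  then have "F \<in> borel_measurable borel" by (rule borel_measurable_continuous_onI)
  moreover have "(\<lambda>x. (A x, B x, C x, D x)) \<in> borel_measurable M" by measurable
  ultimately have "(\<lambda>x. F (A x, B x, C x, D x)) \<in> borel_measurable M" by (rule measurable_compose[rotated])
  then show ?thesis by (simp add: F_def)
qed

section \<open>Step-function approximation\<close>

text \<open>The shift by one makes cell 0 the interval (-1/m, 0], so the value 0, an atom of the
  messages, lies in a cell. Cell i is represented by its right end i/m.\<close>

definition grid :: "nat \<Rightarrow> nat \<Rightarrow> real" where
  "grid m i = (real i - 1) / real m"

definition cell :: "nat \<Rightarrow> nat \<Rightarrow> real \<Rightarrow> real" where
  "cell m i a = exceeds (grid m i) a - exceeds (grid m (Suc i)) a"

lemma grid_mono: "i \<le> j \<Longrightarrow> grid m i \<le> grid m j"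
  by (simp add: grid_def divide_right_mono)

lemma cell_bounds: "0 \<le> cell m i a" "cell m i a \<le> 1"
  using grid_mono[of i "Suc i" m] by (auto simp: cell_def exceeds_def)

lemma measurable_cell [measurable (raw)]:
  assumes [measurable]: "f \<in> borel_measurable M"
  shows "(\<lambda>x. cell m i (f x)) \<in> borel_measurable M"
  unfolding cell_def by measurable

text \<open>The first K cells tile (-1/m, (K-1)/m]. A nonnegative value lies in exactly one of them,
  that of index \<open>\<lceil>a * m\<rceil>\<close>, or beyond the last grid point.\<close>

lemma cell_cases:
  assumes "0 \<le> a" "0 < m"
  obtains i0 where "i0 < K" "\<bar>a - real i0 / m\<bar> \<le> 1 / m" "\<And>i. cell m i a = of_bool (i = i0)"
  | "grid m K < a" "\<And>i. i < K \<Longrightarrow> cell m i a = 0"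
proof (cases "grid m K < a")
  case True
  have "cell m i a = 0" if "i < K" for i
    using grid_mono[of i K m] grid_mono[of "Suc i" K m] that True by (auto simp: cell_def exceeds_def)
  with True that(2) show ?thesis by blast
next
  case False
  define i0 where "i0 = nat \<lceil>a * m\<rceil>"
  have am: "0 \<le> a * m" using assms by simp
  then have i0: "int i0 = \<lceil>a * m\<rceil>" unfolding i0_def by (subst nat_0_le) linarith+
  have "exceeds (grid m i) a = of_bool (i \<le> i0)" for i
  proof -
    have "grid m i < a \<longleftrightarrow> real i - 1 < a * m" using assms by (simp add: grid_def field_simps)
    also have "\<dots> \<longleftrightarrow> of_int (int i - 1) < a * m" by simp
    also have "\<dots> \<longleftrightarrow> int i - 1 < \<lceil>a * m\<rceil>" by (simp only: less_ceiling_iff)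
    also have "\<dots> \<longleftrightarrow> i \<le> i0" using i0 by linarith
    finally show ?thesis by (simp add: exceeds_def)
  qed
  then have cell: "cell m i a = of_bool (i = i0)" for i by (auto simp: cell_def)
  have "a * m \<le> real K - 1" using False assms by (simp add: grid_def field_simps not_less)
  then have "i0 < K" using i0 am by linarith
  have "a * m \<le> i0" "i0 < a * m + 1" using i0 by linarith+
  then have "\<bar>a * m - i0\<bar> \<le> 1" by linarith
  then have "\<bar>a * m - i0\<bar> / m \<le> 1 / m" by (simp add: divide_right_mono)
  also have "\<bar>a * m - i0\<bar> / m = \<bar>a - i0 / m\<bar>"
  proof -
    have "a - i0 / m = (a * m - i0) / m" using assms(2) by (simp add: field_simps)
    then show ?thesis by simp
  qed
  finally show ?thesis using that(1) \<open>i0 < K\<close> cell by blast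
qed

text \<open>The cells of a, b and those of c, d are grouped because the two pairs are independent
  given \<open>\<omega>\<close>: the conditional mean becomes a quadratic polynomial in cell
  probabilities.\<close>

definition stepf :: "(real \<Rightarrow> real \<Rightarrow> real \<Rightarrow> real \<Rightarrow> real) \<Rightarrow> nat \<Rightarrow> nat \<Rightarrow> real \<Rightarrow> real \<Rightarrow> real \<Rightarrow> real \<Rightarrow> real" where
  "stepf f m K a b c d = (\<Sum>p\<in>{..<K} \<times> {..<K} \<times> {..<K} \<times> {..<K}.
     f (real (fst p) / m) (real (fst (snd p)) / m) (real (fst (snd (snd p))) / m) (real (snd (snd (snd p))) / m) *
     ((cell m (fst p) a * cell m (fst (snd p)) b) * (cell m (fst (snd (snd p))) c * cell m (snd (snd (snd p))) d)))"

text \<open>Inside the grid each of the four arguments moves by at most 1/m. If one of them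
  overflows, \<open>stepf\<close> vanishes, and the error, at most B, is charged to its overflow
  indicator.\<close>

lemma stepf_approx:
  assumes "lip4 L f" "0 \<le> L" "\<And>a b c d. \<bar>f a b c d\<bar> \<le> B" "0 < m" "0 \<le> a" "0 \<le> b" "0 \<le> c" "0 \<le> d"
  shows "\<bar>f a b c d - stepf f m K a b c d\<bar> \<le>
    L * (4 / m) + B * (exceeds (grid m K) a + exceeds (grid m K) b + exceeds (grid m K) c + exceeds (grid m K) d)"
    (is "?lhs \<le> ?L + B * ?u")
proof -
  have B: "0 \<le> B" using assms(3)[of 0 0 0 0] by linarith
  have L: "0 \<le> ?L" using assms(2) by simp
  have u: "0 \<le> ?u" by simp
  have zero: "?lhs \<le> ?L + B * ?u" if "stepf f m K a b c d = 0" "1 \<le> ?u"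
  proof -
    have "?lhs \<le> B * 1" using that assms(3) by simp
    also have "\<dots> \<le> B * ?u" using that B by (intro mult_left_mono) auto
    finally show ?thesis using L by simp
  qed
  show ?thesis
  proof (rule cell_cases[OF \<open>0 \<le> a\<close> \<open>0 < m\<close>, of K])
    assume "grid m K < a" and *: "\<And>i. i < K \<Longrightarrow> cell m i a = 0"
    show ?thesis
      by (rule zero) (use * \<open>grid m K < a\<close> in \<open>auto simp: stepf_def exceeds_def intro!: sum.neutral\<close>)
  next
    fix i0 assume i: "i0 < K" "\<bar>a - real i0 / m\<bar> \<le> 1 / m" "\<And>i. cell m i a = of_bool (i = i0)"
    show ?thesis
    proof (rule cell_cases[OF \<open>0 \<le> b\<close> \<open>0 < m\<close>, of K])
      assume "grid m K < b" and *: "\<And>i. i < K \<Longrightarrow> cell m i b = 0"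
      show ?thesis
        by (rule zero) (use * \<open>grid m K < b\<close> in \<open>auto simp: stepf_def exceeds_def intro!: sum.neutral\<close>)
    next
      fix j0 assume j: "j0 < K" "\<bar>b - real j0 / m\<bar> \<le> 1 / m" "\<And>i. cell m i b = of_bool (i = j0)"
      show ?thesis
      proof (rule cell_cases[OF \<open>0 \<le> c\<close> \<open>0 < m\<close>, of K])
        assume "grid m K < c" and *: "\<And>i. i < K \<Longrightarrow> cell m i c = 0"
        show ?thesis
          by (rule zero) (use * \<open>grid m K < c\<close> in \<open>auto simp: stepf_def exceeds_def intro!: sum.neutral\<close>)
      next
        fix k0 assume k: "k0 < K" "\<bar>c - real k0 / m\<bar> \<le> 1 / m" "\<And>i. cell m i c = of_bool (i = k0)"
        show ?thesis
        proof (rule cell_cases[OF \<open>0 \<le> d\<close> \<open>0 < m\<close>, of K])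
          assume "grid m K < d" and *: "\<And>i. i < K \<Longrightarrow> cell m i d = 0"
          show ?thesis
            by (rule zero) (use * \<open>grid m K < d\<close> in \<open>auto simp: stepf_def exceeds_def intro!: sum.neutral\<close>)
        next
          fix l0 assume l: "l0 < K" "\<bar>d - real l0 / m\<bar> \<le> 1 / m" "\<And>i. cell m i d = of_bool (i = l0)"
          let ?F = "\<lambda>p. f (real (fst p) / m) (real (fst (snd p)) / m) (real (fst (snd (snd p))) / m) (real (snd (snd (snd p))) / m)"
          have "stepf f m K a b c d = (\<Sum>p\<in>{..<K} \<times> {..<K} \<times> {..<K} \<times> {..<K}. if p = (i0, j0, k0, l0) then ?F p else 0)"
            unfolding stepf_def i(3) j(3) k(3) l(3) by (intro sum.cong refl) auto
          also have "\<dots> = ?F (i0, j0, k0, l0)"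
            using i(1) j(1) k(1) l(1) by (subst sum.delta) auto
          finally have "?lhs \<le> L * (\<bar>a - real i0 / m\<bar> + \<bar>b - real j0 / m\<bar> + \<bar>c - real k0 / m\<bar> + \<bar>d - real l0 / m\<bar>)"
            using assms(1) by (simp add: lip4_def)
          also have "\<dots> \<le> L * (1 / m + 1 / m + 1 / m + 1 / m)"
            using i j k l assms(2) by (intro mult_left_mono add_mono) auto
          also have "\<dots> = ?L" by simp
          finally show ?thesis using mult_nonneg_nonneg[OF B u] by linarith
        qed
      qed
    qed
  qed
qed

lemma quadexp_integrable_inner:
  fixes f :: "real \<Rightarrow> real \<Rightarrow> real \<Rightarrow> real \<Rightarrow> real"
  assumes lip: "lip4 L f" and B: "\<And>a b c d. \<bar>f a b c d\<bar> \<le> B" and V: "finite V"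
  shows "integrable (iid \<Otimes>\<^sub>M iid) (\<lambda>p. f (real n * nextmsg \<omega> k V (fst p)) (real n * nextmsg \<omega> (Suc k) V (fst p))
     (real n * nextmsg \<omega> k V (snd p)) (real n * nextmsg \<omega> (Suc k) V (snd p)))" (is "integrable _ ?F")
proof -
  have "?F \<in> borel_measurable (iid \<Otimes>\<^sub>M iid)"
    using V by (intro lip4_measurable[OF lip]) measurable
  then show ?thesis
    using B by (intro iid_pair.P.integrable_const_bound[where B = B]) auto
qed

lemma quadexp_pair:
  assumes "integrable (iid \<Otimes>\<^sub>M iid) (\<lambda>p. f (real n * nextmsg \<omega> k V (fst p)) (real n * nextmsg \<omega> (Suc k) V (fst p))
     (real n * nextmsg \<omega> k V (snd p)) (real n * nextmsg \<omega> (Suc k) V (snd p)))"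
  shows "quadexp f k n V \<omega> = (\<integral>p. f (real n * nextmsg \<omega> k V (fst p)) (real n * nextmsg \<omega> (Suc k) V (fst p))
     (real n * nextmsg \<omega> k V (snd p)) (real n * nextmsg \<omega> (Suc k) V (snd p)) \<partial>(iid \<Otimes>\<^sub>M iid))"
  using iid_pair.integral_fst'[OF assms] by (simp add: quadexp_def)

lemma quadexp_bound:
  assumes lip: "lip4 L f" and B: "\<And>a b c d. \<bar>f a b c d\<bar> \<le> B" and V: "finite V"
  shows "\<bar>quadexp f k n V \<omega>\<bar> \<le> B"
proof -
  note i = quadexp_integrable_inner[OF lip B V, of n \<omega> k]
  have "B \<ge> 0" using B[of 0 0 0 0] by linarith
  have "\<bar>quadexp f k n V \<omega>\<bar> \<le> (\<integral>p. \<bar>f (real n * nextmsg \<omega> k V (fst p)) (real n * nextmsg \<omega> (Suc k) V (fst p))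
     (real n * nextmsg \<omega> k V (snd p)) (real n * nextmsg \<omega> (Suc k) V (snd p))\<bar> \<partial>(iid \<Otimes>\<^sub>M iid))"
    unfolding quadexp_pair[OF i] by (rule integral_abs_bound)
  also have "\<dots> \<le> (\<integral>p. B \<partial>((iid :: (nat \<Rightarrow> real) measure) \<Otimes>\<^sub>M (iid :: (nat \<Rightarrow> real) measure)))"
    using i B by (intro integral_mono) auto
  also have "\<dots> = B" by simp
  finally show ?thesis .
qed

lemma measurable_quadexp:
  assumes lip: "lip4 L f" and V: "finite V"
  shows "quadexp f k n V \<in> borel_measurable iid"
proof -
  have "(\<lambda>x. f (real n * nextmsg (fst (fst x)) k V (snd (fst x))) (real n * nextmsg (fst (fst x)) (Suc k) V (snd (fst x)))
     (real n * nextmsg (fst (fst x)) k V (snd x)) (real n * nextmsg (fst (fst x)) (Suc k) V (snd x)))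
     \<in> borel_measurable ((iid \<Otimes>\<^sub>M iid) \<Otimes>\<^sub>M iid)"
    using V by (intro lip4_measurable[OF lip]) measurable
  then have *: "(\<lambda>(\<omega>\<zeta>, \<eta>). f (real n * nextmsg (fst \<omega>\<zeta>) k V (snd \<omega>\<zeta>)) (real n * nextmsg (fst \<omega>\<zeta>) (Suc k) V (snd \<omega>\<zeta>))
     (real n * nextmsg (fst \<omega>\<zeta>) k V \<eta>) (real n * nextmsg (fst \<omega>\<zeta>) (Suc k) V \<eta>)) \<in> borel_measurable ((iid \<Otimes>\<^sub>M iid) \<Otimes>\<^sub>M iid)"
    by (simp add: case_prod_unfold)
  from iid.borel_measurable_lebesgue_integral[OF this]
  have "(\<lambda>(\<omega>, \<zeta>). \<integral>\<eta>. f (real n * nextmsg \<omega> k V \<zeta>) (real n * nextmsg \<omega> (Suc k) V \<zeta>)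
     (real n * nextmsg \<omega> k V \<eta>) (real n * nextmsg \<omega> (Suc k) V \<eta>) \<partial>iid) \<in> borel_measurable (iid \<Otimes>\<^sub>M iid)"
    by (simp add: case_prod_unfold)
  from iid.borel_measurable_lebesgue_integral[OF this] show ?thesis
    by (simp add: quadexp_def[abs_def])
qed

text \<open>Convergence of all joint tails gives convergence of all cell probabilities, hence of
  conditional means of step functions; bounded Lipschitz functions follow by approximation.\<close>

lemma quadexp_conv:
  assumes tails: "\<And>x y. \<exists>q. conv1 (pair_tail k x y) q"
    and lip: "lip4 L f" and "0 \<le> L" and B: "\<And>a b c d. \<bar>f a b c d\<bar> \<le> B"
  shows "\<exists>q. conv1 (quadexp f k) q"
proof (rule conv1_approx)
  have "0 \<le> B" using B[of 0 0 0 0] by linarith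
  fix c
  show "\<forall>\<^sub>F (n, V) in nearly_full c. integrable iid (quadexp f k n V)"
    using eventually_nearly_full_finite[of 0 c]
  proof (eventually_elim, unfold split_beta, elim conjE)
    fix x :: "nat \<times> nat set" assume "finite (snd x)"
    then show "integrable iid (quadexp f k (fst x) (snd x))"
      using quadexp_bound[OF lip B] measurable_quadexp[OF lip] by (intro iid.integrable_const_bound[where B = B]) auto
  qed
next
  have "0 \<le> B" using B[of 0 0 0 0] by linarith
  fix \<epsilon> :: real assume "0 < \<epsilon>"
  \<comment> \<open>The mesh 1/m is fixed first, against the Lipschitz error; only then the number K
    of cells, against the exponentially small overflow, whose limit is taken for this m.\<close>
  have lim: "(\<lambda>m. L * (4 / real (Suc m))) \<longlonglongrightarrow> 0" by real_asymp
  have "\<forall>\<^sub>F m' in sequentially. L * (4 / real (Suc m')) < \<epsilon> / 2"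
    by (rule order_tendstoD(2)[OF lim]) (use \<open>0 < \<epsilon>\<close> in simp)
  then obtain m' where m': "L * (4 / real (Suc m')) < \<epsilon> / 2"
    unfolding eventually_sequentially by blast
  define m where "m = Suc m'"
  have m: "0 < m" "L * (4 / m) < \<epsilon> / 2" using m' by (auto simp: m_def)
  have "(\<lambda>K. 4 * B * exp (- ((real K - 1) / real m) / 2)) \<longlonglongrightarrow> 0" using m(1) by real_asymp
  then have "\<forall>\<^sub>F K in sequentially. 4 * B * exp (- grid m K / 2) < \<epsilon> / 2"
    unfolding grid_def by (rule order_tendstoD(2)) (use \<open>0 < \<epsilon>\<close> in auto)
  then have "\<forall>\<^sub>F K in sequentially. 4 * B * exp (- grid m K / 2) < \<epsilon> / 2 \<and> 0 < K"
    using eventually_gt_at_top[of 0] by eventually_elim auto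
  then obtain K where K: "4 * B * exp (- grid m K / 2) < \<epsilon> / 2" "0 < K"
    by (auto simp: eventually_sequentially)
  define p where "p i j n V \<omega> = (\<integral>\<zeta>. cell m i (real n * nextmsg \<omega> k V \<zeta>) * cell m j (real n * nextmsg \<omega> (Suc k) V \<zeta>) \<partial>iid)" for i j n V \<omega>
  have int_cell: "integrable iid (\<lambda>\<zeta>. cell m i (real n * nextmsg \<omega> k V \<zeta>) * cell m j (real n * nextmsg \<omega> (Suc k) V \<zeta>))"
    if "finite V" for i j n V \<omega>
    using that by (intro iid.integrable_const_bound[where B = 1])
      (auto simp: abs_mult cell_bounds mult_le_one intro!: borel_measurable_times measurable_cell measurable_nextmsg)
  have int_exceeds: "integrable iid (\<lambda>\<zeta>. exceeds x (real n * nextmsg \<omega> k V \<zeta>) * exceeds y (real n * nextmsg \<omega> (Suc k) V \<zeta>))"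
    if "finite V" for x y n V \<omega>
    using that by (intro iid.integrable_const_bound[where B = 1])
      (auto simp: abs_mult mult_le_one intro!: borel_measurable_times measurable_exceeds measurable_nextmsg)
  \<comment> \<open>Inclusion-exclusion: the mass of a rectangle is a signed sum of four quadrant
    tails.\<close>
  have p_tail: "p i j n V \<omega> = (pair_tail k (grid m i) (grid m j) n V \<omega> - pair_tail k (grid m i) (grid m (Suc j)) n V \<omega>) -
      (pair_tail k (grid m (Suc i)) (grid m j) n V \<omega> - pair_tail k (grid m (Suc i)) (grid m (Suc j)) n V \<omega>)" if "finite V" for i j n V \<omega>
    unfolding pair_tail_def p_def using int_exceeds[OF that]
    by (subst Bochner_Integration.integral_diff[symmetric],
        (auto intro!: Bochner_Integration.integrable_diff)[2],
        subst Bochner_Integration.integral_diff[symmetric],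
        (auto intro!: Bochner_Integration.integrable_diff)[2],
        subst Bochner_Integration.integral_diff[symmetric],
        (auto intro!: Bochner_Integration.integrable_diff)[2])
       (auto simp: cell_def algebra_simps intro!: Bochner_Integration.integral_cong)
  have p_bound: "\<bar>p i j n V \<omega>\<bar> \<le> 1" if "finite V" for i j n V \<omega>
  proof -
    have "0 \<le> p i j n V \<omega>" unfolding p_def by (intro Bochner_Integration.integral_nonneg) (auto simp: cell_bounds)
    moreover have "p i j n V \<omega> \<le> (\<integral>\<zeta>. 1 \<partial>(iid :: (nat \<Rightarrow> real) measure))"
      unfolding p_def using int_cell[OF that] by (intro integral_mono) (auto simp: cell_bounds mult_le_one)
    ultimately show ?thesis by simp
  qed
  have p_conv: "\<exists>q. conv1 (p i j) q" for i j
  proof -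
    obtain q1 q2 q3 q4 where "conv1 (pair_tail k (grid m i) (grid m j)) q1" "conv1 (pair_tail k (grid m i) (grid m (Suc j))) q2"
      "conv1 (pair_tail k (grid m (Suc i)) (grid m j)) q3" "conv1 (pair_tail k (grid m (Suc i)) (grid m (Suc j))) q4"
      using tails by metis
    then have "conv1 (\<lambda>n V \<omega>. (pair_tail k (grid m i) (grid m j) n V \<omega> - pair_tail k (grid m i) (grid m (Suc j)) n V \<omega>) -
      (pair_tail k (grid m (Suc i)) (grid m j) n V \<omega> - pair_tail k (grid m (Suc i)) (grid m (Suc j)) n V \<omega>)) ((q1 - q2) - (q3 - q4))"
      by (intro conv1_diff)
    then have "conv1 (p i j) ((q1 - q2) - (q3 - q4))"
    proof (rule conv1_cong)
      fix c
      show "\<forall>\<^sub>F (n, V) in nearly_full c. \<forall>\<omega>. p i j n V \<omega> = (pair_tail k (grid m i) (grid m j) n V \<omega> - pair_tail k (grid m i) (grid m (Suc j)) n V \<omega>) -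
      (pair_tail k (grid m (Suc i)) (grid m j) n V \<omega> - pair_tail k (grid m (Suc i)) (grid m (Suc j)) n V \<omega>)"
        using eventually_nearly_full_finite[of 0 c] by eventually_elim (auto simp: p_tail)
    qed
    then show ?thesis ..
  qed
  then obtain Q where Q: "\<And>i j. conv1 (p i j) (Q i j)" by metis
  let ?I = "{..<K} \<times> {..<K} \<times> {..<K} \<times> {..<K}"
  define F where "F s = f (real (fst s) / m) (real (fst (snd s)) / m) (real (fst (snd (snd s))) / m) (real (snd (snd (snd s))) / m)" for s
  define g' where "g' n V \<omega> = (\<Sum>s\<in>?I. F s * (p (fst s) (fst (snd s)) n V \<omega> * p (fst (snd (snd s))) (snd (snd (snd s))) n V \<omega>))" for n V \<omega>
  have conv: "conv1 g' (\<Sum>s\<in>?I. F s * (Q (fst s) (fst (snd s)) * Q (fst (snd (snd s))) (snd (snd (snd s)))))"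
    unfolding g'_def
  proof (intro conv1_sum conv1_cmult conv1_mult Q)
    fix s :: "nat \<times> nat \<times> nat \<times> nat" and c
    show "\<forall>\<^sub>F (n, V) in nearly_full c. \<forall>\<omega>. \<bar>p (fst s) (fst (snd s)) n V \<omega>\<bar> \<le> 1 \<and> \<bar>p (fst (snd (snd s))) (snd (snd (snd s))) n V \<omega>\<bar> \<le> 1"
      using eventually_nearly_full_finite[of 0 c] by eventually_elim (auto simp: p_bound)
  qed auto
  have close: "\<bar>quadexp f k n V \<omega> - g' n V \<omega>\<bar> \<le> \<epsilon>"
    if V: "finite V" "V \<noteq> {}" and n: "0 < n" "n \<le> 2 * card V" for n V \<omega>
  proof -
    define a where "a = (\<lambda>\<zeta>. real n * nextmsg \<omega> k V \<zeta>)"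
    define b where "b = (\<lambda>\<zeta>. real n * nextmsg \<omega> (Suc k) V \<zeta>)"
    have [measurable]: "a \<in> borel_measurable iid" "b \<in> borel_measurable iid"
      using V by (auto simp: a_def b_def intro!: borel_measurable_times measurable_nextmsg)
    have nn: "0 \<le> a \<zeta>" "0 \<le> b \<zeta>" for \<zeta> using V by (auto simp: a_def b_def)
    have int_f: "integrable (iid \<Otimes>\<^sub>M iid) (\<lambda>x. f (a (fst x)) (b (fst x)) (a (snd x)) (b (snd x)))"
      using quadexp_integrable_inner[OF lip B V(1), of n \<omega> k] by (simp add: a_def b_def)
    have ab: "quadexp f k n V \<omega> = (\<integral>x. f (a (fst x)) (b (fst x)) (a (snd x)) (b (snd x)) \<partial>(iid \<Otimes>\<^sub>M iid))"
      using quadexp_pair[OF quadexp_integrable_inner[OF lip B V(1), of n \<omega> k]] by (simp add: a_def b_def)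
    have cells: "integrable (iid \<Otimes>\<^sub>M iid) (\<lambda>x. (cell m i (a (fst x)) * cell m j (b (fst x))) * (cell m i' (a (snd x)) * cell m j' (b (snd x))))"
      "(\<integral>x. (cell m i (a (fst x)) * cell m j (b (fst x))) * (cell m i' (a (snd x)) * cell m j' (b (snd x))) \<partial>(iid \<Otimes>\<^sub>M iid)) = p i j n V \<omega> * p i' j' n V \<omega>" for i j i' j'
    proof -
      show i: "integrable (iid \<Otimes>\<^sub>M iid) (\<lambda>x. (cell m i (a (fst x)) * cell m j (b (fst x))) * (cell m i' (a (snd x)) * cell m j' (b (snd x))))"
        by (rule iid_pair.P.integrable_const_bound[where B = 1])
           (auto simp: abs_mult cell_bounds intro!: mult_le_one)
      show "(\<integral>x. (cell m i (a (fst x)) * cell m j (b (fst x))) * (cell m i' (a (snd x)) * cell m j' (b (snd x))) \<partial>(iid \<Otimes>\<^sub>M iid)) = p i j n V \<omega> * p i' j' n V \<omega>"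
        using iid_pair.integral_fst'[OF i] by (simp add: p_def a_def b_def)
    qed
    have int_step: "integrable (iid \<Otimes>\<^sub>M iid) (\<lambda>x. stepf f m K (a (fst x)) (b (fst x)) (a (snd x)) (b (snd x)))"
      unfolding stepf_def by (intro Bochner_Integration.integrable_sum integrable_mult_right cells)
    have g': "g' n V \<omega> = (\<integral>x. stepf f m K (a (fst x)) (b (fst x)) (a (snd x)) (b (snd x)) \<partial>(iid \<Otimes>\<^sub>M iid))"
      unfolding stepf_def g'_def F_def
      by (subst Bochner_Integration.integral_sum) (auto intro!: integrable_mult_right cells simp: cells(2) simp del: mult_eq_0_iff)
    let ?R = "\<lambda>x. L * (4 / m) + B * (exceeds (grid m K) (a (fst x)) + exceeds (grid m K) (b (fst x)) + exceeds (grid m K) (a (snd x)) + exceeds (grid m K) (b (snd x)))"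
    have ia: "integrable iid (\<lambda>\<zeta>. exceeds (grid m K) (a \<zeta>))" "integrable iid (\<lambda>\<zeta>. exceeds (grid m K) (b \<zeta>))"
      by (auto intro!: iid.integrable_const_bound[where B = 1])
    let ?PP = "(iid :: (nat \<Rightarrow> real) measure) \<Otimes>\<^sub>M (iid :: (nat \<Rightarrow> real) measure)"
    have iab: "integrable ?PP (\<lambda>x. exceeds (grid m K) (a (fst x)))" "integrable ?PP (\<lambda>x. exceeds (grid m K) (b (fst x)))"
       "integrable ?PP (\<lambda>x. exceeds (grid m K) (a (snd x)))" "integrable ?PP (\<lambda>x. exceeds (grid m K) (b (snd x)))"
      by (auto intro!: iid_pair.P.integrable_const_bound[where B = 1])
    have "\<bar>quadexp f k n V \<omega> - g' n V \<omega>\<bar> \<le> (\<integral>x. \<bar>f (a (fst x)) (b (fst x)) (a (snd x)) (b (snd x)) - stepf f m K (a (fst x)) (b (fst x)) (a (snd x)) (b (snd x))\<bar> \<partial>(iid \<Otimes>\<^sub>M iid))"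
      unfolding ab g' Bochner_Integration.integral_diff[OF int_f int_step, symmetric] by (rule integral_abs_bound)
    also have "\<dots> \<le> (\<integral>x. ?R x \<partial>(iid \<Otimes>\<^sub>M iid))"
      by (intro integral_mono stepf_approx[OF lip \<open>0 \<le> L\<close> B m(1)] nn integrable_abs
            Bochner_Integration.integrable_diff int_f int_step Bochner_Integration.integrable_add integrable_mult_right iab) auto
    also have "\<dots> = L * (4 / m) + B * ((\<integral>\<zeta>. exceeds (grid m K) (a \<zeta>) \<partial>iid) + (\<integral>\<zeta>. exceeds (grid m K) (b \<zeta>) \<partial>iid) + (\<integral>\<zeta>. exceeds (grid m K) (a \<zeta>) \<partial>iid) + (\<integral>\<zeta>. exceeds (grid m K) (b \<zeta>) \<partial>iid))"
      using iab iid_pair.integral_fst'[OF iab(1)] iid_pair.integral_fst'[OF iab(2)] iid_pair.integral_fst'[OF iab(3)] iid_pair.integral_fst'[OF iab(4)]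
      by simp
    also have "\<dots> \<le> L * (4 / m) + B * (exp (- grid m K / 2) + exp (- grid m K / 2) + exp (- grid m K / 2) + exp (- grid m K / 2))"
      unfolding a_def b_def using V n K \<open>0 \<le> B\<close>
      by (intro add_mono mult_left_mono nextmsg_exceeds order_refl) (auto simp: grid_def)
    also have "\<dots> = L * (4 / m) + 4 * B * exp (- grid m K / 2)" by simp
    also have "\<dots> < \<epsilon>" using m(2) K(1) by linarith
    finally show ?thesis by simp
  qed
  show "\<exists>g' q'. conv1 g' q' \<and> (\<forall>c. \<forall>\<^sub>F (n, V) in nearly_full c. (\<integral>\<omega>. \<bar>quadexp f k n V \<omega> - g' n V \<omega>\<bar> \<partial>iid) \<le> \<epsilon>)"
  proof (intro exI conjI allI)
    show "conv1 g' (\<Sum>s\<in>?I. F s * (Q (fst s) (fst (snd s)) * Q (fst (snd (snd s))) (snd (snd (snd s)))))" by (rule conv)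
    fix c
    show "\<forall>\<^sub>F (n, V) in nearly_full c. (\<integral>\<omega>. \<bar>quadexp f k n V \<omega> - g' n V \<omega>\<bar> \<partial>iid) \<le> \<epsilon>"
      using eventually_nearly_full_finite[of 1 c] conv1D(1)[OF conv, of c]
    proof (eventually_elim, unfold split_beta, elim conjE)
      fix x :: "nat \<times> nat set" assume *: "finite (snd x)" "1 \<le> card (snd x)" "fst x \<le> 2 * card (snd x)" "0 < fst x" "integrable iid (g' (fst x) (snd x))"
      have "integrable iid (quadexp f k (fst x) (snd x))"
        using * quadexp_bound[OF lip B] measurable_quadexp[OF lip] by (intro iid.integrable_const_bound[where B = B]) auto
      then have "(\<integral>\<omega>. \<bar>quadexp f k (fst x) (snd x) \<omega> - g' (fst x) (snd x) \<omega>\<bar> \<partial>iid) \<le> (\<integral>\<omega>. \<epsilon> \<partial>(iid :: (nat set \<Rightarrow> real) measure))"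
        using * by (intro integral_mono close) auto
      then show "(\<integral>\<omega>. \<bar>quadexp f k (fst x) (snd x) \<omega> - g' (fst x) (snd x) \<omega>\<bar> \<partial>iid) \<le> \<epsilon>" by simp
    qed
  qed
qed

subsection \<open>Law of large numbers for the messages\<close>

lemma nextmsg_star_other: "v \<notin> W \<Longrightarrow> nextmsg (star_upd v V \<zeta> \<omega>) k W \<eta> = nextmsg \<omega> k W \<eta>"
  by (cases k) (auto simp: nextmsg_def samsg_star_other intro!: minmsg_cong)

text \<open>The message at u ignores v and vice versa, so neither looks at the edge {u, v}.
  Resampling the star at v and then the star at u therefore produces two independent new vertices
  over the same W.\<close>

lemma quad_resample:
  assumes "u \<notin> W" "v \<notin> W" "u \<noteq> v"
    and int: "integrable iid (\<lambda>\<omega>. f (real n * samsg \<omega> k (insert u W) u) (real n * samsg \<omega> (Suc k) (insert u W) u)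
      (real n * samsg \<omega> k (insert v W) v) (real n * samsg \<omega> (Suc k) (insert v W) v))"
  shows "integrable iid (quadexp f k n W)"
    and "(\<integral>\<omega>. f (real n * samsg \<omega> k (insert u W) u) (real n * samsg \<omega> (Suc k) (insert u W) u)
      (real n * samsg \<omega> k (insert v W) v) (real n * samsg \<omega> (Suc k) (insert v W) v) \<partial>iid) = (\<integral>\<omega>. quadexp f k n W \<omega> \<partial>iid)"
proof -
  define g where "g \<omega> = (\<integral>\<eta>. f (real n * samsg \<omega> k (insert u W) u) (real n * samsg \<omega> (Suc k) (insert u W) u)
      (real n * nextmsg \<omega> k W \<eta>) (real n * nextmsg \<omega> (Suc k) W \<eta>) \<partial>iid)" for \<omega>
  have v: "samsg (star_upd v W \<eta> \<omega>) j (insert u W) u = samsg \<omega> j (insert u W) u" for j \<eta> \<omega>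
    using assms by (intro samsg_star_other) auto
  note r1 = integrable_resample[OF \<open>v \<notin> W\<close> int, unfolded samsg_star_nextmsg[OF \<open>v \<notin> W\<close> subset_refl] v, folded g_def]
  have g: "g (star_upd u W \<zeta> \<omega>) = (\<integral>\<eta>. f (real n * nextmsg \<omega> k W \<zeta>) (real n * nextmsg \<omega> (Suc k) W \<zeta>)
      (real n * nextmsg \<omega> k W \<eta>) (real n * nextmsg \<omega> (Suc k) W \<eta>) \<partial>iid)" for \<zeta> \<omega>
    unfolding g_def samsg_star_nextmsg[OF \<open>u \<notin> W\<close> subset_refl] nextmsg_star_other[OF \<open>u \<notin> W\<close>] ..
  note r2 = integrable_resample[OF \<open>u \<notin> W\<close> r1(2), unfolded g]
  show "integrable iid (quadexp f k n W)"
    using r2(2) by (simp add: quadexp_def[abs_def])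
  show "(\<integral>\<omega>. f (real n * samsg \<omega> k (insert u W) u) (real n * samsg \<omega> (Suc k) (insert u W) u)
      (real n * samsg \<omega> k (insert v W) v) (real n * samsg \<omega> (Suc k) (insert v W) v) \<partial>iid) = (\<integral>\<omega>. quadexp f k n W \<omega> \<partial>iid)"
    unfolding r1(3) r2(3) by (simp add: quadexp_def)
qed

lemma nearly_full_ratio: "((\<lambda>(n, V). real (card V) / real n) \<longlongrightarrow> 1) (nearly_full c)"
proof (rule tendsto_sandwich[OF _ _ _ tendsto_const])
  have "(\<lambda>n. 1 - real c / real n) \<longlonglongrightarrow> 1" by real_asymp
  then show "((\<lambda>(n, V). 1 - real c / real n) \<longlongrightarrow> 1) (nearly_full c)" by (rule tendsto_nearly_full)
  show "\<forall>\<^sub>F x in nearly_full c. (case x of (n, V) \<Rightarrow> 1 - real c / real n) \<le> (case x of (n, V) \<Rightarrow> real (card V) / real n)"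
    using eventually_nearly_full_finite[of 0 c]
  proof (eventually_elim, clarify)
    fix n and V :: "nat set" assume "0 < n" "n \<le> card V + c"
    then have "1 - real c / n = (real n - c) / n" "real n - c \<le> card V" by (auto simp: field_simps)
    then show "1 - real c / real n \<le> real (card V) / real n" by (simp add: divide_right_mono)
  qed
  show "\<forall>\<^sub>F x in nearly_full c. (case x of (n, V) \<Rightarrow> real (card V) / real n) \<le> 1"
    using eventually_nearly_full_finite[of 0 c] by eventually_elim auto
qed

section \<open>Conditional joint tails and their exponents\<close>

text \<open>The exponent of the joint tail one step later. Levels are divided by n because messages
  are unscaled here, and a negative level contributes threshold 0, meaning no condition.\<close>

definition load :: "nat \<Rightarrow> real \<Rightarrow> real \<Rightarrow> nat \<Rightarrow> nat set \<Rightarrow> (nat set \<Rightarrow> real) \<Rightarrow> real" where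
  "load k x y n V \<omega> = (\<Sum>t\<in>V. max (if x < 0 then 0 else x / n + samsg \<omega> k V t) (if y < 0 then 0 else y / n + samsg \<omega> (Suc k) V t))"

lemma load_nonneg: "finite V \<Longrightarrow> 0 \<le> load k x y n V \<omega>"
  unfolding load_def by (intro sum_nonneg) (auto simp: max_def intro!: add_nonneg_nonneg)

lemma pair_tail_measure:
  assumes "finite V" "0 < n"
  shows "pair_tail k x y n V \<omega> = measure iid {\<zeta>. x / n < nextmsg \<omega> k V \<zeta> \<and> y / n < nextmsg \<omega> (Suc k) V \<zeta>}"
proof -
  have [measurable]: "(\<lambda>\<zeta>. nextmsg \<omega> j V \<zeta>) \<in> borel_measurable iid" for j
    using assms by (intro measurable_nextmsg) auto
  have "pair_tail k x y n V \<omega> = (\<integral>\<zeta>. indicator {\<zeta>. x / n < nextmsg \<omega> k V \<zeta> \<and> y / n < nextmsg \<omega> (Suc k) V \<zeta>} \<zeta> \<partial>iid)"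
    unfolding pair_tail_def using assms
    by (intro Bochner_Integration.integral_cong) (auto simp: exceeds_def indicator_def field_simps)
  then show ?thesis by simp
qed

text \<open>This closes the recursion: the law of the next pair of messages depends on the current
  ones only through a sum over V, to which a law of large numbers applies.\<close>

lemma pair_tail_Suc:
  assumes "finite V" "V \<noteq> {}" "0 < n"
  shows "pair_tail (Suc k) x y n V \<omega> = exp (- load k x y n V \<omega>)"
proof -
  have "x / n < 0 \<longleftrightarrow> x < 0" "y / n < 0 \<longleftrightarrow> y < 0" using assms(3) by (auto simp: divide_less_0_iff)
  then show ?thesis
    unfolding pair_tail_measure[OF assms(1,3)] nextmsg_def load_def
    using measure_minmsg_greater2[OF assms(1,2), of "samsg \<omega> k V" "samsg \<omega> (Suc k) V" "x / n" "y / n"] assms(1)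
    by (simp del: samsg.simps)
qed

text \<open>Message 0 is constantly 0, so x enters only by its sign, and message 1 is a plain
  minimum of exponential costs.\<close>

lemma pair_tail_0:
  assumes "finite V" "V \<noteq> {}" "0 < n"
  shows "pair_tail 0 x y n V \<omega> = (if 0 \<le> x then 0 else if y < 0 then 1 else exp (- (card V / n * y)))"
proof -
  have neg: "y / n < minmsg V a \<zeta>" if "y < 0" for a \<zeta>
  proof -
    have "y / n < 0" using that assms by (simp add: divide_less_0_iff)
    then show ?thesis using minmsg_nonneg[OF assms(1), of a \<zeta>] by linarith
  qed
  have "x / n < 0 \<longleftrightarrow> x < 0" using assms(3) by (auto simp: divide_less_0_iff)
  moreover have "measure iid {\<zeta>. y / n < minmsg V (\<lambda>_. 0) \<zeta>} = exp (- (card V / n * y))" if "0 \<le> y"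
    using measure_minmsg_greater[OF assms(1,2), of "\<lambda>_. 0" "y / n"] that by simp
  ultimately show ?thesis
    unfolding pair_tail_measure[OF assms(1,3)] nextmsg_def using neg by (auto simp: not_le not_less)
qed

lemma pair_tail_0_conv: "\<exists>q. conv1 (pair_tail 0 x y) q"
proof -
  define q where "q = (if 0 \<le> x then 0 else if y < 0 then 1 else exp (- y))"
  have "conv1 (pair_tail 0 x y) q"
  proof (rule conv1I[where b = "\<lambda>n V. \<bar>exp (- (real (card V) / real n * y)) - exp (- y)\<bar>"])
    fix c
    show "\<forall>\<^sub>F (n, V) in nearly_full c. integrable iid (pair_tail 0 x y n V) \<and> (\<integral>\<omega>. \<bar>pair_tail 0 x y n V \<omega> - q\<bar> \<partial>iid) \<le> \<bar>exp (- (real (card V) / real n * y)) - exp (- y)\<bar>"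
      using eventually_nearly_full_finite[of 1 c]
    proof (eventually_elim, unfold split_beta, elim conjE)
      fix z :: "nat \<times> nat set" assume "finite (snd z)" "1 \<le> card (snd z)" "0 < fst z"
      then have "pair_tail 0 x y (fst z) (snd z) = (\<lambda>\<omega>. if 0 \<le> x then 0 else if y < 0 then 1 else exp (- (card (snd z) / fst z * y)))"
        by (intro ext pair_tail_0) auto
      then show "integrable iid (pair_tail 0 x y (fst z) (snd z)) \<and> (\<integral>\<omega>. \<bar>pair_tail 0 x y (fst z) (snd z) \<omega> - q\<bar> \<partial>iid) \<le> \<bar>exp (- (real (card (snd z)) / real (fst z) * y)) - exp (- y)\<bar>"
        by (simp add: q_def)
    qed
    have "((\<lambda>z. \<bar>exp (- ((case z of (n, V) \<Rightarrow> real (card V) / real n) * y)) - exp (- y)\<bar>) \<longlongrightarrow> \<bar>exp (- (1 * y)) - exp (- y)\<bar>) (nearly_full c)"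
      by (intro tendsto_intros nearly_full_ratio)
    then show "((\<lambda>(n, V). \<bar>exp (- (real (card V) / real n * y)) - exp (- y)\<bar>) \<longlongrightarrow> 0) (nearly_full c)"
      by (simp add: case_prod_unfold)
  qed
  then show ?thesis ..
qed

lemma iid_abs_le_sqrt:
  fixes X :: "(nat set \<Rightarrow> real) \<Rightarrow> real"
  assumes "integrable iid X" "integrable iid (\<lambda>\<omega>. (X \<omega>)\<^sup>2)"
  shows "(\<integral>\<omega>. \<bar>X \<omega>\<bar> \<partial>iid) \<le> sqrt (\<integral>\<omega>. (X \<omega>)\<^sup>2 \<partial>iid)"
proof (rule real_le_rsqrt)
  have "0 \<le> iid.variance (\<lambda>\<omega>. \<bar>X \<omega>\<bar>)" by (rule iid.variance_positive)
  also have "\<dots> = (\<integral>\<omega>. (X \<omega>)\<^sup>2 \<partial>iid) - (\<integral>\<omega>. \<bar>X \<omega>\<bar> \<partial>iid)\<^sup>2"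
    using assms by (subst iid.variance_eq) auto
  finally show "(\<integral>\<omega>. \<bar>X \<omega>\<bar> \<partial>iid)\<^sup>2 \<le> (\<integral>\<omega>. (X \<omega>)\<^sup>2 \<partial>iid)" by simp
qed

lemma quadexp_pair_only:
  "quadexp (\<lambda>a b c d. h a b) k n V \<omega> = (\<integral>\<zeta>. h (real n * nextmsg \<omega> k V \<zeta>) (real n * nextmsg \<omega> (Suc k) V \<zeta>) \<partial>iid)"
  by (simp add: quadexp_def)

text \<open>Conditional independence of the two new vertices, the source of decorrelation in the
  second moment computation.\<close>

lemma quadexp_product:
  "quadexp (\<lambda>a b c d. h a b * h c d) k n V \<omega> = (quadexp (\<lambda>a b c d. h a b) k n V \<omega>)\<^sup>2"
  by (simp add: quadexp_def power2_eq_square)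

lemma quadexp_shift:
  assumes "lip4 L (\<lambda>a b c d. h a b)" "\<And>a b. \<bar>h a b\<bar> \<le> B" "finite V"
  shows "quadexp (\<lambda>a b c d. h a b - q) k n V \<omega> = quadexp (\<lambda>a b c d. h a b) k n V \<omega> - q"
proof -
  have "(\<lambda>\<zeta>. h (real n * nextmsg \<omega> k V \<zeta>) (real n * nextmsg \<omega> (Suc k) V \<zeta>)) \<in> borel_measurable iid"
    using assms by (intro lip4_measurable[OF assms(1), where C = "\<lambda>_. 0" and D = "\<lambda>_. 0"]) auto
  then have "integrable iid (\<lambda>\<zeta>. h (real n * nextmsg \<omega> k V \<zeta>) (real n * nextmsg \<omega> (Suc k) V \<zeta>))"
    using assms(2) by (intro iid.integrable_const_bound[where B = B]) auto
  then show ?thesis unfolding quadexp_pair_only by simp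
qed

text \<open>Second moment method: for \<open>u \<noteq> u'\<close> the messages at \<open>u\<close> in
  \<open>V - {u'}\<close> and at \<open>u'\<close> in \<open>V - {u}\<close> are conditionally independent given the costs inside
  \<open>V - {u, u'}\<close>.\<close>

lemma lip4D:
  "lip4 L f \<Longrightarrow> \<bar>f a b c d - f a' b' c' d'\<bar> \<le> L * (\<bar>a - a'\<bar> + \<bar>b - b'\<bar> + \<bar>c - c'\<bar> + \<bar>d - d'\<bar>)"
  by (simp add: lip4_def)

text \<open>In the second moment the n diagonal terms are divided by n^2. Off the diagonal, passing
  to the vertex sets without the other vertex costs O(1/n), n being the scale of the messages and
  O(1/n^2) their sensitivity; what remains is the mean of (\<open>quadexp\<close> - q)^2, at most C
  times the mean of its absolute deviation.\<close>

lemma average_conv: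
  assumes lip: "lip4 L (\<lambda>a b c d. h a b)" and L: "0 \<le> L" and B: "\<And>a b. \<bar>h a b\<bar> \<le> B"
    and q: "conv1 (quadexp (\<lambda>a b c d. h a b) k) q"
  shows "conv1 (\<lambda>n V \<omega>. (\<Sum>u\<in>V. h (real n * samsg \<omega> k V u) (real n * samsg \<omega> (Suc k) V u)) / n) q"
proof -
  have "0 \<le> B" using B[of 0 0] by linarith
  define C where "C = B + \<bar>q\<bar>"
  have "0 \<le> C" using \<open>0 \<le> B\<close> by (simp add: C_def)
  define H where "H n V u \<omega> = h (real n * samsg \<omega> k V u) (real n * samsg \<omega> (Suc k) V u) - q" for n V u \<omega>
  have HC: "\<bar>H n V u \<omega>\<bar> \<le> C" for n V u \<omega>
    using B[of "real n * samsg \<omega> k V u" "real n * samsg \<omega> (Suc k) V u"] unfolding H_def C_def by linarith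
  have [measurable]: "H n V u \<in> borel_measurable iid" if "finite V" for n V u
  proof -
    have "(\<lambda>\<omega>. h (real n * samsg \<omega> k V u) (real n * samsg \<omega> (Suc k) V u)) \<in> borel_measurable iid"
      using that by (intro lip4_measurable[OF lip, where C = "\<lambda>_. 0" and D = "\<lambda>_. 0"] borel_measurable_times measurable_samsg) auto
    then show ?thesis unfolding H_def[abs_def] by measurable
  qed
  have H2: "\<bar>H n V u \<omega> * H n V' u' \<omega>\<bar> \<le> C * C" for n V u \<omega> V' u'
    unfolding abs_mult by (intro mult_mono HC) (use \<open>0 \<le> C\<close> in auto)
  have intHH: "integrable iid (\<lambda>\<omega>. H n V u \<omega> * H n V' u' \<omega>)" if "finite V" "finite V'" for n V u V' u'
    using that H2 by (intro iid.integrable_const_bound[where B = "C * C"]) auto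
  define r where "r n V = (\<Sum>u\<in>V. \<Sum>u'\<in>V. \<integral>\<omega>. H n V u \<omega> * H n V u' \<omega> \<partial>iid) / (real n)\<^sup>2" for n V
  \<comment> \<open>Both steps k and k + 1 enter; the sensitivity of each is bounded with the
    smaller denominator, the one belonging to k + 1.\<close>
  have off: "(\<integral>\<omega>. H n V u \<omega> * H n V u' \<omega> \<partial>iid) \<le> 2 * C * (L * (real n * (2 * k + 2 * Suc k) / (real (card V) - 2 - k)\<^sup>2)) +
      C * (\<integral>\<omega>. \<bar>quadexp (\<lambda>a b c d. h a b) k n (V - {u, u'}) \<omega> - q\<bar> \<partial>iid)"
    if V: "finite V" "k + 3 \<le> card V" and u: "u \<in> V" "u' \<in> V" "u \<noteq> u'"
      and intq: "integrable iid (quadexp (\<lambda>a b c d. h a b) k n (V - {u, u'}))" for n V u u'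
  proof -
    define W where "W = V - {u, u'}"
    have W: "u \<notin> W" "u' \<notin> W" "insert u W = V - {u'}" "insert u' W = V - {u}" "finite W"
      using u V by (auto simp: W_def)
    have sens: "(\<integral>\<omega>. \<bar>H n V v \<omega> - H n (V - {v'}) v \<omega>\<bar> \<partial>iid) \<le> L * (real n * (2 * k + 2 * Suc k) / (real (card V) - 2 - k)\<^sup>2)"
      if v: "v \<in> V" "v' \<in> V" "v \<noteq> v'" for v v'
    proof -
      have card: "card (V - {v}) = card V - 1" "card (V - {v'} - {v}) = card V - 2"
        using v V by (auto simp: card_Diff_singleton)
      then have "0 < card (V - {v})" "0 < card (V - {v'} - {v})" using V by linarith+
      then have ne: "V - {v} \<noteq> {}" "V - {v'} - {v} \<noteq> {}" by (metis card.empty less_irrefl)+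
      have int: "integrable iid (\<lambda>\<omega>. \<bar>samsg \<omega> j V v - samsg \<omega> j (V - {v'}) v\<bar>)" for j
        using V ne by (intro integrable_abs Bochner_Integration.integrable_diff samsg_integrable) auto
      have "(\<integral>\<omega>. \<bar>H n V v \<omega> - H n (V - {v'}) v \<omega>\<bar> \<partial>iid) \<le>
         (\<integral>\<omega>. L * (real n * \<bar>samsg \<omega> k V v - samsg \<omega> k (V - {v'}) v\<bar> + real n * \<bar>samsg \<omega> (Suc k) V v - samsg \<omega> (Suc k) (V - {v'}) v\<bar>) \<partial>iid)"
      proof (rule integral_mono)
        show "integrable iid (\<lambda>\<omega>. \<bar>H n V v \<omega> - H n (V - {v'}) v \<omega>\<bar>)"
          using V HC by (intro integrable_abs Bochner_Integration.integrable_diff iid.integrable_const_bound[where B = C]) auto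
        show "integrable iid (\<lambda>\<omega>. L * (real n * \<bar>samsg \<omega> k V v - samsg \<omega> k (V - {v'}) v\<bar> + real n * \<bar>samsg \<omega> (Suc k) V v - samsg \<omega> (Suc k) (V - {v'}) v\<bar>))"
          by (intro integrable_mult_right Bochner_Integration.integrable_add int)
        fix \<omega>
        have "\<bar>H n V v \<omega> - H n (V - {v'}) v \<omega>\<bar> \<le> L * (\<bar>real n * samsg \<omega> k V v - real n * samsg \<omega> k (V - {v'}) v\<bar> +
            \<bar>real n * samsg \<omega> (Suc k) V v - real n * samsg \<omega> (Suc k) (V - {v'}) v\<bar> + \<bar>0 - 0\<bar> + \<bar>0 - 0\<bar>)"
          using lip4D[OF lip, where a = "real n * samsg \<omega> k V v" and b = "real n * samsg \<omega> (Suc k) V v" and c = 0 and d = 0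
             and a' = "real n * samsg \<omega> k (V - {v'}) v" and b' = "real n * samsg \<omega> (Suc k) (V - {v'}) v" and c' = 0 and d' = 0]
          by (simp add: H_def del: samsg.simps)
        then show "\<bar>H n V v \<omega> - H n (V - {v'}) v \<omega>\<bar> \<le> L * (real n * \<bar>samsg \<omega> k V v - samsg \<omega> k (V - {v'}) v\<bar> + real n * \<bar>samsg \<omega> (Suc k) V v - samsg \<omega> (Suc k) (V - {v'}) v\<bar>)"
          by (simp add: abs_mult del: samsg.simps flip: right_diff_distrib)
      qed
      also have "\<dots> = L * (real n * (\<integral>\<omega>. \<bar>samsg \<omega> k V v - samsg \<omega> k (V - {v'}) v\<bar> \<partial>iid) + real n * (\<integral>\<omega>. \<bar>samsg \<omega> (Suc k) V v - samsg \<omega> (Suc k) (V - {v'}) v\<bar> \<partial>iid))"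
        using int[of k] int[of "Suc k"] by (simp del: samsg.simps)
      also have "\<dots> \<le> L * (real n * (2 * k / (real (card V) - 1 - k)\<^sup>2) + real n * (2 * Suc k / (real (card V) - 1 - Suc k)\<^sup>2))"
        using samsg_sensitivity[of V v v' k] samsg_sensitivity[of V v v' "Suc k"] V v
        by (intro mult_left_mono add_mono L) (simp_all del: samsg.simps)
      also have "\<dots> \<le> L * (real n * (2 * k / (real (card V) - 2 - k)\<^sup>2) + real n * (2 * Suc k / (real (card V) - 2 - k)\<^sup>2))"
        using V by (intro mult_left_mono add_mono divide_left_mono power_mono L) auto
      also have "\<dots> = L * (real n * (2 * k + 2 * Suc k) / (real (card V) - 2 - k)\<^sup>2)"
        by (simp only: add_divide_distrib times_divide_eq_right distrib_left of_nat_add of_nat_mult)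
      finally show ?thesis .
    qed
    have intH: "integrable iid (H n V v)" "integrable iid (H n (V - {v'}) v)" for v v'
      using V HC by (auto intro!: iid.integrable_const_bound[where B = C])
    have "(\<integral>\<omega>. H n V u \<omega> * H n V u' \<omega> \<partial>iid) \<le> (\<integral>\<omega>. (C * \<bar>H n V u \<omega> - H n (V - {u'}) u \<omega>\<bar> + C * \<bar>H n V u' \<omega> - H n (V - {u}) u' \<omega>\<bar>) + H n (V - {u'}) u \<omega> * H n (V - {u}) u' \<omega> \<partial>iid)"
    proof (rule integral_mono)
      fix \<omega>
      have "H n V u \<omega> * H n V u' \<omega> = (H n V u \<omega> - H n (V - {u'}) u \<omega>) * H n V u' \<omega> + H n (V - {u'}) u \<omega> * (H n V u' \<omega> - H n (V - {u}) u' \<omega>) + H n (V - {u'}) u \<omega> * H n (V - {u}) u' \<omega>"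
        by (simp add: algebra_simps)
      moreover have "(H n V u \<omega> - H n (V - {u'}) u \<omega>) * H n V u' \<omega> \<le> \<bar>H n V u \<omega> - H n (V - {u'}) u \<omega>\<bar> * C"
        by (rule order_trans[OF abs_ge_self]) (auto simp: abs_mult intro!: mult_left_mono HC)
      moreover have "H n (V - {u'}) u \<omega> * (H n V u' \<omega> - H n (V - {u}) u' \<omega>) \<le> C * \<bar>H n V u' \<omega> - H n (V - {u}) u' \<omega>\<bar>"
        by (rule order_trans[OF abs_ge_self]) (auto simp: abs_mult intro!: mult_right_mono HC)
      ultimately show "H n V u \<omega> * H n V u' \<omega> \<le> (C * \<bar>H n V u \<omega> - H n (V - {u'}) u \<omega>\<bar> + C * \<bar>H n V u' \<omega> - H n (V - {u}) u' \<omega>\<bar>) + H n (V - {u'}) u \<omega> * H n (V - {u}) u' \<omega>"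
        by (simp add: mult.commute)
    qed (use V intHH intH in \<open>auto intro!: Bochner_Integration.integrable_add integrable_mult_right integrable_abs Bochner_Integration.integrable_diff\<close>)
    also have "\<dots> = (C * (\<integral>\<omega>. \<bar>H n V u \<omega> - H n (V - {u'}) u \<omega>\<bar> \<partial>iid) + C * (\<integral>\<omega>. \<bar>H n V u' \<omega> - H n (V - {u}) u' \<omega>\<bar> \<partial>iid)) + (\<integral>\<omega>. H n (V - {u'}) u \<omega> * H n (V - {u}) u' \<omega> \<partial>iid)"
      using V intHH intH by simp
    also have "(\<integral>\<omega>. H n (V - {u'}) u \<omega> * H n (V - {u}) u' \<omega> \<partial>iid) = (\<integral>\<omega>. quadexp (\<lambda>a b c d. (h a b - q) * (h c d - q)) k n W \<omega> \<partial>iid)"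
      using quad_resample(2)[OF W(1,2) \<open>u \<noteq> u'\<close>, of "\<lambda>a b c d. (h a b - q) * (h c d - q)" n k] intHH[of "V - {u'}" "V - {u}" n u u'] V
      unfolding W H_def by simp
    \<comment> \<open>By conditional independence the product of the two centred factors averages to
      a square.\<close>
    also have "\<dots> = (\<integral>\<omega>. (quadexp (\<lambda>a b c d. h a b) k n W \<omega> - q)\<^sup>2 \<partial>iid)"
      by (simp only: quadexp_product quadexp_shift[OF lip B W(5)])
    finally have le1: "(\<integral>\<omega>. H n V u \<omega> * H n V u' \<omega> \<partial>iid) \<le>
      (C * (\<integral>\<omega>. \<bar>H n V u \<omega> - H n (V - {u'}) u \<omega>\<bar> \<partial>iid) + C * (\<integral>\<omega>. \<bar>H n V u' \<omega> - H n (V - {u}) u' \<omega>\<bar> \<partial>iid)) + (\<integral>\<omega>. (quadexp (\<lambda>a b c d. h a b) k n W \<omega> - q)\<^sup>2 \<partial>iid)" .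
    have le2: "(\<integral>\<omega>. (quadexp (\<lambda>a b c d. h a b) k n W \<omega> - q)\<^sup>2 \<partial>iid) \<le> (\<integral>\<omega>. C * \<bar>quadexp (\<lambda>a b c d. h a b) k n W \<omega> - q\<bar> \<partial>iid)"
    proof (rule integral_mono)
      have qB: "\<bar>quadexp (\<lambda>a b c d. h a b) k n W \<omega> - q\<bar> \<le> C" for \<omega>
        using quadexp_bound[OF lip B W(5), of k n \<omega>] unfolding C_def by linarith
      have [measurable]: "quadexp (\<lambda>a b c d. h a b) k n W \<in> borel_measurable iid"
        by (rule measurable_quadexp[OF lip W(5)])
      show "integrable iid (\<lambda>\<omega>. (quadexp (\<lambda>a b c d. h a b) k n W \<omega> - q)\<^sup>2)"
        using qB by (intro iid.integrable_const_bound[where B = "C\<^sup>2"]) (auto simp: power2_le_iff_abs_le \<open>0 \<le> C\<close>)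
      show "integrable iid (\<lambda>\<omega>. C * \<bar>quadexp (\<lambda>a b c d. h a b) k n W \<omega> - q\<bar>)"
        using intq unfolding W_def by auto
      fix \<omega>
      show "(quadexp (\<lambda>a b c d. h a b) k n W \<omega> - q)\<^sup>2 \<le> C * \<bar>quadexp (\<lambda>a b c d. h a b) k n W \<omega> - q\<bar>"
        using mult_right_mono[OF qB[of \<omega>] abs_ge_zero[of "quadexp (\<lambda>a b c d. h a b) k n W \<omega> - q"]]
        by (simp add: power2_eq_square)
    qed
    have combine: "a' \<le> 2 * C * s' + w'" if "a' \<le> (x' + y') + z'" "z' \<le> w'" "x' \<le> C * s'" "y' \<le> C * s'" for a' x' y' z' w' s' :: real
      using that by linarith
    show ?thesis
      using combine[OF le1 le2 mult_left_mono[OF sens[OF u] \<open>0 \<le> C\<close>] mult_left_mono[OF sens[OF u(2,1) u(3)[symmetric]] \<open>0 \<le> C\<close>]]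
      unfolding W_def integral_mult_right_zero .
  qed
  have r0: "(r' \<longlongrightarrow> 0) (nearly_full c)" if r': "r' = (\<lambda>(n, V). r n V)" for r' c
  proof (rule tendstoI)
    fix \<epsilon> :: real assume "0 < \<epsilon>"
    \<comment> \<open>The \<open>+ 1\<close> keeps the denominator positive and makes
      \<open>C * \<delta>\<close> strictly less than half of \<open>\<epsilon>\<close>.\<close>
    define \<delta> where "\<delta> = \<epsilon> / (2 * (C + 1))"
    have \<delta>: "0 < \<delta>" "C * \<delta> < \<epsilon> / 2" using \<open>0 < \<epsilon>\<close> \<open>0 \<le> C\<close> by (auto simp: \<delta>_def field_simps)
    have "\<forall>\<^sub>F x in nearly_full (c + 2). dist (case x of (n, V) \<Rightarrow> \<integral>\<omega>. \<bar>quadexp (\<lambda>a b c d. h a b) k n V \<omega> - q\<bar> \<partial>iid) 0 < \<delta>"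
      using conv1D(2)[OF q] \<delta>(1) by (rule tendstoD)
    then have "\<forall>\<^sub>F x in nearly_full (c + 2). (case x of (n, V) \<Rightarrow> integrable iid (quadexp (\<lambda>a b c d. h a b) k n V)) \<and> dist (case x of (n, V) \<Rightarrow> \<integral>\<omega>. \<bar>quadexp (\<lambda>a b c d. h a b) k n V \<omega> - q\<bar> \<partial>iid) 0 < \<delta>"
      using conv1D(1)[OF q, of "c + 2"] by eventually_elim (rule conjI)
    note ev = eventually_nearly_full_remove[OF this]
    \<comment> \<open>First the diagonal, then the sensitivity error. Since V misses at most c of n
      vertices, \<open>n - (c + 2 + k)\<close> is a lower bound for \<open>card V - 2 - k\<close>
      that depends on n alone.\<close>
    define t where "t n = C * C / real n + 2 * C * (L * (real n * (2 * k + 2 * Suc k) / (real n - (c + 2 + k))\<^sup>2))" for n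
    have "t \<longlonglongrightarrow> 0" unfolding t_def by real_asymp
    from tendstoD[OF tendsto_nearly_full[OF this], of "\<epsilon> / 2" c]
    have "\<forall>\<^sub>F x in nearly_full c. dist (case x of (n, V) \<Rightarrow> t n) 0 < \<epsilon> / 2" using \<open>0 < \<epsilon>\<close> by simp
    then show "\<forall>\<^sub>F x in nearly_full c. dist (r' x) 0 < \<epsilon>"
      using ev eventually_nearly_full_finite[of "c + k + 3" c]
    proof (eventually_elim)
      fix x assume t: "dist (case x of (n, V) \<Rightarrow> t n) 0 < \<epsilon> / 2"
        and e: "case x of (n, V) \<Rightarrow> \<forall>u\<in>V. \<forall>u'\<in>V. u \<noteq> u' \<longrightarrow> (case (n, V - {u, u'}) of (n, V) \<Rightarrow> integrable iid (quadexp (\<lambda>a b c d. h a b) k n V)) \<and> dist (case (n, V - {u, u'}) of (n, V) \<Rightarrow> \<integral>\<omega>. \<bar>quadexp (\<lambda>a b c d. h a b) k n V \<omega> - q\<bar> \<partial>iid) 0 < \<delta>"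
        and f: "case x of (n, V) \<Rightarrow> finite V \<and> c + k + 3 \<le> card V \<and> card V \<le> n \<and> n \<le> card V + c \<and> n \<le> 2 * card V \<and> 0 < n"
      obtain n V where x: "x = (n, V)" by (cases x)
      have V: "finite V" "c + k + 3 \<le> card V" "card V \<le> n" "n \<le> card V + c" "0 < n" using f by (auto simp: x)
      define E where "E = 2 * C * (L * (real n * (2 * k + 2 * Suc k) / (real n - (c + 2 + k))\<^sup>2))"
      have E: "0 \<le> E" using \<open>0 \<le> C\<close> L by (auto simp: E_def)
      have bnd: "(\<integral>\<omega>. H n V u \<omega> * H n V u' \<omega> \<partial>iid) \<le> (if u = u' then C * C else E + C * \<delta>)" if "u \<in> V" "u' \<in> V" for u u'
      proof (cases "u = u'")
        case True
        have "(\<integral>\<omega>. H n V u \<omega> * H n V u' \<omega> \<partial>iid) \<le> (\<integral>\<omega>. C * C \<partial>(iid :: (nat set \<Rightarrow> real) measure))"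
          using intHH[OF V(1) V(1)] H2 by (intro integral_mono) (auto intro: order_trans[OF abs_ge_self])
        then show ?thesis using True by simp
      next
        case False
        have e': "integrable iid (quadexp (\<lambda>a b c d. h a b) k n (V - {u, u'}))" "(\<integral>\<omega>. \<bar>quadexp (\<lambda>a b c d. h a b) k n (V - {u, u'}) \<omega> - q\<bar> \<partial>iid) < \<delta>"
          using e that False by (auto simp: x dist_real_def)
        have "(\<integral>\<omega>. H n V u \<omega> * H n V u' \<omega> \<partial>iid) \<le> 2 * C * (L * (real n * (2 * k + 2 * Suc k) / (real (card V) - 2 - k)\<^sup>2)) +
            C * (\<integral>\<omega>. \<bar>quadexp (\<lambda>a b c d. h a b) k n (V - {u, u'}) \<omega> - q\<bar> \<partial>iid)"
          using V that False e'(1) by (intro off) auto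
        also have "\<dots> \<le> E + C * \<delta>"
          unfolding E_def using V e'(2) \<open>0 \<le> C\<close> L
          by (intro add_mono mult_left_mono divide_left_mono power_mono) auto
        finally show ?thesis using False by simp
      qed
      have "(\<Sum>u\<in>V. \<Sum>u'\<in>V. \<integral>\<omega>. H n V u \<omega> * H n V u' \<omega> \<partial>iid) \<le> (\<Sum>u\<in>V. \<Sum>u'\<in>V. (if u = u' then C * C else 0) + (E + C * \<delta>))"
        using E \<delta> \<open>0 \<le> C\<close> by (intro sum_mono order_trans[OF bnd]) auto
      also have "\<dots> = card V * (C * C) + (card V)\<^sup>2 * (E + C * \<delta>)"
        using V(1) by (simp add: sum.distrib sum.delta' power2_eq_square algebra_simps)
      also have "\<dots> \<le> real n * (C * C) + (real n)\<^sup>2 * (E + C * \<delta>)"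
        using V E \<delta> \<open>0 \<le> C\<close> by (intro add_mono mult_right_mono power_mono) auto
      finally have "r n V \<le> (real n * (C * C) + (real n)\<^sup>2 * (E + C * \<delta>)) / (real n)\<^sup>2"
        unfolding r_def by (intro divide_right_mono) auto
      also have "\<dots> = t n + C * \<delta>" unfolding t_def E_def[symmetric] using V(5) by (simp add: field_simps power2_eq_square)
      also have "\<dots> < \<epsilon>" using t \<delta> by (auto simp: x dist_real_def)
      finally have "r n V < \<epsilon>" .
      moreover have "0 \<le> r n V"
      proof -
        have "(\<Sum>u\<in>V. \<Sum>u'\<in>V. \<integral>\<omega>. H n V u \<omega> * H n V u' \<omega> \<partial>iid) = (\<integral>\<omega>. (\<Sum>u\<in>V. H n V u \<omega>) * (\<Sum>u'\<in>V. H n V u' \<omega>) \<partial>iid)"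
          unfolding sum_product using intHH[OF V(1) V(1)] by (simp add: Bochner_Integration.integral_sum)
        also have "\<dots> \<ge> 0" by (intro Bochner_Integration.integral_nonneg) auto
        finally show ?thesis by (simp add: r_def)
      qed
      ultimately show "dist (r' x) 0 < \<epsilon>" by (simp add: r' x dist_real_def)
    qed
  qed
  show ?thesis
  \<comment> \<open>The second summand appears because the sum over V is divided by n and not by
    \<open>card V\<close>.\<close>
  proof (rule conv1I[where b = "\<lambda>n V. sqrt (r n V) + \<bar>real (card V) / real n - 1\<bar> * \<bar>q\<bar>"])
    fix c
    show "\<forall>\<^sub>F (n, V) in nearly_full c. integrable iid (\<lambda>\<omega>. (\<Sum>u\<in>V. h (real n * samsg \<omega> k V u) (real n * samsg \<omega> (Suc k) V u)) / n) \<and>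
      (\<integral>\<omega>. \<bar>(\<Sum>u\<in>V. h (real n * samsg \<omega> k V u) (real n * samsg \<omega> (Suc k) V u)) / n - q\<bar> \<partial>iid) \<le> sqrt (r n V) + \<bar>real (card V) / real n - 1\<bar> * \<bar>q\<bar>"
      using eventually_nearly_full_finite[of 0 c]
    proof (eventually_elim, clarify)
      fix n :: nat and V :: "nat set" assume V: "finite V" "0 < n"
      define X where "X \<omega> = (\<Sum>u\<in>V. H n V u \<omega>) / n" for \<omega>
      have intH: "integrable iid (H n V v)" for v
        using V HC by (auto intro!: iid.integrable_const_bound[where B = C])
      have X: "(\<Sum>u\<in>V. h (real n * samsg \<omega> k V u) (real n * samsg \<omega> (Suc k) V u)) / n = X \<omega> + real (card V) / n * q" for \<omega>
        unfolding X_def H_def using V by (simp add: sum_subtractf diff_divide_distrib del: samsg.simps)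
      have X2: "(X \<omega>)\<^sup>2 = (\<Sum>u\<in>V. \<Sum>u'\<in>V. H n V u \<omega> * H n V u' \<omega>) / (real n)\<^sup>2" for \<omega>
        unfolding X_def by (simp add: power_divide sum_product power2_eq_square)
      have intX: "integrable iid X" "integrable iid (\<lambda>\<omega>. (X \<omega>)\<^sup>2)"
        unfolding X2 unfolding X_def using intH intHH[OF V(1) V(1)] by auto
      have "(\<integral>\<omega>. (X \<omega>)\<^sup>2 \<partial>iid) = r n V"
        unfolding X2 r_def using intHH[OF V(1) V(1)] by (simp add: Bochner_Integration.integral_sum)
      then have sq: "(\<integral>\<omega>. \<bar>X \<omega>\<bar> \<partial>iid) \<le> sqrt (r n V)" using iid_abs_le_sqrt[OF intX] by simp
      have "(\<integral>\<omega>. \<bar>X \<omega> + real (card V) / n * q - q\<bar> \<partial>iid) \<le> (\<integral>\<omega>. \<bar>X \<omega>\<bar> + \<bar>real (card V) / real n - 1\<bar> * \<bar>q\<bar> \<partial>iid)"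
      proof (rule integral_mono)
        fix \<omega>
        have "X \<omega> + real (card V) / n * q - q = X \<omega> + (real (card V) / n - 1) * q" by (simp add: algebra_simps)
        then show "\<bar>X \<omega> + real (card V) / n * q - q\<bar> \<le> \<bar>X \<omega>\<bar> + \<bar>real (card V) / real n - 1\<bar> * \<bar>q\<bar>"
          using abs_triangle_ineq[of "X \<omega>" "(real (card V) / n - 1) * q"] by (simp only: abs_mult)
      qed (use intX in auto)
      also have "\<dots> = (\<integral>\<omega>. \<bar>X \<omega>\<bar> \<partial>iid) + \<bar>real (card V) / real n - 1\<bar> * \<bar>q\<bar>" using intX by simp
      finally show "integrable iid (\<lambda>\<omega>. (\<Sum>u\<in>V. h (real n * samsg \<omega> k V u) (real n * samsg \<omega> (Suc k) V u)) / n) \<and>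
      (\<integral>\<omega>. \<bar>(\<Sum>u\<in>V. h (real n * samsg \<omega> k V u) (real n * samsg \<omega> (Suc k) V u)) / n - q\<bar> \<partial>iid) \<le> sqrt (r n V) + \<bar>real (card V) / real n - 1\<bar> * \<bar>q\<bar>"
        unfolding X using sq intX by auto
    qed
    have "((\<lambda>x. sqrt (case x of (n, V) \<Rightarrow> r n V) + \<bar>(case x of (n, V) \<Rightarrow> real (card V) / real n) - 1\<bar> * \<bar>q\<bar>) \<longlongrightarrow> sqrt 0 + \<bar>1 - 1\<bar> * \<bar>q\<bar>) (nearly_full c)"
      by (intro tendsto_intros nearly_full_ratio r0 refl)
    then show "((\<lambda>(n, V). sqrt (r n V) + \<bar>real (card V) / real n - 1\<bar> * \<bar>q\<bar>) \<longlongrightarrow> 0) (nearly_full c)"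
      by (simp add: case_prod_unfold)
  qed
qed

section \<open>Truncation and the induction over iterations\<close>

text \<open>Here n is at most 4 times the number of other vertices, so the bound is 4^2 times the
  factor 2! of the second exponential moment.\<close>

lemma samsg_scaled_moment2:
  assumes "finite V" "2 \<le> card V" "n \<le> 2 * card V" "t \<in> V"
  shows "integrable iid (\<lambda>\<omega>. (real n * samsg \<omega> k V t)\<^sup>2)"
    and "(\<integral>\<omega>. (real n * samsg \<omega> k V t)\<^sup>2 \<partial>iid) \<le> 32"
proof -
  have card: "card (V - {t}) = card V - 1" using assms by (simp add: card_Diff_singleton)
  then have "0 < card (V - {t})" using assms by linarith
  then have ne: "V - {t} \<noteq> {}" by (metis card.empty less_irrefl)
  note m = samsg_moment[OF assms(1) ne, where p = 2 and k = k]
  show "integrable iid (\<lambda>\<omega>. (real n * samsg \<omega> k V t)\<^sup>2)"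
    using m(1) by (simp add: power_mult_distrib)
  have "(\<integral>\<omega>. (real n * samsg \<omega> k V t)\<^sup>2 \<partial>iid) = (real n)\<^sup>2 * (\<integral>\<omega>. (samsg \<omega> k V t)\<^sup>2 \<partial>iid)"
    by (simp add: power_mult_distrib)
  also have "\<dots> \<le> (4 * real (card (V - {t})))\<^sup>2 * (2 / (real (card (V - {t})))\<^sup>2)"
    using m(2) assms card by (intro mult_mono power_mono) auto
  also have "\<dots> = 32" using \<open>0 < card (V - {t})\<close> by (simp add: power_mult_distrib)
  finally show "(\<integral>\<omega>. (real n * samsg \<omega> k V t)\<^sup>2 \<partial>iid) \<le> 32" .
qed

lemma clamp_lipschitz: "\<bar>max 0 (min R s) - max 0 (min R t)\<bar> \<le> \<bar>s - t :: real\<bar>"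
  by (auto simp: max_def min_def)

lemma max_lipschitz: "\<bar>max p q - max p' q'\<bar> \<le> \<bar>p - p'\<bar> + \<bar>q - q' :: real\<bar>"
  by (auto simp: max_def)

lemma clamp_error:
  fixes s R :: real
  assumes "0 \<le> s" "0 < R"
  shows "\<bar>s - max 0 (min R s)\<bar> \<le> s\<^sup>2 / R"
proof (cases "s \<le> R")
  case True
  then show ?thesis using assms by simp
next
  case False
  then have "s * R \<le> s * s" using assms by (intro mult_left_mono) auto
  then have "s \<le> s\<^sup>2 / R" using assms by (simp add: power2_eq_square field_simps)
  then show ?thesis using False assms by simp
qed

text \<open>The summands of the load are Lipschitz but unbounded, so they are clamped at R before
  the law of large numbers is applied. Bounded second moments make the clamping error at most C/R in
  mean, uniformly in n and V.\<close>

lemma load_conv: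
  assumes tails: "\<And>x y. \<exists>q. conv1 (pair_tail k x y) q"
  shows "\<exists>q. conv1 (load k x y) q"
proof (rule conv1_approx)
  define h where "h a b = max (if x < 0 then 0 else x + a) (if y < 0 then 0 else y + b)" for a b
  \<comment> \<open>From (p + a + b)^2 being at most 3 (p^2 + a^2 + b^2), with second moments at
    most 32 each for the scaled messages a and b.\<close>
  define C where "C = 3 * ((\<bar>x\<bar> + \<bar>y\<bar>)\<^sup>2 + 64)"
  have "0 \<le> C" by (simp add: C_def)
  have load: "load k x y n V \<omega> = (\<Sum>t\<in>V. h (real n * samsg \<omega> k V t) (real n * samsg \<omega> (Suc k) V t)) / n" if "0 < n" for n V \<omega>
    unfolding load_def sum_divide_distrib
  proof (intro sum.cong refl)
    fix t
    show "max (if x < 0 then 0 else x / n + samsg \<omega> k V t) (if y < 0 then 0 else y / n + samsg \<omega> (Suc k) V t) = h (real n * samsg \<omega> k V t) (real n * samsg \<omega> (Suc k) V t) / n"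
    proof -
      have "max p q / n = max (p / n) (q / n)" for p q :: real
        using that by (simp add: max_divide_distrib_right)
      then show ?thesis using that unfolding h_def by (simp add: add_divide_distrib del: samsg.simps)
    qed
  qed
  have int_samsg: "integrable iid (\<lambda>\<omega>. samsg \<omega> j V t)" if "finite V" "2 \<le> card V" "t \<in> V" for j V t
  proof -
    have "0 < card (V - {t})" using that by (simp add: card_Diff_singleton)
    then have "V - {t} \<noteq> {}" by (metis card.empty less_irrefl)
    then show ?thesis using that by (intro samsg_integrable)
  qed
  have int_h: "integrable iid (\<lambda>\<omega>. h (real n * samsg \<omega> k V t) (real n * samsg \<omega> (Suc k) V t))" if "finite V" "2 \<le> card V" "t \<in> V" for n V t
    unfolding h_def using int_samsg[OF that, of k] int_samsg[OF that, of "Suc k"]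
    by (cases "x < 0"; cases "y < 0") (auto intro!: integrable_max simp del: samsg.simps)
  have int_load: "integrable iid (load k x y n V)" if "finite V" "2 \<le> card V" "0 < n" for n V
  proof -
    have "integrable iid (\<lambda>\<omega>. (\<Sum>t\<in>V. h (real n * samsg \<omega> k V t) (real n * samsg \<omega> (Suc k) V t)) / n)"
      using int_h that by (intro Bochner_Integration.integrable_divide Bochner_Integration.integrable_sum) auto
    then show ?thesis using load[OF that(3)] by (simp add: fun_eq_iff[symmetric] cong: Bochner_Integration.integrable_cong)
  qed
  show "\<forall>\<^sub>F (n, V) in nearly_full c. integrable iid (load k x y n V)" for c
    using eventually_nearly_full_finite[of 2 c] by eventually_elim (auto intro: int_load)
  fix \<epsilon> :: real assume "0 < \<epsilon>"
  define R where "R = C / \<epsilon> + 1"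
  have R: "0 < R" "C / R \<le> \<epsilon>"
  proof -
    show "0 < R" using \<open>0 < \<epsilon>\<close> \<open>0 \<le> C\<close> by (auto simp: R_def intro: add_nonneg_pos)
    then show "C / R \<le> \<epsilon>" using \<open>0 < \<epsilon>\<close> by (simp add: R_def field_simps)
  qed
  define hR where "hR a b = max 0 (min R (h a b))" for a b
  have lip: "lip4 1 (\<lambda>a b c d. hR a b)"
    unfolding lip4_def
  proof (intro allI)
    fix a b c d a' b' c' d' :: real
    have "\<bar>hR a b - hR a' b'\<bar> \<le> \<bar>h a b - h a' b'\<bar>" unfolding hR_def by (rule clamp_lipschitz)
    also have "\<dots> \<le> \<bar>(if x < 0 then 0 else x + a) - (if x < 0 then 0 else x + a')\<bar> + \<bar>(if y < 0 then 0 else y + b) - (if y < 0 then 0 else y + b')\<bar>"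
      unfolding h_def by (rule max_lipschitz)
    also have "\<dots> \<le> \<bar>a - a'\<bar> + \<bar>b - b'\<bar>" by simp
    finally show "\<bar>hR a b - hR a' b'\<bar> \<le> 1 * (\<bar>a - a'\<bar> + \<bar>b - b'\<bar> + \<bar>c - c'\<bar> + \<bar>d - d'\<bar>)" by simp
  qed
  have hR: "\<bar>hR a b\<bar> \<le> R" for a b using R by (auto simp: hR_def)
  obtain q where "conv1 (quadexp (\<lambda>a b c d. hR a b) k) q"
    using quadexp_conv[OF tails lip _ hR] by auto
  from average_conv[OF lip _ hR this]
  have conv: "conv1 (\<lambda>n V \<omega>. (\<Sum>u\<in>V. hR (real n * samsg \<omega> k V u) (real n * samsg \<omega> (Suc k) V u)) / n) q" by simp
  show "\<exists>g' q'. conv1 g' q' \<and> (\<forall>c. \<forall>\<^sub>F (n, V) in nearly_full c. (\<integral>\<omega>. \<bar>load k x y n V \<omega> - g' n V \<omega>\<bar> \<partial>iid) \<le> \<epsilon>)"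
  proof (intro exI conjI allI)
    show "conv1 (\<lambda>n V \<omega>. (\<Sum>u\<in>V. hR (real n * samsg \<omega> k V u) (real n * samsg \<omega> (Suc k) V u)) / n) q" by (rule conv)
    fix c
    show "\<forall>\<^sub>F (n, V) in nearly_full c. (\<integral>\<omega>. \<bar>load k x y n V \<omega> - (\<Sum>u\<in>V. hR (real n * samsg \<omega> k V u) (real n * samsg \<omega> (Suc k) V u)) / n\<bar> \<partial>iid) \<le> \<epsilon>"
      using eventually_nearly_full_finite[of 2 c] conv1D(1)[OF conv, of c]
    proof (eventually_elim, clarify)
      fix n :: nat and V :: "nat set"
      assume V: "finite V" "2 \<le> card V" "card V \<le> n" "n \<le> 2 * card V" "0 < n"
      assume i': "integrable iid (\<lambda>\<omega>. (\<Sum>u\<in>V. hR (real n * samsg \<omega> k V u) (real n * samsg \<omega> (Suc k) V u)) / n)"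
      let ?b = "\<lambda>\<omega> u. 3 * ((\<bar>x\<bar> + \<bar>y\<bar>)\<^sup>2 + ((real n * samsg \<omega> k V u)\<^sup>2 + (real n * samsg \<omega> (Suc k) V u)\<^sup>2)) / R"
      have ib: "integrable iid (\<lambda>\<omega>. ?b \<omega> u)" if "u \<in> V" for u
        using samsg_scaled_moment2(1)[OF V(1,2,4) that] by (intro Bochner_Integration.integrable_divide integrable_mult_right Bochner_Integration.integrable_add) (auto simp del: samsg.simps)
      have "(\<integral>\<omega>. \<bar>load k x y n V \<omega> - (\<Sum>u\<in>V. hR (real n * samsg \<omega> k V u) (real n * samsg \<omega> (Suc k) V u)) / n\<bar> \<partial>iid) \<le>
        (\<integral>\<omega>. (\<Sum>u\<in>V. ?b \<omega> u) / n \<partial>iid)"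
      proof (rule integral_mono)
        show "integrable iid (\<lambda>\<omega>. \<bar>load k x y n V \<omega> - (\<Sum>u\<in>V. hR (real n * samsg \<omega> k V u) (real n * samsg \<omega> (Suc k) V u)) / n\<bar>)"
          using int_load i' V by auto
        show "integrable iid (\<lambda>\<omega>. (\<Sum>u\<in>V. ?b \<omega> u) / n)"
          by (intro Bochner_Integration.integrable_divide Bochner_Integration.integrable_sum ib)
        fix \<omega>
        have "\<bar>load k x y n V \<omega> - (\<Sum>u\<in>V. hR (real n * samsg \<omega> k V u) (real n * samsg \<omega> (Suc k) V u)) / n\<bar> =
          \<bar>\<Sum>u\<in>V. h (real n * samsg \<omega> k V u) (real n * samsg \<omega> (Suc k) V u) - hR (real n * samsg \<omega> k V u) (real n * samsg \<omega> (Suc k) V u)\<bar> / n"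
          unfolding load[OF V(5)] by (simp add: sum_subtractf diff_divide_distrib[symmetric] del: samsg.simps)
        also have "\<dots> \<le> (\<Sum>u\<in>V. ?b \<omega> u) / n"
        proof (intro divide_right_mono order_trans[OF sum_abs] sum_mono)
          fix u assume "u \<in> V"
          define a where "a = real n * samsg \<omega> k V u"
          define b where "b = real n * samsg \<omega> (Suc k) V u"
          have ab: "0 \<le> a" "0 \<le> b" using V by (auto simp: a_def b_def simp del: samsg.simps)
          then have h: "0 \<le> h a b" "h a b \<le> (\<bar>x\<bar> + \<bar>y\<bar>) + a + b" unfolding h_def by (auto simp: max_def)
          have "\<bar>h a b - hR a b\<bar> \<le> (h a b)\<^sup>2 / R" unfolding hR_def using h R by (intro clamp_error)
          also have "\<dots> \<le> ((\<bar>x\<bar> + \<bar>y\<bar>) + a + b)\<^sup>2 / R" using h R by (intro divide_right_mono power_mono) auto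
          also have "\<dots> \<le> 3 * ((\<bar>x\<bar> + \<bar>y\<bar>)\<^sup>2 + (a\<^sup>2 + b\<^sup>2)) / R"
          proof (intro divide_right_mono)
            \<comment> \<open>The sum of these three squares is exactly the defect of the inequality
              to be shown.\<close>
            have "0 \<le> (\<bar>x\<bar> + \<bar>y\<bar> - a)\<^sup>2 + (\<bar>x\<bar> + \<bar>y\<bar> - b)\<^sup>2 + (a - b)\<^sup>2" by simp
            then show "((\<bar>x\<bar> + \<bar>y\<bar>) + a + b)\<^sup>2 \<le> 3 * ((\<bar>x\<bar> + \<bar>y\<bar>)\<^sup>2 + (a\<^sup>2 + b\<^sup>2))"
              by (simp add: power2_eq_square algebra_simps)
          qed (use R in auto)
          finally show "\<bar>h (real n * samsg \<omega> k V u) (real n * samsg \<omega> (Suc k) V u) - hR (real n * samsg \<omega> k V u) (real n * samsg \<omega> (Suc k) V u)\<bar> \<le> ?b \<omega> u"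
            by (simp only: a_def b_def)
        qed auto
        finally show "\<bar>load k x y n V \<omega> - (\<Sum>u\<in>V. hR (real n * samsg \<omega> k V u) (real n * samsg \<omega> (Suc k) V u)) / n\<bar> \<le> (\<Sum>u\<in>V. ?b \<omega> u) / n" .
      qed
      also have "\<dots> = (\<Sum>u\<in>V. (\<integral>\<omega>. ?b \<omega> u \<partial>iid)) / n"
        using ib by (simp only: Bochner_Integration.integral_divide_zero Bochner_Integration.integral_sum)
      also have "\<dots> \<le> (\<Sum>u\<in>V. C / R) / n"
      proof (intro divide_right_mono sum_mono)
        fix u assume u: "u \<in> V"
        note m = samsg_scaled_moment2[OF V(1,2,4) u]
        have "(\<integral>\<omega>. ?b \<omega> u \<partial>iid) = 3 * ((\<bar>x\<bar> + \<bar>y\<bar>)\<^sup>2 + ((\<integral>\<omega>. (real n * samsg \<omega> k V u)\<^sup>2 \<partial>iid) + (\<integral>\<omega>. (real n * samsg \<omega> (Suc k) V u)\<^sup>2 \<partial>iid))) / R"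
          using m(1)[of k] m(1)[of "Suc k"] by (simp del: samsg.simps)
        also have "\<dots> \<le> 3 * ((\<bar>x\<bar> + \<bar>y\<bar>)\<^sup>2 + (32 + 32)) / R"
          using m(2)[of k] m(2)[of "Suc k"] R by (intro divide_right_mono mult_left_mono add_mono) auto
        finally show "(\<integral>\<omega>. ?b \<omega> u \<partial>iid) \<le> C / R" by (simp add: C_def)
      qed auto
      also have "\<dots> = (card V / n) * (C / R)" by simp
      also have "\<dots> \<le> 1 * (C / R)" using V R \<open>0 \<le> C\<close> by (intro mult_right_mono) auto
      also have "\<dots> \<le> \<epsilon>" using R by simp
      finally show "(\<integral>\<omega>. \<bar>load k x y n V \<omega> - (\<Sum>u\<in>V. hR (real n * samsg \<omega> k V u) (real n * samsg \<omega> (Suc k) V u)) / n\<bar> \<partial>iid) \<le> \<epsilon>" .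
    qed
  qed
qed

text \<open>Clamping q at 0 keeps both arguments in the range where exp (-x) is 1-Lipschitz, and
  moves the limit no further from a nonnegative g.\<close>

lemma exp_neg_conv:
  assumes "conv1 g q" "\<And>c. \<forall>\<^sub>F (n, V) in nearly_full c. \<forall>\<omega>. 0 \<le> g n V \<omega>"
  shows "conv1 (\<lambda>n V \<omega>. exp (- g n V \<omega>)) (exp (- max 0 q))"
proof (rule conv1_dominated[OF assms(1), where C = 1])
  fix c
  show "\<forall>\<^sub>F (n, V) in nearly_full c. (\<lambda>\<omega>. exp (- g n V \<omega>)) \<in> borel_measurable iid \<and> (\<forall>\<omega>. \<bar>exp (- g n V \<omega>) - exp (- max 0 q)\<bar> \<le> 1 * \<bar>g n V \<omega> - q\<bar>)"
    using assms(2)[of c] conv1_measurable[OF assms(1), of c]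
  proof (eventually_elim, clarify)
    fix n and V :: "nat set" 
    assume *: "\<forall>\<omega>. 0 \<le> g n V \<omega>" and [measurable]: "g n V \<in> borel_measurable iid"
    have "\<bar>exp (- g n V \<omega>) - exp (- max 0 q)\<bar> \<le> \<bar>g n V \<omega> - q\<bar>" for \<omega>
    proof -
      have "0 \<le> g n V \<omega>" using * by simp
      then show ?thesis
        using exp_minus_diff_le[of "g n V \<omega>" "max 0 q"] exp_minus_diff_le[of "max 0 q" "g n V \<omega>"]
        by (cases "g n V \<omega> \<le> max 0 q") (auto simp: abs_if max_def split: if_splits)
    qed
    then show "(\<lambda>\<omega>. exp (- g n V \<omega>)) \<in> borel_measurable iid \<and> (\<forall>\<omega>. \<bar>exp (- g n V \<omega>) - exp (- max 0 q)\<bar> \<le> 1 * \<bar>g n V \<omega> - q\<bar>)"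
      by simp
  qed
qed

text \<open>The circle of the induction: tails at step k give conditional means of bounded Lipschitz
  functions, these give averages over V, hence loads, and loads are the exponents of the tails at
  step k + 1.\<close>

lemma tails_conv: "\<exists>q. conv1 (pair_tail k x y) q"
proof (induction k arbitrary: x y)
  case 0
  show ?case by (rule pair_tail_0_conv)
next
  case (Suc k)
  obtain q where q: "conv1 (load k x y) q" using load_conv[OF Suc.IH] by blast
  have "conv1 (\<lambda>n V \<omega>. exp (- load k x y n V \<omega>)) (exp (- max 0 q))"
  proof (rule exp_neg_conv[OF q])
    fix c
    show "\<forall>\<^sub>F (n, V) in nearly_full c. \<forall>\<omega>. 0 \<le> load k x y n V \<omega>"
      using eventually_nearly_full_finite[of 0 c] by eventually_elim (auto intro: load_nonneg)
  qed
  then have "conv1 (pair_tail (Suc k) x y) (exp (- max 0 q))"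
  proof (rule conv1_cong)
    fix c
    show "\<forall>\<^sub>F (n, V) in nearly_full c. \<forall>\<omega>. pair_tail (Suc k) x y n V \<omega> = exp (- load k x y n V \<omega>)"
      using eventually_nearly_full_finite[of 1 c] by eventually_elim (auto intro!: pair_tail_Suc)
  qed
  then show ?case ..
qed

section \<open>Limiting means of the messages\<close>

primrec mean_msg :: "nat \<Rightarrow> real" where
  "mean_msg 0 = 0"
| "mean_msg (Suc k) = exp (- mean_msg k)"

lemma mean_msg_nonneg: "0 \<le> mean_msg k"
  by (cases k) auto

lemma eventually_nearly_full_remove1:
  assumes "eventually P (nearly_full (c + 1))"
  shows "eventually (\<lambda>(n, V). \<forall>u\<in>V. P (n, V - {u})) (nearly_full c)"
proof -
  obtain n0 where n0: "\<And>n V. n0 \<le> n \<Longrightarrow> finite V \<Longrightarrow> card V \<le> n \<Longrightarrow> n \<le> card V + (c + 1) \<Longrightarrow> P (n, V)"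
    using assms by (auto simp: eventually_nearly_full)
  show ?thesis unfolding eventually_nearly_full split
  proof (intro exI[of _ n0] allI impI ballI)
    fix n and V :: "nat set" and u
    assume *: "n0 \<le> n" "finite V" "card V \<le> n" "n \<le> card V + c" "u \<in> V"
    then have "card (V - {u}) = card V - 1" by (simp add: card_Diff_singleton)
    with * show "P (n, V - {u})" by (intro n0) auto
  qed
qed

lemma samsg_expectation:
  assumes "finite V" "t \<in> V" "V - {t} \<noteq> {}"
  shows "(\<integral>\<omega>. samsg \<omega> (Suc k) V t \<partial>iid) = (\<integral>\<omega>. exp (- (\<Sum>u\<in>V - {t}. samsg \<omega> k (V - {t}) u)) \<partial>iid) / card (V - {t})"
proof -
  have t: "t \<notin> V - {t}" "insert t (V - {t}) = V" using assms by auto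
  have "(\<integral>\<omega>. samsg \<omega> (Suc k) V t \<partial>iid) = (\<integral>\<omega>. (\<integral>\<zeta>. minmsg (V - {t}) (samsg \<omega> k (V - {t})) \<zeta> \<partial>iid) \<partial>iid)"
    using integrable_resample(3)[OF t(1) samsg_integrable(1)[OF assms(1,3), of "Suc k"], unfolded samsg_star[OF t(1) subset_refl, unfolded t(2)]] .
  also have "\<dots> = (\<integral>\<omega>. exp (- (\<Sum>u\<in>V - {t}. samsg \<omega> k (V - {t}) u)) / card (V - {t}) \<partial>iid)"
    using assms by (intro Bochner_Integration.integral_cong refl minmsg_expectation) auto
  finally show ?thesis by simp
qed

text \<open>Concentration at some constant is known from the loads, so only the expectation is left
  to compute. It is an average over t of the means of exp (- total message in V - {t}), to which the
  induction hypothesis applies.\<close>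

lemma total_msg_conv: "conv1 (\<lambda>n V \<omega>. \<Sum>t\<in>V. samsg \<omega> k V t) (mean_msg k)"
proof (induction k)
  case 0
  show ?case using conv1_const[of 0] by simp
next
  case (Suc k)
  \<comment> \<open>At levels 0 and -1 the second message imposes no condition, and the load reduces
    to the sum of the first messages.\<close>
  obtain q where q0: "conv1 (load (Suc k) 0 (- 1)) q" using load_conv[OF tails_conv] by blast
  have q: "conv1 (\<lambda>n V \<omega>. \<Sum>t\<in>V. samsg \<omega> (Suc k) V t) q"
  proof (rule conv1_cong[OF q0])
    fix c
    show "\<forall>\<^sub>F (n, V) in nearly_full c. \<forall>\<omega>. (\<Sum>t\<in>V. samsg \<omega> (Suc k) V t) = load (Suc k) 0 (- 1) n V \<omega>"
      using eventually_nearly_full_finite[of 0 c]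
      by eventually_elim (auto simp: load_def intro!: sum.cong simp del: samsg.simps)
  qed
  have "conv1 (\<lambda>n V \<omega>. exp (- (\<Sum>t\<in>V. samsg \<omega> k V t))) (exp (- max 0 (mean_msg k)))"
  proof (rule exp_neg_conv[OF Suc])
    fix c
    show "\<forall>\<^sub>F (n, V) in nearly_full c. \<forall>\<omega>. 0 \<le> (\<Sum>t\<in>V. samsg \<omega> k V t)"
      using eventually_nearly_full_finite[of 0 c] by eventually_elim (auto intro!: sum_nonneg)
  qed
  then have e: "((\<lambda>(n, V). \<integral>\<omega>. exp (- (\<Sum>t\<in>V. samsg \<omega> k V t)) \<partial>iid) \<longlongrightarrow> mean_msg (Suc k)) (nearly_full 1)"
    using mean_msg_nonneg[of k] by (simp add: max_absorb2 conv1_expectation)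
  \<comment> \<open>As the limit is a constant, full vertex sets suffice to identify it; the means
    on V - {t} were taken with one missing vertex for this purpose.\<close>
  have "((\<lambda>(n, V). \<integral>\<omega>. (\<Sum>t\<in>V. samsg \<omega> (Suc k) V t) \<partial>iid) \<longlongrightarrow> mean_msg (Suc k)) (nearly_full 0)"
  proof (rule tendstoI)
    fix \<epsilon> :: real assume "0 < \<epsilon>"
    then have "0 < \<epsilon> / 4" by simp
    have "(\<lambda>n. mean_msg (Suc k) / (real n - 1)) \<longlonglongrightarrow> 0" by real_asymp
    note small = tendstoD[OF tendsto_nearly_full[OF this] \<open>0 < \<epsilon> / 4\<close>, of 0]
    have e': "\<forall>\<^sub>F x in nearly_full (0 + 1). dist (case x of (n, V) \<Rightarrow> \<integral>\<omega>. exp (- (\<Sum>t\<in>V. samsg \<omega> k V t)) \<partial>iid) (mean_msg (Suc k)) < \<epsilon> / 4"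
      using tendstoD[OF e \<open>0 < \<epsilon> / 4\<close>] by simp
    show "\<forall>\<^sub>F x in nearly_full 0. dist (case x of (n, V) \<Rightarrow> \<integral>\<omega>. (\<Sum>t\<in>V. samsg \<omega> (Suc k) V t) \<partial>iid) (mean_msg (Suc k)) < \<epsilon>"
      using small eventually_nearly_full_remove1[OF e']
        eventually_nearly_full_finite[of 2 0]
    proof eventually_elim
      fix x assume d: "dist (case x of (n, V) \<Rightarrow> mean_msg (Suc k) / (real n - 1)) 0 < \<epsilon> / 4"
        and e: "case x of (n, V) \<Rightarrow> \<forall>u\<in>V. dist (case (n, V - {u}) of (n, V) \<Rightarrow> \<integral>\<omega>. exp (- (\<Sum>t\<in>V. samsg \<omega> k V t)) \<partial>iid) (mean_msg (Suc k)) < \<epsilon> / 4"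
        and f: "case x of (n, V) \<Rightarrow> finite V \<and> 2 \<le> card V \<and> card V \<le> n \<and> n \<le> card V + 0 \<and> n \<le> 2 * card V \<and> 0 < n"
      obtain n V where x: "x = (n, V)" by (cases x)
      have V: "finite V" "2 \<le> card V" "n = card V" using f by (auto simp: x)
      have card: "card (V - {t}) = n - 1" if "t \<in> V" for t using that V by (simp add: card_Diff_singleton)
      have ne: "V - {t} \<noteq> {}" if "t \<in> V" for t
      proof -
        have "0 < card (V - {t})" using card[OF that] V by simp
        then show ?thesis by (metis card.empty less_irrefl)
      qed
      have int: "integrable iid (\<lambda>\<omega>. samsg \<omega> (Suc k) V t)" if "t \<in> V" for t
        using V ne[OF that] by (intro samsg_integrable)
      define m where "m = mean_msg (Suc k)"
      define E where "E t = (\<integral>\<omega>. exp (- (\<Sum>u\<in>V - {t}. samsg \<omega> k (V - {t}) u)) \<partial>iid)" for t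
      have E: "\<bar>E t - m\<bar> \<le> \<epsilon> / 4" if "t \<in> V" for t
        using e that by (auto simp: x E_def m_def dist_real_def)
      have n1: "real n - 1 \<ge> 1" "real (n - 1) = real n - 1" using V by (auto simp: of_nat_diff)
      have "(\<integral>\<omega>. (\<Sum>t\<in>V. samsg \<omega> (Suc k) V t) \<partial>iid) = (\<Sum>t\<in>V. E t / (real n - 1))"
        using int V ne card by (simp add: Bochner_Integration.integral_sum samsg_expectation E_def n1 del: samsg.simps)
      also have "\<dots> = (\<Sum>t\<in>V. (E t - m) / (real n - 1)) + real n * m / (real n - 1)"
        using V by (simp add: diff_divide_distrib sum_subtractf)
      also have "real n * m / (real n - 1) = m + m / (real n - 1)" using n1 by (simp add: field_simps)
      finally have eq: "(\<integral>\<omega>. (\<Sum>t\<in>V. samsg \<omega> (Suc k) V t) \<partial>iid) - m = (\<Sum>t\<in>V. (E t - m) / (real n - 1)) + m / (real n - 1)" by simp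
      have "\<bar>\<Sum>t\<in>V. (E t - m) / (real n - 1)\<bar> \<le> (\<Sum>t\<in>V. (\<epsilon> / 4) / (real n - 1))"
      proof (intro order_trans[OF sum_abs] sum_mono)
        fix t assume "t \<in> V"
        then have "\<bar>E t - m\<bar> / (real n - 1) \<le> (\<epsilon> / 4) / (real n - 1)" using n1 by (intro divide_right_mono E) auto
        then show "\<bar>(E t - m) / (real n - 1)\<bar> \<le> (\<epsilon> / 4) / (real n - 1)" using n1 by simp
      qed
      also have "\<dots> = (real n / (real n - 1)) * (\<epsilon> / 4)" using V by simp
      also have "\<dots> \<le> 2 * (\<epsilon> / 4)" using n1 \<open>0 < \<epsilon>\<close> V by (intro mult_right_mono) (auto simp: field_simps)
      finally have "\<bar>(\<integral>\<omega>. (\<Sum>t\<in>V. samsg \<omega> (Suc k) V t) \<partial>iid) - m\<bar> \<le> 2 * (\<epsilon> / 4) + \<bar>m / (real n - 1)\<bar>"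
        unfolding eq by (rule order_trans[OF abs_triangle_ineq add_right_mono])
      also have "\<dots> < \<epsilon>"
      proof -
        have "\<bar>m / (real n - 1)\<bar> < \<epsilon> / 4" using d by (simp only: x m_def dist_real_def split diff_0_right)
        then show ?thesis using \<open>0 < \<epsilon>\<close> by linarith
      qed
      finally show "dist (case x of (n, V) \<Rightarrow> \<integral>\<omega>. (\<Sum>t\<in>V. samsg \<omega> (Suc k) V t) \<partial>iid) (mean_msg (Suc k)) < \<epsilon>"
        by (simp only: x m_def dist_real_def split)
    qed
  qed
  moreover have "((\<lambda>(n, V). \<integral>\<omega>. (\<Sum>t\<in>V. samsg \<omega> (Suc k) V t) \<partial>iid) \<longlongrightarrow> q) (nearly_full 0)"
    by (rule conv1_expectation[OF q])
  ultimately have "mean_msg (Suc k) = q" by (intro tendsto_unique[OF nearly_full_nontrivial])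
  with q show ?case by simp
qed

text \<open>An edge with messages \<open>a, b\<close> (after \<open>k\<close> and \<open>k + 1\<close> steps) from one endpoint and \<open>c, d\<close> from
  the other is covered iff its cost is at most \<open>max (a + d) (b + c)\<close>; half the square of this
  threshold is, up to third order, the mean of the cost on that event.\<close>

definition edge_sq :: "real \<Rightarrow> real \<Rightarrow> real \<Rightarrow> real \<Rightarrow> real" where
  "edge_sq a b c d = (max (a + d) (b + c))\<^sup>2"

section \<open>The squared threshold of an edge\<close>

text \<open>Two rounds of the convexity bound (x + y)^3 at most 4 (x^3 + y^3), whose defect is 3 (x
  + y) (x - y)^2; hence the factor 4 * 4.\<close>

lemma cube_sum_le:
  fixes a b c d :: real
  assumes "0 \<le> a" "0 \<le> b" "0 \<le> c" "0 \<le> d"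
  shows "(a + b + c + d) ^ 3 \<le> 16 * (a ^ 3 + b ^ 3 + c ^ 3 + d ^ 3)"
proof -
  have two: "(x + y) ^ 3 \<le> 4 * (x ^ 3 + y ^ 3)" if "0 \<le> x" "0 \<le> y" for x y :: real
  proof -
    have "4 * (x ^ 3 + y ^ 3) - (x + y) ^ 3 = 3 * ((x + y) * (x - y)\<^sup>2)"
      by (simp add: power2_eq_square power3_eq_cube algebra_simps)
    moreover have "0 \<le> (x + y) * (x - y)\<^sup>2" using that by (intro mult_nonneg_nonneg) auto
    ultimately show ?thesis by linarith
  qed
  have "(a + b + c + d) ^ 3 \<le> 4 * ((a + b) ^ 3 + (c + d) ^ 3)"
    using two[of "a + b" "c + d"] assms by (simp add: add.assoc)
  also have "\<dots> \<le> 4 * (4 * (a ^ 3 + b ^ 3) + 4 * (c ^ 3 + d ^ 3))"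
    using two[of a b] two[of c d] assms by (intro mult_left_mono add_mono) auto
  finally show ?thesis by simp
qed

lemma edge_max_cube_le:
  fixes a b c d :: real
  assumes "0 \<le> a" "0 \<le> b" "0 \<le> c" "0 \<le> d"
  shows "(max (a + d) (b + c)) ^ 3 \<le> 16 * (a ^ 3 + b ^ 3 + c ^ 3 + d ^ 3)"
proof -
  have "(max (a + d) (b + c)) ^ 3 \<le> (a + b + c + d) ^ 3" using assms by (intro power_mono) auto
  also have "\<dots> \<le> 16 * (a ^ 3 + b ^ 3 + c ^ 3 + d ^ 3)" using assms by (rule cube_sum_le)
  finally show ?thesis .
qed

lemma edge_sq_bound:
  fixes a b c d :: real
  assumes "0 \<le> a" "0 \<le> b" "0 \<le> c" "0 \<le> d"
  shows "edge_sq a b c d \<le> 1 + 16 * (a ^ 3 + b ^ 3 + c ^ 3 + d ^ 3)"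
proof -
  define s where "s = max (a + d) (b + c)"
  have "0 \<le> s" using assms by (auto simp: s_def)
  have "s\<^sup>2 \<le> 1 + s ^ 3"
  proof (cases "s \<le> 1")
    case True
    then show ?thesis using \<open>0 \<le> s\<close> power_le_one[of s 2] zero_le_power[of s 3] by linarith
  next
    case False
    then have "s\<^sup>2 \<le> s ^ 3" by (intro power_increasing) auto
    then show ?thesis by simp
  qed
  with edge_max_cube_le[OF assms] show ?thesis by (simp add: edge_sq_def s_def)
qed

lemma measurable_edge_sq [measurable (raw)]:
  assumes [measurable]: "A \<in> borel_measurable M" "B \<in> borel_measurable M" "C \<in> borel_measurable M" "D \<in> borel_measurable M"
  shows "(\<lambda>x. edge_sq (A x) (B x) (C x) (D x)) \<in> borel_measurable M"
  unfolding edge_sq_def by measurable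

abbreviation iid2 :: "((nat \<Rightarrow> real) \<times> (nat \<Rightarrow> real)) measure" where
  "iid2 \<equiv> iid \<Otimes>\<^sub>M iid"

lemma iid2_marginal:
  assumes "integrable iid f"
  shows "integrable iid2 (\<lambda>p. f (fst p) :: real)" "(\<integral>p. f (fst p) \<partial>iid2) = (\<integral>\<zeta>. f \<zeta> \<partial>iid)"
    and "integrable iid2 (\<lambda>p. f (snd p))" "(\<integral>p. f (snd p) \<partial>iid2) = (\<integral>\<zeta>. f \<zeta> \<partial>iid)"
proof -
  have "integrable (distr iid2 iid fst) f" unfolding iid.distr_pair_fst by (rule assms)
  then show 1: "integrable iid2 (\<lambda>p. f (fst p))" by (rule integrable_distr[OF measurable_fst])
  show 2: "(\<integral>p. f (fst p) \<partial>iid2) = (\<integral>\<zeta>. f \<zeta> \<partial>iid)"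
    using iid_pair.integral_fst'[OF 1] by simp
  show 3: "integrable iid2 (\<lambda>p. f (snd p))"
    using iid_pair.integrable_product_swap[OF 1] by (simp add: case_prod_unfold)
  show "(\<integral>p. f (snd p) \<partial>iid2) = (\<integral>\<zeta>. f \<zeta> \<partial>iid)"
    using iid_pair.integral_fst'[OF 3] by simp
qed

text \<open>The constant is 2^3 * 3!, with 2 from the bound on n / card V. The four messages around
  an edge then give 192, and the factor 16 of \<open>cube_sum_le\<close> turns this into
  3072.\<close>

lemma scaled_nextmsg_moment3:
  assumes V: "finite V" "V \<noteq> {}"
  shows "integrable iid (\<lambda>\<zeta>. (real n * nextmsg \<omega> k V \<zeta>) ^ 3)"
    and "n \<le> 2 * card V \<Longrightarrow> (\<integral>\<zeta>. (real n * nextmsg \<omega> k V \<zeta>) ^ 3 \<partial>iid) \<le> 48"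
proof -
  note m = nextmsg_moment[OF V, where p = 3 and \<omega> = \<omega> and k = k]
  show "integrable iid (\<lambda>\<zeta>. (real n * nextmsg \<omega> k V \<zeta>) ^ 3)" using m(1) by (simp add: power_mult_distrib)
  assume n: "n \<le> 2 * card V"
  have c: "0 < card V" using V by (simp add: card_gt_0_iff)
  have "(\<integral>\<zeta>. (real n * nextmsg \<omega> k V \<zeta>) ^ 3 \<partial>iid) = real n ^ 3 * (\<integral>\<zeta>. nextmsg \<omega> k V \<zeta> ^ 3 \<partial>iid)"
    by (simp add: power_mult_distrib)
  also have "\<dots> \<le> (2 * real (card V)) ^ 3 * (fact 3 / real (card V) ^ 3)"
    using m(2) n V by (intro mult_mono power_mono) auto
  also have "\<dots> = 48" using c by (simp add: power_mult_distrib fact_numeral)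
  finally show "(\<integral>\<zeta>. (real n * nextmsg \<omega> k V \<zeta>) ^ 3 \<partial>iid) \<le> 48" .
qed

context
  fixes n k :: nat and V :: "nat set" and \<omega> :: "nat set \<Rightarrow> real"
  assumes V: "finite V" "V \<noteq> {}"
begin

private definition "a = (\<lambda>\<zeta>. real n * nextmsg \<omega> k V \<zeta>)"
private definition "b = (\<lambda>\<zeta>. real n * nextmsg \<omega> (Suc k) V \<zeta>)"

private lemma ab_measurable [measurable]: "a \<in> borel_measurable iid" "b \<in> borel_measurable iid"
  using V by (auto simp: a_def b_def intro!: borel_measurable_times measurable_nextmsg)

private lemma ab_nonneg: "0 \<le> a \<zeta>" "0 \<le> b \<zeta>"
  using V by (auto simp: a_def b_def)

private lemma ab_cubes: "integrable iid2 (\<lambda>p. (a (fst p)) ^ 3 + (b (fst p)) ^ 3 + (a (snd p)) ^ 3 + (b (snd p)) ^ 3)"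
  using scaled_nextmsg_moment3(1)[OF V, of n \<omega> k] scaled_nextmsg_moment3(1)[OF V, of n \<omega> "Suc k"]
  by (intro Bochner_Integration.integrable_add iid2_marginal) (auto simp: a_def b_def)

private lemma ab_cubes_le: "n \<le> 2 * card V \<Longrightarrow> (\<integral>p. (a (fst p)) ^ 3 + (b (fst p)) ^ 3 + (a (snd p)) ^ 3 + (b (snd p)) ^ 3 \<partial>iid2) \<le> 192"
proof -
  assume n: "n \<le> 2 * card V"
  have i: "integrable iid (\<lambda>\<zeta>. a \<zeta> ^ 3)" "integrable iid (\<lambda>\<zeta>. b \<zeta> ^ 3)"
    and m: "(\<integral>\<zeta>. a \<zeta> ^ 3 \<partial>iid) \<le> 48" "(\<integral>\<zeta>. b \<zeta> ^ 3 \<partial>iid) \<le> 48"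
    using scaled_nextmsg_moment3[OF V] n by (auto simp: a_def b_def)
  have "(\<integral>p. (a (fst p)) ^ 3 + (b (fst p)) ^ 3 + (a (snd p)) ^ 3 + (b (snd p)) ^ 3 \<partial>iid2) =
    (\<integral>\<zeta>. a \<zeta> ^ 3 \<partial>iid) + (\<integral>\<zeta>. b \<zeta> ^ 3 \<partial>iid) + (\<integral>\<zeta>. a \<zeta> ^ 3 \<partial>iid) + (\<integral>\<zeta>. b \<zeta> ^ 3 \<partial>iid)"
    using iid2_marginal[OF i(1)] iid2_marginal[OF i(2)] by simp
  then show ?thesis using m by simp
qed

private lemma edge_sq_int: "integrable iid2 (\<lambda>p. edge_sq (a (fst p)) (b (fst p)) (a (snd p)) (b (snd p)))"
proof (rule Bochner_Integration.integrable_bound)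
  show "integrable iid2 (\<lambda>p. 1 + 16 * ((a (fst p)) ^ 3 + (b (fst p)) ^ 3 + (a (snd p)) ^ 3 + (b (snd p)) ^ 3))"
    by (intro Bochner_Integration.integrable_add integrable_mult_right ab_cubes) auto
  show "(\<lambda>p. edge_sq (a (fst p)) (b (fst p)) (a (snd p)) (b (snd p))) \<in> borel_measurable iid2"
    by measurable
  show "AE p in iid2. norm (edge_sq (a (fst p)) (b (fst p)) (a (snd p)) (b (snd p))) \<le>
      norm (1 + 16 * ((a (fst p)) ^ 3 + (b (fst p)) ^ 3 + (a (snd p)) ^ 3 + (b (snd p)) ^ 3))"
  proof (rule AE_I2)
    fix p :: "(nat \<Rightarrow> real) \<times> (nat \<Rightarrow> real)"
    have "0 \<le> edge_sq (a (fst p)) (b (fst p)) (a (snd p)) (b (snd p))" by (simp add: edge_sq_def)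
    then show "norm (edge_sq (a (fst p)) (b (fst p)) (a (snd p)) (b (snd p))) \<le>
      norm (1 + 16 * ((a (fst p)) ^ 3 + (b (fst p)) ^ 3 + (a (snd p)) ^ 3 + (b (snd p)) ^ 3))"
      using edge_sq_bound[of "a (fst p)" "b (fst p)" "a (snd p)" "b (snd p)"] ab_nonneg by simp
  qed
qed

lemma quadexp_edge_sq:
  "integrable iid2 (\<lambda>p. edge_sq (real n * nextmsg \<omega> k V (fst p)) (real n * nextmsg \<omega> (Suc k) V (fst p))
     (real n * nextmsg \<omega> k V (snd p)) (real n * nextmsg \<omega> (Suc k) V (snd p)))"
  using edge_sq_int by (simp add: a_def b_def)

lemma quadexp_edge_sq_bounds:
  assumes "n \<le> 2 * card V"
  shows "0 \<le> quadexp edge_sq k n V \<omega>" "quadexp edge_sq k n V \<omega> \<le> 3073"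
proof -
  have eq: "quadexp edge_sq k n V \<omega> = (\<integral>p. edge_sq (a (fst p)) (b (fst p)) (a (snd p)) (b (snd p)) \<partial>iid2)"
    using quadexp_pair[OF quadexp_edge_sq] by (simp add: a_def b_def)
  show "0 \<le> quadexp edge_sq k n V \<omega>"
    unfolding eq by (intro Bochner_Integration.integral_nonneg) (simp add: edge_sq_def)
  have "quadexp edge_sq k n V \<omega> \<le> (\<integral>p. 1 + 16 * ((a (fst p)) ^ 3 + (b (fst p)) ^ 3 + (a (snd p)) ^ 3 + (b (snd p)) ^ 3) \<partial>iid2)"
    unfolding eq by (intro integral_mono edge_sq_int edge_sq_bound ab_nonneg Bochner_Integration.integrable_add integrable_mult_right ab_cubes) auto
  also have "\<dots> = 1 + 16 * (\<integral>p. (a (fst p)) ^ 3 + (b (fst p)) ^ 3 + (a (snd p)) ^ 3 + (b (snd p)) ^ 3 \<partial>iid2)"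
    by (subst Bochner_Integration.integral_add) (auto simp del: distrib_left_numeral intro!: integrable_mult_right ab_cubes)
  also have "\<dots> \<le> 3073" using ab_cubes_le[OF assms] by simp
  finally show "quadexp edge_sq k n V \<omega> \<le> 3073" .
qed

text \<open>Clamping matters only for thresholds s above R, where s^2 is at most s^3 / R; the third
  moments finish the estimate.\<close>

lemma quadexp_edge_sq_truncate:
  assumes "n \<le> 2 * card V" "0 < R"
  shows "\<bar>quadexp edge_sq k n V \<omega> - quadexp (\<lambda>a b c d. (max 0 (min R (max (a + d) (b + c))))\<^sup>2) k n V \<omega>\<bar> \<le> 3072 / R"
proof -
  let ?s = "\<lambda>p. max (a (fst p) + b (snd p)) (b (fst p) + a (snd p))"
  have eq: "quadexp edge_sq k n V \<omega> = (\<integral>p. (?s p)\<^sup>2 \<partial>iid2)"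
    using quadexp_pair[OF quadexp_edge_sq] unfolding a_def b_def by (subst (asm) (2) edge_sq_def)
  have i1: "integrable iid2 (\<lambda>p. (?s p)\<^sup>2)" using edge_sq_int by (simp add: edge_sq_def)
  have i2: "integrable iid2 (\<lambda>p. (max 0 (min R (?s p)))\<^sup>2)"
    using assms(2) by (intro iid_pair.P.integrable_const_bound[where B = "R\<^sup>2"]) (auto simp: power2_le_iff_abs_le)
  have eq2: "quadexp (\<lambda>a b c d. (max 0 (min R (max (a + d) (b + c))))\<^sup>2) k n V \<omega> = (\<integral>p. (max 0 (min R (?s p)))\<^sup>2 \<partial>iid2)"
    using quadexp_pair[of "\<lambda>a b c d. (max 0 (min R (max (a + d) (b + c))))\<^sup>2" n \<omega> k V] i2 by (simp add: a_def b_def)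
  have "\<bar>quadexp edge_sq k n V \<omega> - quadexp (\<lambda>a b c d. (max 0 (min R (max (a + d) (b + c))))\<^sup>2) k n V \<omega>\<bar> \<le> (\<integral>p. \<bar>(?s p)\<^sup>2 - (max 0 (min R (?s p)))\<^sup>2\<bar> \<partial>iid2)"
    unfolding eq eq2 Bochner_Integration.integral_diff[OF i1 i2, symmetric] by (rule integral_abs_bound)
  also have "\<dots> \<le> (\<integral>p. 16 * ((a (fst p)) ^ 3 + (b (fst p)) ^ 3 + (a (snd p)) ^ 3 + (b (snd p)) ^ 3) / R \<partial>iid2)"
  proof (rule integral_mono)
    show "integrable iid2 (\<lambda>p. \<bar>(?s p)\<^sup>2 - (max 0 (min R (?s p)))\<^sup>2\<bar>)" using i1 i2 by auto
    show "integrable iid2 (\<lambda>p. 16 * ((a (fst p)) ^ 3 + (b (fst p)) ^ 3 + (a (snd p)) ^ 3 + (b (snd p)) ^ 3) / R)"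
      by (intro Bochner_Integration.integrable_divide integrable_mult_right ab_cubes)
    fix p
    define s where "s = ?s p"
    have "0 \<le> s" using ab_nonneg[of "fst p"] ab_nonneg[of "snd p"] by (auto simp: s_def)
    have "\<bar>s\<^sup>2 - (max 0 (min R s))\<^sup>2\<bar> \<le> s ^ 3 / R"
    proof (cases "s \<le> R")
      case True
      then show ?thesis using \<open>0 \<le> s\<close> assms(2) by simp
    next
      case False
      then have "\<bar>s\<^sup>2 - (max 0 (min R s))\<^sup>2\<bar> \<le> s\<^sup>2"
        using assms(2) power_mono[of R s 2] \<open>0 \<le> s\<close> by (simp add: min_absorb1 max_absorb2)
      also have "s\<^sup>2 = s\<^sup>2 * R / R" using assms(2) by simp
      also have "\<dots> \<le> s\<^sup>2 * s / R" using False assms(2) by (intro divide_right_mono mult_left_mono) auto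
      finally show ?thesis by (simp add: power2_eq_square power3_eq_cube)
    qed
    also have "\<dots> \<le> 16 * ((a (fst p)) ^ 3 + (b (fst p)) ^ 3 + (a (snd p)) ^ 3 + (b (snd p)) ^ 3) / R"
      unfolding s_def using assms(2) by (intro divide_right_mono edge_max_cube_le ab_nonneg) auto
    finally show "\<bar>(?s p)\<^sup>2 - (max 0 (min R (?s p)))\<^sup>2\<bar> \<le> 16 * ((a (fst p)) ^ 3 + (b (fst p)) ^ 3 + (a (snd p)) ^ 3 + (b (snd p)) ^ 3) / R"
      by (simp only: s_def)
  qed
  also have "\<dots> = 16 * (\<integral>p. (a (fst p)) ^ 3 + (b (fst p)) ^ 3 + (a (snd p)) ^ 3 + (b (snd p)) ^ 3 \<partial>iid2) / R"
    by (simp del: distrib_left_numeral)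
  also have "\<dots> \<le> 16 * 192 / R" using ab_cubes_le[OF assms(1)] assms(2) by (intro divide_right_mono mult_left_mono) auto
  finally show ?thesis by simp
qed

end

lemma measurable_quadexp_edge_sq:
  assumes V: "finite V"
  shows "quadexp edge_sq k n V \<in> borel_measurable iid"
proof -
  have "(\<lambda>x. edge_sq (real n * nextmsg (fst (fst x)) k V (snd (fst x))) (real n * nextmsg (fst (fst x)) (Suc k) V (snd (fst x)))
     (real n * nextmsg (fst (fst x)) k V (snd x)) (real n * nextmsg (fst (fst x)) (Suc k) V (snd x)))
     \<in> borel_measurable ((iid \<Otimes>\<^sub>M iid) \<Otimes>\<^sub>M iid)"
    using V by (intro measurable_edge_sq borel_measurable_times measurable_nextmsg) measurable
  then have *: "(\<lambda>(\<omega>\<zeta>, \<eta>). edge_sq (real n * nextmsg (fst \<omega>\<zeta>) k V (snd \<omega>\<zeta>)) (real n * nextmsg (fst \<omega>\<zeta>) (Suc k) V (snd \<omega>\<zeta>))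
     (real n * nextmsg (fst \<omega>\<zeta>) k V \<eta>) (real n * nextmsg (fst \<omega>\<zeta>) (Suc k) V \<eta>)) \<in> borel_measurable ((iid \<Otimes>\<^sub>M iid) \<Otimes>\<^sub>M iid)"
    by (simp add: case_prod_unfold)
  from iid.borel_measurable_lebesgue_integral[OF this]
  have "(\<lambda>(\<omega>, \<zeta>). \<integral>\<eta>. edge_sq (real n * nextmsg \<omega> k V \<zeta>) (real n * nextmsg \<omega> (Suc k) V \<zeta>)
     (real n * nextmsg \<omega> k V \<eta>) (real n * nextmsg \<omega> (Suc k) V \<eta>) \<partial>iid) \<in> borel_measurable (iid \<Otimes>\<^sub>M iid)"
    by (simp add: case_prod_unfold)
  from iid.borel_measurable_lebesgue_integral[OF this] show ?thesis
    by (simp add: quadexp_def[abs_def])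
qed

lemma quadexp_edge_sq_integrable:
  assumes "finite V" "V \<noteq> {}" "n \<le> 2 * card V"
  shows "integrable iid (quadexp edge_sq k n V)"
  using quadexp_edge_sq_bounds[OF assms(1,2,3)] measurable_quadexp_edge_sq[OF assms(1)]
  by (intro iid.integrable_const_bound[where B = 3073]) auto

text \<open>The squared threshold is neither bounded nor Lipschitz. With the threshold clamped to
  [0, R] it is bounded by R^2 and Lipschitz with constant 2R, because squares differ by (s + s') (s
  - s').\<close>

lemma edge_sq_conv: "\<exists>q. conv1 (quadexp edge_sq k) q"
proof (rule conv1_approx)
  have int: "\<forall>\<^sub>F (n, V) in nearly_full c. integrable iid (quadexp edge_sq k n V)" for c
    using eventually_nearly_full_finite[of 1 c] by eventually_elim (auto intro!: quadexp_edge_sq_integrable)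
  then show "\<And>c. \<forall>\<^sub>F (n, V) in nearly_full c. integrable iid (quadexp edge_sq k n V)" .
  fix \<epsilon> :: real assume "0 < \<epsilon>"
  define R where "R = 3072 / \<epsilon>"
  have R: "0 < R" "3072 / R = \<epsilon>" using \<open>0 < \<epsilon>\<close> by (auto simp: R_def)
  define f where "f = (\<lambda>a b c d. (max 0 (min R (max (a + d) (b + c))))\<^sup>2)"
  have lip: "lip4 (2 * R) f"
    unfolding lip4_def
  proof (intro allI)
    fix a b c d a' b' c' d' :: real
    define s where "s = max 0 (min R (max (a + d) (b + c)))"
    define s' where "s' = max 0 (min R (max (a' + d') (b' + c')))"
    have s: "0 \<le> s" "s \<le> R" "0 \<le> s'" "s' \<le> R" using R by (auto simp: s_def s'_def)
    have "\<bar>s - s'\<bar> \<le> \<bar>max (a + d) (b + c) - max (a' + d') (b' + c')\<bar>" unfolding s_def s'_def by (rule clamp_lipschitz)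
    also have "\<dots> \<le> \<bar>(a + d) - (a' + d')\<bar> + \<bar>(b + c) - (b' + c')\<bar>" by (rule max_lipschitz)
    also have "\<dots> \<le> \<bar>a - a'\<bar> + \<bar>b - b'\<bar> + \<bar>c - c'\<bar> + \<bar>d - d'\<bar>" by linarith
    finally have d: "\<bar>s - s'\<bar> \<le> \<bar>a - a'\<bar> + \<bar>b - b'\<bar> + \<bar>c - c'\<bar> + \<bar>d - d'\<bar>" .
    have "\<bar>s\<^sup>2 - s'\<^sup>2\<bar> = (s + s') * \<bar>s - s'\<bar>"
      using s by (simp add: power2_eq_square square_diff_square_factored abs_mult)
    also have "\<dots> \<le> (2 * R) * (\<bar>a - a'\<bar> + \<bar>b - b'\<bar> + \<bar>c - c'\<bar> + \<bar>d - d'\<bar>)"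
      using s d by (intro mult_mono) auto
    finally show "\<bar>f a b c d - f a' b' c' d'\<bar> \<le> 2 * R * (\<bar>a - a'\<bar> + \<bar>b - b'\<bar> + \<bar>c - c'\<bar> + \<bar>d - d'\<bar>)"
      by (simp only: f_def s_def s'_def)
  qed
  have fB: "\<bar>f a b c d\<bar> \<le> R\<^sup>2" for a b c d
    using R by (auto simp: f_def power2_le_iff_abs_le)
  obtain q where q: "conv1 (quadexp f k) q" using quadexp_conv[OF tails_conv lip _ fB] R by auto
  show "\<exists>g' q'. conv1 g' q' \<and> (\<forall>c. \<forall>\<^sub>F (n, V) in nearly_full c. (\<integral>\<omega>. \<bar>quadexp edge_sq k n V \<omega> - g' n V \<omega>\<bar> \<partial>iid) \<le> \<epsilon>)"
  proof (intro exI conjI allI)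
    show "conv1 (quadexp f k) q" by (rule q)
    fix c
    show "\<forall>\<^sub>F (n, V) in nearly_full c. (\<integral>\<omega>. \<bar>quadexp edge_sq k n V \<omega> - quadexp f k n V \<omega>\<bar> \<partial>iid) \<le> \<epsilon>"
      using eventually_nearly_full_finite[of 1 c] int[of c] conv1D(1)[OF q, of c]
    proof (eventually_elim, clarify)
      fix n :: nat and V :: "nat set" assume V: "finite V" "1 \<le> card V" "n \<le> 2 * card V"
        and i: "integrable iid (quadexp edge_sq k n V)" "integrable iid (quadexp f k n V)"
      have ne: "V \<noteq> {}" using V by auto
      have "(\<integral>\<omega>. \<bar>quadexp edge_sq k n V \<omega> - quadexp f k n V \<omega>\<bar> \<partial>iid) \<le> (\<integral>\<omega>. \<epsilon> \<partial>(iid :: (nat set \<Rightarrow> real) measure))"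
        using i quadexp_edge_sq_truncate[OF V(1) ne V(3) R(1)] unfolding R(2) f_def
        by (intro integral_mono) auto
      then show "(\<integral>\<omega>. \<bar>quadexp edge_sq k n V \<omega> - quadexp f k n V \<omega>\<bar> \<partial>iid) \<le> \<epsilon>" by simp
    qed
  qed
qed

subsection \<open>The limit of many iterations\<close>

text \<open>Rewrites the defining equation as the fixed-point equation of the mean
  recursion.\<close>

lemma Lambert_W_one:
  obtains w where "Lambert_W 1 = w" "0 < w" "w = exp (- w)"
proof -
  let ?f = "\<lambda>x::real. x * exp x"
  have "\<exists>x\<ge>0. x \<le> 1 \<and> ?f x = 1"
  proof (rule IVT')
    have "1 \<le> exp (1::real)" by simp
    then show "1 \<le> (1::real) * exp 1" by (simp only: mult_1)
    show "continuous_on {0..1} (\<lambda>x::real. x * exp x)" by (intro continuous_intros)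
  qed simp_all
  then obtain w :: real where w: "0 \<le> w" "w * exp w = 1" by blast
  have "inj_on ?f {0..}"
  proof (rule strict_mono_on_imp_inj_on, rule strict_mono_onI)
    fix x y :: real assume "x \<in> {0..}" "x < y"
    then show "?f x < ?f y" by (intro mult_strict_mono) auto
  qed
  from the_inv_into_f_f[OF this, of w] have "Lambert_W 1 = w"
    using w by (simp add: Lambert_W_def)
  moreover have "0 < w" using w by (cases "w = 0") auto
  moreover have "w = exp (- w)" using w by (simp add: exp_minus field_simps)
  ultimately show ?thesis using that by blast
qed

text \<open>On the whole half line exp (-x) is only 1-Lipschitz. But the iterates lie in [0, 1], so
  from the first step on they are at least exp (-1); beyond the minimum \<open>\<delta>\<close> of
  this value and w the map contracts by the factor exp (- \<open>\<delta>\<close>) < 1.\<close>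

lemma mean_msg_conv: "mean_msg \<longlonglongrightarrow> Lambert_W 1"
proof -
  obtain w where w: "Lambert_W 1 = w" "0 < w" "w = exp (- w)" by (rule Lambert_W_one)
  have le1: "mean_msg k \<le> 1" for k
    using mean_msg_nonneg by (cases k) auto
  define \<delta> where "\<delta> = min (exp (- 1)) w"
  define \<rho> where "\<rho> = exp (- \<delta>)"
  have \<rho>: "0 \<le> \<rho>" "\<rho> < 1" using w by (auto simp: \<rho>_def \<delta>_def)
  have lip: "\<bar>exp (- x) - exp (- y)\<bar> \<le> \<rho> * \<bar>x - y\<bar>" if "\<delta> \<le> x" "\<delta> \<le> y" for x y :: real
  proof -
    have *: "exp (- x) - exp (- y) \<le> \<rho> * (y - x)" "0 \<le> exp (- x) - exp (- y)" if "\<delta> \<le> x" "x \<le> y" for x y :: real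
    proof -
      have "exp (- x) - exp (- y) = \<rho> * (exp (- (x - \<delta>)) - exp (- (y - \<delta>)))"
        by (simp add: \<rho>_def right_diff_distrib flip: exp_add)
      also have "\<dots> \<le> \<rho> * ((y - \<delta>) - (x - \<delta>))"
        using that \<rho> by (intro mult_left_mono exp_minus_diff_le) auto
      finally show "exp (- x) - exp (- y) \<le> \<rho> * (y - x)" by simp
      show "0 \<le> exp (- x) - exp (- y)" using that by simp
    qed
    show ?thesis
      using *[of x y] *[of y x] that by (cases "x \<le> y") (auto simp: abs_if)
  qed
  have ge: "\<delta> \<le> mean_msg (Suc k)" for k
    using le1[of k] by (auto simp: \<delta>_def min_le_iff_disj)
  have "\<bar>mean_msg (Suc k) - w\<bar> \<le> \<rho> ^ k" for k
  proof (induction k)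
    case 0
    have "w \<le> 1" using w by (metis exp_le_one_iff less_imp_le neg_le_0_iff_le)
    then show ?case using w by simp
  next
    case (Suc k)
    have "\<bar>mean_msg (Suc (Suc k)) - w\<bar> = \<bar>exp (- mean_msg (Suc k)) - exp (- w)\<bar>"
      using w(3) by (metis mean_msg.simps(2))
    also have "\<dots> \<le> \<rho> * \<bar>mean_msg (Suc k) - w\<bar>"
      using ge by (intro lip) (auto simp: \<delta>_def)
    also have "\<dots> \<le> \<rho> * \<rho> ^ k" using Suc \<rho> by (intro mult_left_mono)
    finally show ?case by simp
  qed
  then have "(\<lambda>k. mean_msg (Suc k) - w) \<longlonglongrightarrow> 0"
    using \<rho> by (intro Lim_null_comparison[OF _ LIMSEQ_realpow_zero[of \<rho>]]) (auto intro!: always_eventually)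
  then have "(\<lambda>k. mean_msg (Suc k)) \<longlonglongrightarrow> w" by (rule LIM_zero_cancel)
  then show ?thesis unfolding w(1) by (rule LIMSEQ_imp_Suc)
qed

text \<open>Replaces the threshold by a + c. The cross term 2 u \<open>\<Delta>\<close> is split by
  Young's inequality with weight \<open>\<epsilon>\<close>, since only the mean square of the
  increments is known to become small.\<close>

lemma edge_sq_close:
  fixes a b c d \<epsilon> :: real
  assumes "0 \<le> a" "0 \<le> c" "0 < \<epsilon>"
  shows "\<bar>edge_sq a b c d - (a + c)\<^sup>2\<bar> \<le> (1 + 1 / \<epsilon>) * (2 * (b - a)\<^sup>2 + 2 * (d - c)\<^sup>2) + \<epsilon> * (a + c)\<^sup>2"
proof -
  define u where "u = a + c"
  define t where "t = max (a + d) (b + c)"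
  define \<Delta> where "\<Delta> = \<bar>b - a\<bar> + \<bar>d - c\<bar>"
  have "0 \<le> u" using assms by (simp add: u_def)
  have tu: "\<bar>t - u\<bar> \<le> \<Delta>" unfolding t_def u_def \<Delta>_def by (auto simp: max_def)
  have \<Delta>2: "\<Delta>\<^sup>2 \<le> 2 * (b - a)\<^sup>2 + 2 * (d - c)\<^sup>2"
  proof -
    have *: "(x + y)\<^sup>2 \<le> 2 * x\<^sup>2 + 2 * y\<^sup>2" for x y :: real
      using zero_le_power2[of "x - y"] by (simp add: power2_sum power2_diff)
    show ?thesis unfolding \<Delta>_def using *[of "\<bar>b - a\<bar>" "\<bar>d - c\<bar>"] by (simp only: power2_abs)
  qed
  have "t\<^sup>2 - u\<^sup>2 = (t - u)\<^sup>2 + 2 * u * (t - u)" by (simp add: power2_eq_square algebra_simps)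
  then have "\<bar>t\<^sup>2 - u\<^sup>2\<bar> \<le> \<bar>t - u\<bar>\<^sup>2 + 2 * u * \<bar>t - u\<bar>"
    using abs_triangle_ineq[of "(t - u)\<^sup>2" "2 * u * (t - u)"] \<open>0 \<le> u\<close> by (simp add: abs_mult)
  also have "\<dots> \<le> \<Delta>\<^sup>2 + 2 * u * \<Delta>"
    using tu \<open>0 \<le> u\<close> by (intro add_mono power_mono mult_left_mono) auto
  also have "2 * u * \<Delta> \<le> \<Delta>\<^sup>2 / \<epsilon> + \<epsilon> * u\<^sup>2"
  proof -
    have "0 \<le> (\<Delta> - \<epsilon> * u)\<^sup>2 / \<epsilon>" using assms by simp
    also have "\<dots> = \<Delta>\<^sup>2 / \<epsilon> + \<epsilon> * u\<^sup>2 - 2 * u * \<Delta>"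
      using assms(3) by (simp add: power2_eq_square field_simps)
    finally show ?thesis by simp
  qed
  also have "\<Delta>\<^sup>2 + (\<Delta>\<^sup>2 / \<epsilon> + \<epsilon> * u\<^sup>2) = (1 + 1 / \<epsilon>) * \<Delta>\<^sup>2 + \<epsilon> * u\<^sup>2" by (simp add: algebra_simps)
  also have "\<dots> \<le> (1 + 1 / \<epsilon>) * (2 * (b - a)\<^sup>2 + 2 * (d - c)\<^sup>2) + \<epsilon> * u\<^sup>2"
    using assms \<Delta>2 by (intro add_right_mono mult_left_mono) auto
  finally show ?thesis by (simp only: edge_sq_def t_def u_def)
qed

text \<open>Given \<open>\<omega>\<close> the q-th moment of a is p q!, whence 2 (2p) + 2 p^2 for
  the sum of two independent copies. Step \<open>Suc k\<close> is used because messages have this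
  law only from step 1 on.\<close>

lemma quadexp_edge_sq_close:
  fixes \<omega> :: "nat set \<Rightarrow> real" and k :: nat
  assumes V: "finite V" "V \<noteq> {}" "n = card V" and "0 < \<epsilon>"
  defines "p \<equiv> exp (- (\<Sum>t\<in>V. samsg \<omega> k V t))" and "p' \<equiv> exp (- (\<Sum>t\<in>V. samsg \<omega> (Suc k) V t))"
  shows "\<bar>quadexp edge_sq (Suc k) n V \<omega> - (4 * p + 2 * (p * p))\<bar> \<le> (1 + 1 / \<epsilon>) * (8 * \<bar>p' - p\<bar>) + \<epsilon> * (4 * p + 2 * (p * p))"
proof -
  have n: "0 < n" using V by (simp add: card_gt_0_iff)
  define a where "a = (\<lambda>\<zeta>. real n * nextmsg \<omega> (Suc k) V \<zeta>)"
  define b where "b = (\<lambda>\<zeta>. real n * nextmsg \<omega> (Suc (Suc k)) V \<zeta>)"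
  have [measurable]: "a \<in> borel_measurable iid" "b \<in> borel_measurable iid"
    using V by (auto simp: a_def b_def intro!: borel_measurable_times measurable_nextmsg)
  have nn: "0 \<le> a \<zeta>" "0 \<le> b \<zeta>" for \<zeta> using V by (auto simp: a_def b_def)
  have a_mom: "integrable iid (\<lambda>\<zeta>. a \<zeta> ^ q)" "(\<integral>\<zeta>. a \<zeta> ^ q \<partial>iid) = p * fact q" if "0 < q" for q
    using minmsg_moment[OF V(1,2), of "samsg \<omega> k V" q] that V n
    by (auto simp: a_def nextmsg_def power_mult_distrib p_def)
  have b_mom: "integrable iid (\<lambda>\<zeta>. b \<zeta> ^ q)" "(\<integral>\<zeta>. b \<zeta> ^ q \<partial>iid) = p' * fact q" if "0 < q" for q
    using minmsg_moment[OF V(1,2), of "samsg \<omega> (Suc k) V" q] that V n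
    by (auto simp: b_def nextmsg_def power_mult_distrib p'_def simp del: samsg.simps)
  note a1 = a_mom[of 1, simplified] and a2 = a_mom[of 2, simplified] and b2 = b_mom[of 2, simplified]
  have i_sq: "integrable iid2 (\<lambda>x. (a (fst x) + a (snd x))\<^sup>2)"
  proof (rule Bochner_Integration.integrable_bound)
    show "integrable iid2 (\<lambda>x. 2 * (a (fst x))\<^sup>2 + 2 * (a (snd x))\<^sup>2)"
      by (intro Bochner_Integration.integrable_add integrable_mult_right iid2_marginal a2)
    show "AE x in iid2. norm ((a (fst x) + a (snd x))\<^sup>2) \<le> norm (2 * (a (fst x))\<^sup>2 + 2 * (a (snd x))\<^sup>2)"
    proof (rule AE_I2)
      fix x :: "(nat \<Rightarrow> real) \<times> (nat \<Rightarrow> real)"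
      have "0 \<le> (a (fst x) - a (snd x))\<^sup>2" by simp
      then have "(a (fst x) + a (snd x))\<^sup>2 \<le> 2 * (a (fst x))\<^sup>2 + 2 * (a (snd x))\<^sup>2"
        by (simp add: power2_sum power2_diff)
      then show "norm ((a (fst x) + a (snd x))\<^sup>2) \<le> norm (2 * (a (fst x))\<^sup>2 + 2 * (a (snd x))\<^sup>2)"
        unfolding real_norm_def abs_of_nonneg[OF zero_le_power2] by (rule order_trans[OF _ abs_ge_self])
    qed
  qed measurable
  have e_sq: "(\<integral>x. (a (fst x) + a (snd x))\<^sup>2 \<partial>iid2) = 4 * p + 2 * (p * p)"
  proof -
    have "(\<integral>x. (a (fst x) + a (snd x))\<^sup>2 \<partial>iid2) = (\<integral>\<zeta>. (\<integral>\<eta>. (a \<zeta> + a \<eta>)\<^sup>2 \<partial>iid) \<partial>iid)"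
      using iid_pair.integral_fst'[OF i_sq] by simp
    also have "\<dots> = (\<integral>\<zeta>. (a \<zeta>)\<^sup>2 + 2 * p + 2 * a \<zeta> * p \<partial>iid)"
      using a1 a2 by (simp add: power2_sum mult.commute)
    also have "\<dots> = 4 * p + 2 * (p * p)" using a1 a2 by simp
    finally show ?thesis .
  qed
  \<comment> \<open>The sign of b - a depends only on the parity of k, hence is the same for all
    \<open>\<zeta>\<close>.\<close>
  have mono: "(\<forall>\<zeta>. a \<zeta> \<le> b \<zeta>) \<or> (\<forall>\<zeta>. b \<zeta> \<le> a \<zeta>)"
  proof (cases "even k")
    case True
    then have "samsg \<omega> k V t \<le> samsg \<omega> (Suc k) V t" for t using samsg_alternating[OF V(1), of k \<omega> t] by simp
    then have "b \<zeta> \<le> a \<zeta>" for \<zeta> unfolding a_def b_def nextmsg_def using V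
      by (auto intro!: mult_left_mono minmsg_antimono simp del: samsg.simps)
    then show ?thesis by blast
  next
    case False
    then have "samsg \<omega> (Suc k) V t \<le> samsg \<omega> k V t" for t using samsg_alternating[OF V(1), of k \<omega> t] by simp
    then have "a \<zeta> \<le> b \<zeta>" for \<zeta> unfolding a_def b_def nextmsg_def using V
      by (auto intro!: mult_left_mono minmsg_antimono simp del: samsg.simps)
    then show ?thesis by blast
  qed
  have i_d: "integrable iid (\<lambda>\<zeta>. (b \<zeta> - a \<zeta>)\<^sup>2)" and e_d: "(\<integral>\<zeta>. (b \<zeta> - a \<zeta>)\<^sup>2 \<partial>iid) \<le> 2 * \<bar>p' - p\<bar>"
  proof -
    \<comment> \<open>With the common sign of b - a as a factor, (b - a)^2 lies below a difference
      of squares whose mean is explicit in p and p'.\<close>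
    define \<sigma> :: real where "\<sigma> = (if \<forall>\<zeta>. a \<zeta> \<le> b \<zeta> then 1 else - 1)"
    have le: "(b \<zeta> - a \<zeta>)\<^sup>2 \<le> \<sigma> * ((b \<zeta>)\<^sup>2 - (a \<zeta>)\<^sup>2)" for \<zeta>
    proof -
      have *: "(y - x)\<^sup>2 \<le> y\<^sup>2 - x\<^sup>2" if "0 \<le> x" "x \<le> y" for x y :: real
      proof -
        have "0 \<le> 2 * (x * (y - x))" using that by simp
        then show ?thesis by (simp add: power2_eq_square algebra_simps)
      qed
      show ?thesis
        using mono *[of "a \<zeta>" "b \<zeta>"] *[of "b \<zeta>" "a \<zeta>"] nn[of \<zeta>]
        by (auto simp: \<sigma>_def power2_commute[of "b \<zeta>"])
    qed
    have i: "integrable iid (\<lambda>\<zeta>. \<sigma> * ((b \<zeta>)\<^sup>2 - (a \<zeta>)\<^sup>2))" using a2 b2 by auto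
    show i': "integrable iid (\<lambda>\<zeta>. (b \<zeta> - a \<zeta>)\<^sup>2)"
      by (rule Bochner_Integration.integrable_bound[OF i]) (use le in \<open>auto intro: order_trans[OF _ abs_ge_self]\<close>)
    have "(\<integral>\<zeta>. (b \<zeta> - a \<zeta>)\<^sup>2 \<partial>iid) \<le> (\<integral>\<zeta>. \<sigma> * ((b \<zeta>)\<^sup>2 - (a \<zeta>)\<^sup>2) \<partial>iid)"
      using i i' le by (intro integral_mono)
    also have "\<dots> = \<sigma> * (2 * (p' - p))" using a2 b2 by simp
    also have "\<dots> \<le> 2 * \<bar>p' - p\<bar>" unfolding \<sigma>_def by (cases "p \<le> p'") (simp_all add: abs_if)
    finally show "(\<integral>\<zeta>. (b \<zeta> - a \<zeta>)\<^sup>2 \<partial>iid) \<le> 2 * \<bar>p' - p\<bar>" .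
  qed
  have i_e: "integrable iid2 (\<lambda>x. edge_sq (a (fst x)) (b (fst x)) (a (snd x)) (b (snd x)))"
    using quadexp_edge_sq[OF V(1,2), of n \<omega> "Suc k"] by (simp add: a_def b_def)
  have "\<bar>quadexp edge_sq (Suc k) n V \<omega> - (4 * p + 2 * (p * p))\<bar> \<le> (\<integral>x. \<bar>edge_sq (a (fst x)) (b (fst x)) (a (snd x)) (b (snd x)) - (a (fst x) + a (snd x))\<^sup>2\<bar> \<partial>iid2)"
    unfolding quadexp_pair[OF quadexp_edge_sq[OF V(1,2)]] a_def[symmetric] b_def[symmetric] e_sq[symmetric]
      Bochner_Integration.integral_diff[OF i_e i_sq, symmetric] fun_cong[OF a_def[symmetric]] fun_cong[OF b_def[symmetric]]
    by (rule integral_abs_bound)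
  also have "\<dots> \<le> (\<integral>x. (1 + 1 / \<epsilon>) * (2 * (b (fst x) - a (fst x))\<^sup>2 + 2 * (b (snd x) - a (snd x))\<^sup>2) + \<epsilon> * (a (fst x) + a (snd x))\<^sup>2 \<partial>iid2)"
    by (intro integral_mono edge_sq_close nn assms Bochner_Integration.integrable_add integrable_mult_right iid2_marginal[OF i_d] i_sq
        integrable_abs Bochner_Integration.integrable_diff i_e)
  also have "\<dots> = (1 + 1 / \<epsilon>) * (2 * (\<integral>\<zeta>. (b \<zeta> - a \<zeta>)\<^sup>2 \<partial>iid) + 2 * (\<integral>\<zeta>. (b \<zeta> - a \<zeta>)\<^sup>2 \<partial>iid)) + \<epsilon> * (4 * p + 2 * (p * p))"
    using iid2_marginal[OF i_d] i_sq e_sq by simp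
  also have "\<dots> \<le> (1 + 1 / \<epsilon>) * (2 * (2 * \<bar>p' - p\<bar>) + 2 * (2 * \<bar>p' - p\<bar>)) + \<epsilon> * (4 * p + 2 * (p * p))"
    using e_d \<open>0 < \<epsilon>\<close> by (intro add_right_mono mult_left_mono add_mono) auto
  finally show ?thesis by simp
qed

lemma edge_sq_limit_close:
  assumes \<Lambda>: "conv1 (quadexp edge_sq (Suc k)) \<Lambda>" and "0 < \<epsilon>"
  defines "m \<equiv> mean_msg (Suc k)" and "m' \<equiv> mean_msg (Suc (Suc k))"
  shows "\<bar>\<Lambda> - (4 * m + 2 * (m * m))\<bar> \<le> (1 + 1 / \<epsilon>) * (8 * \<bar>m' - m\<bar>) + \<epsilon> * (4 * m + 2 * (m * m))"
proof -
  define p where "p j n V \<omega> = exp (- (\<Sum>t\<in>V. samsg \<omega> j V t))" for j and n :: nat and V \<omega>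
  have p_conv: "conv1 (p j) (mean_msg (Suc j))" for j
  proof -
    have "conv1 (p j) (exp (- max 0 (mean_msg j)))"
      unfolding p_def
    proof (rule exp_neg_conv[OF total_msg_conv])
      fix c
      show "\<forall>\<^sub>F (n, V) in nearly_full c. \<forall>\<omega>. 0 \<le> (\<Sum>t\<in>V. samsg \<omega> j V t)"
        using eventually_nearly_full_finite[of 0 c] by eventually_elim (auto intro!: sum_nonneg)
    qed
    then show ?thesis using mean_msg_nonneg[of j] by (simp add: max_absorb2)
  qed
  have p_le: "\<forall>\<^sub>F (n, V) in nearly_full c. \<forall>\<omega>. \<bar>p k n V \<omega>\<bar> \<le> 1 \<and> \<bar>p k n V \<omega>\<bar> \<le> 1" for c
    using eventually_nearly_full_finite[of 0 c] by eventually_elim (auto simp: p_def intro!: sum_nonneg)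
  have G: "conv1 (\<lambda>n V \<omega>. 4 * p k n V \<omega> + 2 * (p k n V \<omega> * p k n V \<omega>)) (4 * m + 2 * (m * m))"
    unfolding m_def by (intro conv1_add conv1_cmult conv1_mult p_conv p_le)
  have D0: "conv1 (\<lambda>n V \<omega>. p (Suc k) n V \<omega> - p k n V \<omega>) (m' - m)"
    unfolding m_def m'_def by (intro conv1_diff p_conv)
  have D: "conv1 (\<lambda>n V \<omega>. \<bar>p (Suc k) n V \<omega> - p k n V \<omega>\<bar>) \<bar>m' - m\<bar>"
  proof (rule conv1_dominated[OF D0, where C = 1])
    fix c
    show "\<forall>\<^sub>F (n, V) in nearly_full c. (\<lambda>\<omega>. \<bar>p (Suc k) n V \<omega> - p k n V \<omega>\<bar>) \<in> borel_measurable iid \<and>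
       (\<forall>\<omega>. \<bar>\<bar>p (Suc k) n V \<omega> - p k n V \<omega>\<bar> - \<bar>m' - m\<bar>\<bar> \<le> 1 * \<bar>p (Suc k) n V \<omega> - p k n V \<omega> - (m' - m)\<bar>)"
      using conv1_measurable[OF D0, of c] by eventually_elim auto
  qed
  have RHS: "conv1 (\<lambda>n V \<omega>. (1 + 1 / \<epsilon>) * (8 * \<bar>p (Suc k) n V \<omega> - p k n V \<omega>\<bar>) + \<epsilon> * (4 * p k n V \<omega> + 2 * (p k n V \<omega> * p k n V \<omega>)))
     ((1 + 1 / \<epsilon>) * (8 * \<bar>m' - m\<bar>) + \<epsilon> * (4 * m + 2 * (m * m)))"
    by (intro conv1_add[OF conv1_cmult[OF conv1_cmult[OF D]] conv1_cmult[OF G]])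
  have LHS: "conv1 (\<lambda>n V \<omega>. quadexp edge_sq (Suc k) n V \<omega> - (4 * p k n V \<omega> + 2 * (p k n V \<omega> * p k n V \<omega>))) (\<Lambda> - (4 * m + 2 * (m * m)))"
    by (rule conv1_diff[OF \<Lambda> G])
  show ?thesis
  proof (rule tendsto_le[OF nearly_full_nontrivial conv1_expectation[OF RHS] tendsto_rabs[OF conv1_expectation[OF LHS, of 0]]])
    show "\<forall>\<^sub>F x in nearly_full 0. \<bar>case x of (n, V) \<Rightarrow> \<integral>\<omega>. quadexp edge_sq (Suc k) n V \<omega> - (4 * p k n V \<omega> + 2 * (p k n V \<omega> * p k n V \<omega>)) \<partial>iid\<bar>
       \<le> (case x of (n, V) \<Rightarrow> \<integral>\<omega>. (1 + 1 / \<epsilon>) * (8 * \<bar>p (Suc k) n V \<omega> - p k n V \<omega>\<bar>) + \<epsilon> * (4 * p k n V \<omega> + 2 * (p k n V \<omega> * p k n V \<omega>)) \<partial>iid)"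
      using eventually_nearly_full_finite[of 1 0] conv1D(1)[OF RHS, of 0] conv1D(1)[OF LHS, of 0]
    proof eventually_elim
      fix x :: "nat \<times> nat set"
      assume f: "case x of (n, V) \<Rightarrow> finite V \<and> 1 \<le> card V \<and> card V \<le> n \<and> n \<le> card V + 0 \<and> n \<le> 2 * card V \<and> 0 < n"
        and i: "case x of (n, V) \<Rightarrow> integrable iid (\<lambda>\<omega>. (1 + 1 / \<epsilon>) * (8 * \<bar>p (Suc k) n V \<omega> - p k n V \<omega>\<bar>) + \<epsilon> * (4 * p k n V \<omega> + 2 * (p k n V \<omega> * p k n V \<omega>)))"
          "case x of (n, V) \<Rightarrow> integrable iid (\<lambda>\<omega>. quadexp edge_sq (Suc k) n V \<omega> - (4 * p k n V \<omega> + 2 * (p k n V \<omega> * p k n V \<omega>)))"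
      obtain n V where x: "x = (n, V)" by (cases x)
      have V: "finite V" "V \<noteq> {}" "n = card V" using f by (auto simp: x)
      have "\<bar>\<integral>\<omega>. quadexp edge_sq (Suc k) n V \<omega> - (4 * p k n V \<omega> + 2 * (p k n V \<omega> * p k n V \<omega>)) \<partial>iid\<bar> \<le>
        (\<integral>\<omega>. \<bar>quadexp edge_sq (Suc k) n V \<omega> - (4 * p k n V \<omega> + 2 * (p k n V \<omega> * p k n V \<omega>))\<bar> \<partial>iid)"
        by (rule integral_abs_bound)
      also have "\<dots> \<le> (\<integral>\<omega>. (1 + 1 / \<epsilon>) * (8 * \<bar>p (Suc k) n V \<omega> - p k n V \<omega>\<bar>) + \<epsilon> * (4 * p k n V \<omega> + 2 * (p k n V \<omega> * p k n V \<omega>)) \<partial>iid)"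
        using i unfolding x split
        by (intro integral_mono integrable_abs) (simp_all only: p_def quadexp_edge_sq_close[OF V \<open>0 < \<epsilon>\<close>])
      finally show "\<bar>case x of (n, V) \<Rightarrow> \<integral>\<omega>. quadexp edge_sq (Suc k) n V \<omega> - (4 * p k n V \<omega> + 2 * (p k n V \<omega> * p k n V \<omega>)) \<partial>iid\<bar>
       \<le> (case x of (n, V) \<Rightarrow> \<integral>\<omega>. (1 + 1 / \<epsilon>) * (8 * \<bar>p (Suc k) n V \<omega> - p k n V \<omega>\<bar>) + \<epsilon> * (4 * p k n V \<omega> + 2 * (p k n V \<omega> * p k n V \<omega>)) \<partial>iid)"
        by (simp only: x split)
    qed
  qed
qed

lemma edge_sq_limit:
  assumes \<Lambda>: "\<And>k. conv1 (quadexp edge_sq k) (\<Lambda> k)"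
  shows "(\<lambda>k. \<Lambda> k / 4) \<longlonglongrightarrow> Lambert_W 1 + (Lambert_W 1)\<^sup>2 / 2"
proof -
  define w where "w = Lambert_W 1"
  define g where "g k = 4 * mean_msg (Suc k) + 2 * (mean_msg (Suc k) * mean_msg (Suc k))" for k
  have m1: "(\<lambda>k. mean_msg (Suc k)) \<longlonglongrightarrow> w" "(\<lambda>k. mean_msg (Suc (Suc k))) \<longlonglongrightarrow> w"
    using mean_msg_conv unfolding w_def by (auto intro!: LIMSEQ_Suc simp del: mean_msg.simps)
  have g: "g \<longlonglongrightarrow> 4 * w + 2 * (w * w)" unfolding g_def by (intro tendsto_intros m1)
  have gw: "0 < 4 * w + 2 * (w * w) + 1"
  proof -
    obtain w' where "Lambert_W 1 = w'" "0 < w'" "w' = exp (- w')" by (rule Lambert_W_one)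
    then show ?thesis unfolding w_def by (auto intro!: add_pos_nonneg)
  qed
  have "(\<lambda>k. \<Lambda> (Suc k) - g k) \<longlonglongrightarrow> 0"
  proof (rule tendstoI)
    fix e :: real assume "0 < e"
    \<comment> \<open>The Young weight contributes an error that does not vanish with k; this choice
      keeps it below e/2 in the limit, and the \<open>+ 1\<close> gives a strict inequality.\<close>
    define \<epsilon> where "\<epsilon> = e / (2 * (4 * w + 2 * (w * w) + 1))"
    have \<epsilon>: "0 < \<epsilon>" using \<open>0 < e\<close> gw by (simp add: \<epsilon>_def)
    have "(\<lambda>k. (1 + 1 / \<epsilon>) * (8 * \<bar>mean_msg (Suc (Suc k)) - mean_msg (Suc k)\<bar>) + \<epsilon> * g k) \<longlonglongrightarrow>
       (1 + 1 / \<epsilon>) * (8 * \<bar>w - w\<bar>) + \<epsilon> * (4 * w + 2 * (w * w))"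
      by (intro tendsto_intros m1 g)
    moreover have "(1 + 1 / \<epsilon>) * (8 * \<bar>w - w\<bar>) + \<epsilon> * (4 * w + 2 * (w * w)) < e"
    proof -
      have "\<epsilon> * (4 * w + 2 * (w * w)) < \<epsilon> * (4 * w + 2 * (w * w) + 1)" using \<epsilon> by (intro mult_strict_left_mono) auto
      also have "\<dots> = e / 2"
      proof -
        have "e / (2 * K) * K = e / 2" if "0 < K" for K :: real using that by simp
        then show ?thesis using gw unfolding \<epsilon>_def by blast
      qed
      finally show ?thesis using \<open>0 < e\<close> by simp
    qed
    ultimately have "\<forall>\<^sub>F k in sequentially. (1 + 1 / \<epsilon>) * (8 * \<bar>mean_msg (Suc (Suc k)) - mean_msg (Suc k)\<bar>) + \<epsilon> * g k < e"
      by (rule order_tendstoD(2))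
    then show "\<forall>\<^sub>F k in sequentially. dist (\<Lambda> (Suc k) - g k) 0 < e"
    proof eventually_elim
      case (elim k)
      then show ?case using edge_sq_limit_close[OF \<Lambda>[of "Suc k"] \<epsilon>] by (simp add: g_def dist_real_def)
    qed
  qed
  from tendsto_add[OF this g] have "(\<lambda>k. \<Lambda> (Suc k)) \<longlonglongrightarrow> 4 * w + 2 * (w * w)" by simp
  then have "\<Lambda> \<longlonglongrightarrow> 4 * w + 2 * (w * w)" by (rule LIMSEQ_imp_Suc)
  then have "(\<lambda>k. \<Lambda> k / 4) \<longlonglongrightarrow> (4 * w + 2 * (w * w)) / 4" by (intro tendsto_intros) auto
  then show ?thesis by (simp add: w_def power2_eq_square add_divide_distrib)
qed

subsection \<open>Comparison with belief propagation on the complete graph\<close>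

lemma neighbors_complete: "v < n \<Longrightarrow> neighbors (complete_graph_edges n) v = {..<n} - {v}"
  by (auto simp: neighbors_def complete_graph_edges_def card_insert_if)

lemma bp_message_Suc:
  assumes "3 \<le> n" "v < n" "w < n"
  shows "bp_message (complete_graph_edges n) \<omega> (Suc k) w v =
    minmsg ({..<n} - {v} - {w}) (bp_message (complete_graph_edges n) \<omega> k v) (\<lambda>u. \<omega> {v, u})"
proof -
  have "0 < card ({..<n} - {v} - {w})" using assms by (auto simp: card_Diff_singleton_if)
  then have "{..<n} - {v} - {w} \<noteq> {}" by (metis card.empty less_irrefl)
  then show ?thesis using assms by (simp add: minmsg_def neighbors_complete)
qed

lemma bp_message_nonneg:
  assumes "3 \<le> n" "v < n" "w < n"
  shows "0 \<le> bp_message (complete_graph_edges n) \<omega> k w v"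
proof (cases k)
  case (Suc j)
  show ?thesis unfolding Suc bp_message_Suc[OF assms] by simp
qed simp

lemma bp_decision_iff:
  assumes "3 \<le> n" "v < n" "w < n" "v \<noteq> w"
  shows "w \<in> bp_decision (complete_graph_edges n) \<omega> k v \<longleftrightarrow>
    \<omega> {v, w} \<le> bp_message (complete_graph_edges n) \<omega> k v w + bp_message (complete_graph_edges n) \<omega> (Suc k) w v"
proof -
  let ?X = "bp_message (complete_graph_edges n) \<omega>"
  let ?f = "\<lambda>u. max (\<omega> {v, u} - ?X k v u) 0"
  let ?U = "{..<n} - {v} - {w}"
  have "0 < card ?U" using assms by (auto simp: card_Diff_singleton_if)
  then have ne: "?U \<noteq> {}" by (metis card.empty less_irrefl)
  have "w \<in> bp_decision (complete_graph_edges n) \<omega> k v \<longleftrightarrow> (\<forall>u\<in>?U. ?f w \<le> ?f u)"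
    unfolding bp_decision_def is_arg_min_def mem_Collect_eq neighbors_complete[OF assms(2)] not_less[symmetric]
    using assms by blast
  also have "\<dots> \<longleftrightarrow> ?f w \<le> ?X (Suc k) w v"
    unfolding bp_message_Suc[OF assms(1-3)] using ne by (simp add: minmsg_def)
  also have "\<dots> \<longleftrightarrow> \<omega> {v, w} \<le> ?X k v w + ?X (Suc k) w v"
    using bp_message_nonneg[OF assms(1-3), of \<omega> "Suc k"] by (auto simp: max_def simp del: bp_message.simps)
  finally show ?thesis .
qed

lemma edge_in_cover_iff:
  assumes "3 \<le> n" "v < n" "w < n" "v \<noteq> w"
  shows "{v, w} \<in> decision_cover {..<n} (bp_decision (complete_graph_edges n) \<omega> k) \<longleftrightarrow>
    \<omega> {v, w} \<le> max (bp_message (complete_graph_edges n) \<omega> k v w + bp_message (complete_graph_edges n) \<omega> (Suc k) w v)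
      (bp_message (complete_graph_edges n) \<omega> k w v + bp_message (complete_graph_edges n) \<omega> (Suc k) v w)"
proof -
  have "{v, w} \<in> decision_cover {..<n} (bp_decision (complete_graph_edges n) \<omega> k) \<longleftrightarrow>
     w \<in> bp_decision (complete_graph_edges n) \<omega> k v \<or> v \<in> bp_decision (complete_graph_edges n) \<omega> k w"
    using assms by (auto simp: decision_cover_def doubleton_eq_iff)
  then show ?thesis
    using bp_decision_iff[OF assms, of \<omega> k] bp_decision_iff[OF assms(1,3,2) assms(4)[symmetric], of \<omega> k]
    by (auto simp: insert_commute le_max_iff_disj simp del: bp_message.simps)
qed

lemma cover_subset:
  "decision_cover {..<n} (bp_decision (complete_graph_edges n) \<omega> k) \<subseteq> complete_graph_edges n"
  by (auto simp: decision_cover_def bp_decision_def is_arg_min_def neighbors_def)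

section \<open>Short edges, short cycles and locality\<close>

text \<open>A cheap edge must survive the deletion of any c vertices, because a self-avoiding walk
  has lost its visited vertices when the next minimum is taken.\<close>

definition short_edges :: "nat \<Rightarrow> nat \<Rightarrow> real \<Rightarrow> (nat set \<Rightarrow> real) \<Rightarrow> bool" where
  "short_edges n c M \<omega> \<longleftrightarrow>
    (\<forall>u\<in>{..<n}. \<forall>T\<in>{T. T \<subseteq> {..<n} \<and> card T = c}. \<exists>t\<in>{..<n} - T - {u}. \<omega> {u, t} \<le> M)"

text \<open>\<open>short_cycle \<omega> n \<tau> j V p u\<close>: a walk from \<open>u\<close>, arriving from \<open>p\<close> with the vertices outside
  \<open>V\<close> already visited, can within \<open>j\<close> steps along edges of cost at most \<open>\<tau>\<close> return to a visited
  vertex.\<close>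

primrec short_cycle :: "(nat set \<Rightarrow> real) \<Rightarrow> nat \<Rightarrow> real \<Rightarrow> nat \<Rightarrow> nat set \<Rightarrow> nat \<Rightarrow> nat \<Rightarrow> bool" where
  "short_cycle \<omega> n \<tau> 0 = (\<lambda>V p u. False)"
| "short_cycle \<omega> n \<tau> (Suc j) = (\<lambda>V p u. (\<exists>t\<in>{..<n} - V - {p}. \<omega> {u, t} \<le> \<tau>) \<or>
     (\<exists>t\<in>V - {u}. \<omega> {u, t} \<le> \<tau> \<and> short_cycle \<omega> n \<tau> j (V - {u}) u t))"

lemma short_cycle_mono: "short_cycle \<omega> n \<tau> j V p u \<Longrightarrow> short_cycle \<omega> n \<tau> (Suc j) V p u"
proof (induction j arbitrary: V p u)
  case (Suc j)
  then have "(\<exists>t\<in>{..<n} - V - {p}. \<omega> {u, t} \<le> \<tau>) \<or> (\<exists>t\<in>V - {u}. \<omega> {u, t} \<le> \<tau> \<and> short_cycle \<omega> n \<tau> j (V - {u}) u t)" by simp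
  then show ?case unfolding short_cycle.simps(2)[of \<omega> n \<tau> "Suc j"] using Suc.IH by blast
qed simp

lemma short_edgesD:
  assumes "short_edges n c M \<omega>" "u < n" "T \<subseteq> {..<n}" "card T \<le> c" "c \<le> n"
  obtains t where "t \<in> {..<n} - T - {u}" "\<omega> {u, t} \<le> M"
proof -
  obtain T' where T': "T \<subseteq> T'" "T' \<subseteq> {..<n}" "card T' = c"
    using exists_subset_between[of T c "{..<n}"] assms by auto
  then obtain t where "t \<in> {..<n} - T' - {u}" "\<omega> {u, t} \<le> M"
    using assms unfolding short_edges_def by blast
  then show ?thesis using T' by (intro that[of t]) auto
qed

text \<open>Incoming messages are nonnegative, so a message is at most the cost of any admissible
  edge.\<close>

lemma bp_message_le:
  assumes "short_edges n c M \<omega>" "3 \<le> n" "1 \<le> c" "c \<le> n" "0 \<le> M" "v < n" "w < n"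
  shows "bp_message (complete_graph_edges n) \<omega> k w v \<le> M"
proof (cases k)
  case (Suc j)
  obtain t where t: "t \<in> {..<n} - {w} - {v}" "\<omega> {v, t} \<le> M"
    using short_edgesD[OF assms(1), of v "{w}"] assms by auto
  have "bp_message (complete_graph_edges n) \<omega> k w v \<le> max (\<omega> {v, t} - bp_message (complete_graph_edges n) \<omega> j v t) 0"
    unfolding Suc bp_message_Suc[OF assms(2,6,7)] using t by (intro minmsg_le) auto
  also have "\<dots> \<le> M" using t assms bp_message_nonneg[OF assms(2), of t v \<omega> j] by auto
  finally show ?thesis .
qed (use assms in simp)

lemma samsg_le:
  assumes "short_edges n c M \<omega>" "c \<le> n" "0 \<le> M" "V \<subseteq> {..<n}" "card ({..<n} - V) \<le> c" "v < n"
  shows "samsg \<omega> k V v \<le> M"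
proof (cases k)
  case (Suc j)
  obtain t where t: "t \<in> {..<n} - ({..<n} - V) - {v}" "\<omega> {v, t} \<le> M"
    using short_edgesD[OF assms(1,6), of "{..<n} - V"] assms by auto
  have fin: "finite V" using assms(4) finite_subset by blast
  have "samsg \<omega> k V v \<le> max (\<omega> {v, t} - samsg \<omega> j (V - {v}) t) 0"
    unfolding Suc samsg.simps using t fin by (intro minmsg_le) auto
  also have "\<dots> \<le> M" using t assms fin samsg_nonneg[of "V - {v}" \<omega> j t] by (auto simp del: samsg_nonneg)
  finally show ?thesis .
qed (use assms in simp)

text \<open>All messages are at most M, so an edge of cost above 2M cannot decide a minimum, and
  both recursions only see edges of cost at most 2M. Along such an edge the walk stays in V unless
  it closes a short cycle, and there the induction hypothesis applies. The budget
  \<open>card ({..<n} - V) + j \<le> c\<close> pays for one visited vertex per remaining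
  step.\<close>

lemma bp_message_eq_samsg:
  assumes good: "short_edges n c M \<omega>" and n: "3 \<le> n" "1 \<le> c" "c < n" "0 \<le> M"
  shows "p < n \<Longrightarrow> p \<notin> V \<Longrightarrow> V \<subseteq> {..<n} \<Longrightarrow> u \<in> V \<Longrightarrow> card ({..<n} - V) + j \<le> c \<Longrightarrow>
    \<not> short_cycle \<omega> n (2 * M) j V p u \<Longrightarrow> bp_message (complete_graph_edges n) \<omega> j p u = samsg \<omega> j V u"
proof (induction j arbitrary: V p u)
  case (Suc j)
  let ?X = "bp_message (complete_graph_edges n) \<omega>"
  have fin: "finite V" using Suc.prems finite_subset by blast
  have un: "u < n" using Suc.prems by auto
  have "{..<n} - (V - {u}) = insert u ({..<n} - V)" using un by auto
  then have card: "card ({..<n} - (V - {u})) = card ({..<n} - V) + 1" using Suc.prems by simp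
  have "card V + card ({..<n} - V) = n"
    using card_Diff_subset[OF fin Suc.prems(3)] card_mono[OF _ Suc.prems(3)] by simp
  then have "1 < card V" using Suc.prems n by simp
  then have neV: "V - {u} \<noteq> {}" using Suc.prems fin by (metis card.empty card_Suc_Diff1 less_irrefl One_nat_def)
  have neX: "{..<n} - {u} - {p} \<noteq> {}" using neV Suc.prems by auto
  have IH: "?X j u t = samsg \<omega> j (V - {u}) t" if "t \<in> V - {u}" "\<omega> {u, t} \<le> 2 * M" for t
    using that Suc.prems card by (intro Suc.IH) auto
  have XM: "?X (Suc j) p u \<le> M"
    using Suc.prems n un by (intro bp_message_le[OF good]) auto
  have Xj: "?X j u t \<le> M" if "t < n" for t
    using that n un by (intro bp_message_le[OF good]) auto
  show ?case
  proof (rule antisym)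
    obtain t where t: "t \<in> V - {u}" "samsg \<omega> (Suc j) V u = max (\<omega> {u, t} - samsg \<omega> j (V - {u}) t) 0"
      using minmsg_attained[of "V - {u}" "samsg \<omega> j (V - {u})" "\<lambda>t. \<omega> {u, t}"] fin neV by auto
    have tn: "t < n" using t Suc.prems by auto
    show "?X (Suc j) p u \<le> samsg \<omega> (Suc j) V u"
    proof (cases "\<omega> {u, t} \<le> 2 * M")
      case True
      have "?X (Suc j) p u \<le> max (\<omega> {u, t} - ?X j u t) 0"
        unfolding bp_message_Suc[OF n(1) un Suc.prems(1)] using t Suc.prems tn by (intro minmsg_le) auto
      then show ?thesis unfolding t(2) IH[OF t(1) True] .
    next
      case False
      have "samsg \<omega> j (V - {u}) t \<le> M"
        using Suc.prems n card tn by (intro samsg_le[OF good]) auto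
      then show ?thesis unfolding t(2) using False XM by linarith
    qed
  next
    obtain t where t: "t \<in> {..<n} - {u} - {p}" "?X (Suc j) p u = max (\<omega> {u, t} - ?X j u t) 0"
      unfolding bp_message_Suc[OF n(1) un Suc.prems(1)]
      using minmsg_attained[of "{..<n} - {u} - {p}" "?X j u" "\<lambda>t. \<omega> {u, t}"] neX by blast
    \<comment> \<open>The minimum is at most M, and the message subtracted from the cost is at most
      M.\<close>
    have short: "\<omega> {u, t} \<le> 2 * M" using t XM Xj[of t] by auto
    have "t \<in> V" using t short Suc.prems(6) by auto
    then have tV: "t \<in> V - {u}" using t by auto
    show "samsg \<omega> (Suc j) V u \<le> ?X (Suc j) p u"
      unfolding t(2) IH[OF tV short] samsg.simps using tV fin by (intro minmsg_le) auto
  qed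
qed simp

text \<open>The walk never examines the edge {p, u} by which it arrived, so the event is independent
  of the cost of that edge.\<close>

lemma short_cycle_cong:
  assumes "\<And>x y. x \<in> V \<Longrightarrow> y < n \<Longrightarrow> {x, y} \<noteq> {p, u} \<Longrightarrow> \<omega> {x, y} = \<omega>' {x, y}"
    and "u \<in> V" "p \<notin> V" "V \<subseteq> {..<n}"
  shows "short_cycle \<omega> n \<tau> j V p u = short_cycle \<omega>' n \<tau> j V p u"
  using assms
proof (induction j arbitrary: V p u)
  case (Suc j)
  have 1: "\<omega> {u, t} = \<omega>' {u, t}" if "t \<in> {..<n} - V - {p}" for t
    using that Suc.prems by (intro Suc.prems(1)) (auto simp: doubleton_eq_iff)
  have 2: "\<omega> {u, t} = \<omega>' {u, t}" if "t \<in> V - {u}" for t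
    using that Suc.prems by (intro Suc.prems(1)) (auto simp: doubleton_eq_iff)
  have 3: "short_cycle \<omega> n \<tau> j (V - {u}) u t = short_cycle \<omega>' n \<tau> j (V - {u}) u t" if "t \<in> V - {u}" for t
  proof (rule Suc.IH)
    fix x y assume "x \<in> V - {u}" "y < n" "{x, y} \<noteq> {u, t}"
    then show "\<omega> {x, y} = \<omega>' {x, y}" using Suc.prems by (intro Suc.prems(1)) (auto simp: doubleton_eq_iff)
  qed (use that Suc.prems in auto)
  show ?case using 1 2 3 by (auto simp: short_cycle.simps)
qed simp

lemma measurable_short_cycle [measurable]:
  "finite V \<Longrightarrow> Measurable.pred iid (\<lambda>\<omega>. short_cycle \<omega> n \<tau> j V p u)"
  by (induction j arbitrary: V p u) (simp_all, measurable)

lemma iid_distributed: "distributed iid lborel (\<lambda>\<omega>. \<omega> e) (exponential_density 1)"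
  using iid_factors.PiM_component[of e]
  by (auto simp: distributed_def iid_def cong: distr_cong)

lemma measure_iid_le: "0 \<le> \<tau> \<Longrightarrow> measure iid {\<omega>. \<omega> e \<le> \<tau>} \<le> \<tau>"
proof -
  assume "0 \<le> \<tau>"
  have "measure iid {\<omega>. \<omega> e \<le> \<tau>} = 1 - exp (- \<tau>)"
    using iid.exponential_distributedD_le[OF iid_distributed \<open>0 \<le> \<tau>\<close>, of e] by simp
  also have "\<dots> \<le> \<tau>" using exp_ge_add_one_self[of "- \<tau>"] by linarith
  finally show ?thesis .
qed

lemma iid_prob_eq_integral:
  assumes "Measurable.pred iid R"
  shows "measure iid {\<omega>. R \<omega>} = (\<integral>\<omega>. of_bool (R \<omega>) \<partial>iid)"
proof -
  have "{\<omega>. R \<omega>} \<in> sets iid" using assms by (simp add: pred_def)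
  moreover have "(\<integral>\<omega>. of_bool (R \<omega>) \<partial>iid) = (\<integral>\<omega>. (indicator {\<omega>. R \<omega>} \<omega> :: real) \<partial>iid)"
    by (intro Bochner_Integration.integral_cong) (auto simp: indicator_def)
  ultimately show ?thesis by simp
qed

text \<open>Invariance of Q under resampling the one edge expresses independence of its cost, and
  the integral over the pair of costs factors.\<close>

lemma edge_indep:
  assumes "u \<noteq> t" "0 \<le> \<tau>" and [measurable]: "Measurable.pred iid Q" and Q: "\<And>\<omega> \<zeta>. Q (star_upd u {t} \<zeta> \<omega>) = Q \<omega>"
  shows "measure iid {\<omega>. \<omega> {u, t} \<le> \<tau> \<and> Q \<omega>} \<le> \<tau> * measure iid {\<omega>. Q \<omega>}"
proof -
  have u: "u \<notin> {t}" using assms by auto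
  have i: "integrable iid (\<lambda>\<omega>. of_bool (\<omega> {u, t} \<le> \<tau>) * of_bool (Q \<omega>) :: real)"
    by (intro iid.integrable_const_bound[where B = 1]) (auto simp: of_bool_def)
  have "measure iid {\<omega>. \<omega> {u, t} \<le> \<tau> \<and> Q \<omega>} = (\<integral>\<omega>. of_bool (\<omega> {u, t} \<le> \<tau>) * of_bool (Q \<omega>) \<partial>iid)"
    by (subst iid_prob_eq_integral) (auto simp: of_bool_conj)
  also have "\<dots> = (\<integral>\<omega>. (\<integral>\<zeta>. of_bool (\<zeta> t \<le> \<tau>) * of_bool (Q \<omega>) \<partial>iid) \<partial>iid)"
    by (subst integrable_resample(3)[OF u i]) (simp only: Q star_upd_edge[OF u singletonI])
  also have "\<dots> = (\<integral>\<zeta>. of_bool (\<zeta> t \<le> \<tau>) \<partial>(iid :: (nat \<Rightarrow> real) measure)) * (\<integral>\<omega>. of_bool (Q \<omega>) \<partial>iid)"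
    by simp
  also have "\<dots> = measure iid {\<omega> :: nat \<Rightarrow> real. \<omega> t \<le> \<tau>} * measure iid {\<omega>. Q \<omega>}"
    by (simp add: iid_prob_eq_integral)
  also have "\<dots> \<le> \<tau> * measure iid {\<omega>. Q \<omega>}"
    using assms(2) by (intro mult_right_mono measure_iid_le) auto
  finally show ?thesis .
qed

text \<open>The union bound for a cycle within j steps: a bounds the probability of closing at once
  onto a visited vertex, and b the expected number of short edges along which the walk can
  continue.\<close>

primrec cycle_bound :: "real \<Rightarrow> real \<Rightarrow> nat \<Rightarrow> real" where
  "cycle_bound a b 0 = 0"
| "cycle_bound a b (Suc j) = a + b * cycle_bound a b j"

lemma cycle_bound_nonneg: "0 \<le> a \<Longrightarrow> 0 \<le> b \<Longrightarrow> 0 \<le> cycle_bound a b j"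
  by (induction j) auto

lemma short_cycle_prob:
  assumes "0 \<le> \<tau>" "V \<subseteq> {..<n}" "u \<in> V" "p \<notin> V" "card ({..<n} - V) + j \<le> c"
  shows "measure iid {\<omega>. short_cycle \<omega> n \<tau> j V p u} \<le> cycle_bound (c * \<tau>) (n * \<tau>) j"
  using assms
proof (induction j arbitrary: V p u)
  case (Suc j)
  let ?B = "cycle_bound (c * \<tau>) (n * \<tau>) j"
  have fin: "finite V" using Suc.prems finite_subset by blast
  have un: "u < n" using Suc.prems by auto
  have "{..<n} - (V - {u}) = insert u ({..<n} - V)" using un by auto
  then have card: "card ({..<n} - (V - {u})) = card ({..<n} - V) + 1" using Suc.prems by simp
  let ?A1 = "\<lambda>t. {\<omega> :: nat set \<Rightarrow> real. \<omega> {u, t} \<le> \<tau>}"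
  let ?A2 = "\<lambda>t. {\<omega>. \<omega> {u, t} \<le> \<tau> \<and> short_cycle \<omega> n \<tau> j (V - {u}) u t}"
  have m1: "?A1 t \<in> sets iid" for t
  proof -
    have "{\<omega> \<in> space iid. \<omega> {u, t} \<le> \<tau>} \<in> sets iid" by measurable
    then show ?thesis by simp
  qed
  have m2: "?A2 t \<in> sets iid" for t
  proof -
    have "{\<omega> \<in> space iid. \<omega> {u, t} \<le> \<tau> \<and> short_cycle \<omega> n \<tau> j (V - {u}) u t} \<in> sets iid"
      using finite_Diff[OF fin, of "{u}"] by measurable
    then show ?thesis by simp
  qed
  have "{\<omega>. short_cycle \<omega> n \<tau> (Suc j) V p u} = (\<Union>t\<in>{..<n} - V - {p}. ?A1 t) \<union> (\<Union>t\<in>V - {u}. ?A2 t)" by auto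
  then have "measure iid {\<omega>. short_cycle \<omega> n \<tau> (Suc j) V p u} \<le> measure iid (\<Union>t\<in>{..<n} - V - {p}. ?A1 t) + measure iid (\<Union>t\<in>V - {u}. ?A2 t)"
    by (simp only:) (intro measure_Un_le sets.finite_UN m1 m2 finite_Diff fin finite_lessThan)
  also have "measure iid (\<Union>t\<in>{..<n} - V - {p}. ?A1 t) \<le> (\<Sum>t\<in>{..<n} - V - {p}. measure iid (?A1 t))"
    using m1 by (intro measure_UNION_le) auto
  also have "\<dots> \<le> (\<Sum>t\<in>{..<n} - V - {p}. \<tau>)" using Suc.prems by (intro sum_mono measure_iid_le)
  also have "\<dots> = card ({..<n} - V - {p}) * \<tau>" by simp
  also have "\<dots> \<le> c * \<tau>"
  proof -
    have "card ({..<n} - V - {p}) \<le> card ({..<n} - V)" by (intro card_mono) auto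
    then show ?thesis using Suc.prems by (intro mult_right_mono) auto
  qed
  also have "measure iid (\<Union>t\<in>V - {u}. ?A2 t) \<le> (\<Sum>t\<in>V - {u}. measure iid (?A2 t))"
    using m2 fin by (intro measure_UNION_le) auto
  also have "\<dots> \<le> (\<Sum>t\<in>V - {u}. \<tau> * ?B)"
  proof (rule sum_mono)
    fix t assume t: "t \<in> V - {u}"
    have "measure iid (?A2 t) \<le> \<tau> * measure iid {\<omega>. short_cycle \<omega> n \<tau> j (V - {u}) u t}"
    proof (rule edge_indep)
      fix \<omega> \<zeta>
      show "short_cycle (star_upd u {t} \<zeta> \<omega>) n \<tau> j (V - {u}) u t = short_cycle \<omega> n \<tau> j (V - {u}) u t"
      proof (rule short_cycle_cong)
        fix x y assume "x \<in> V - {u}" "y < n" "{x, y} \<noteq> {u, t}"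
        then show "star_upd u {t} \<zeta> \<omega> {x, y} = \<omega> {x, y}"
          by (auto simp: star_upd_def)
      qed (use t Suc.prems in auto)
    qed (use t Suc.prems fin in \<open>auto\<close>)
    also have "\<dots> \<le> \<tau> * ?B"
      using t Suc.prems card by (intro mult_left_mono Suc.IH) auto
    finally show "measure iid (?A2 t) \<le> \<tau> * ?B" .
  qed
  also have "\<dots> = card (V - {u}) * (\<tau> * ?B)" by simp
  also have "\<dots> \<le> n * (\<tau> * ?B)"
  proof (rule mult_right_mono)
    have "card (V - {u}) \<le> card {..<n}" using Suc.prems by (intro card_mono) auto
    then show "real (card (V - {u})) \<le> real n" by simp
    show "0 \<le> \<tau> * ?B" using Suc.prems by (intro mult_nonneg_nonneg cycle_bound_nonneg) auto
  qed
  finally show ?case by simp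
qed simp

lemma measurable_short_edges [measurable]: "Measurable.pred iid (short_edges n c M)"
proof -
  have fin: "finite {T. T \<subseteq> {..<n} \<and> card T = c}"
    by (rule finite_subset[of _ "Pow {..<n}"]) auto
  have e: "{\<omega> \<in> space iid. \<omega> {u, t} \<le> M} \<in> sets iid" for u t :: nat by measurable
  have "{\<omega> \<in> space iid. short_edges n c M \<omega>} \<in> sets iid"
    unfolding short_edges_def
    by (intro sets.sets_Collect_finite_All sets.sets_Collect_finite_Ex fin e) auto
  then show ?thesis by (simp add: pred_def)
qed

text \<open>Union bound over n vertices and at most n^c deleted sets; in each case at least n - c -
  1 independent costs would all have to exceed M.\<close>

lemma short_edges_prob:
  assumes "0 \<le> M" "c < n"
  shows "measure iid {\<omega>. \<not> short_edges n c M \<omega>} \<le> real n * real n ^ c * exp (- (real n - c - 1) * M)"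
proof -
  let ?TT = "{T. T \<subseteq> {..<n} \<and> card T = c}"
  have fin: "finite ?TT"
    by (rule finite_subset[of _ "Pow {..<n}"]) auto
  let ?A = "\<lambda>u T. {\<omega> :: nat set \<Rightarrow> real. \<forall>e\<in>(\<lambda>t. {u, t}) ` ({..<n} - T - {u}). M < \<omega> e}"
  have m: "?A u T \<in> sets iid" for u T
    using sets_iid_cylinder[of "(\<lambda>t. {u, t}) ` ({..<n} - T - {u})" "\<lambda>_. {M<..}"] by simp
  have A: "measure iid (?A u T) \<le> exp (- (real n - c - 1) * M)" if "T \<in> ?TT" for u T
  proof -
    have inj: "inj_on (\<lambda>t. {u, t}) ({..<n} - T - {u})" by (auto simp: inj_on_def doubleton_eq_iff)
    have "n - c \<le> card ({..<n} - T)" using that diff_card_le_card_Diff[of T "{..<n}"] by (auto intro: finite_subset)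
    then have "real n - c - 1 \<le> real (card ({..<n} - T - {u}))"
      using assms by (cases "u \<in> {..<n} - T") (auto simp: card_Diff_singleton_if of_nat_diff)
    then have "(real n - c - 1) * M \<le> real (card ({..<n} - T - {u})) * M" using assms by (intro mult_right_mono)
    moreover have "measure iid (?A u T) = exp (- (real (card ({..<n} - T - {u})) * M))"
      using assms by (subst measure_iid_greater) (auto simp: card_image[OF inj])
    ultimately show ?thesis by (simp only: mult_minus_left exp_le_cancel_iff neg_le_iff_le)
  qed
  have "{\<omega>. \<not> short_edges n c M \<omega>} = (\<Union>u\<in>{..<n}. \<Union>T\<in>?TT. ?A u T)"
    by (auto simp: short_edges_def not_le)
  then have "measure iid {\<omega>. \<not> short_edges n c M \<omega>} \<le> (\<Sum>u\<in>{..<n}. measure iid (\<Union>T\<in>?TT. ?A u T))"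
    by (simp only:) (intro measure_UNION_le sets.finite_UN m fin finite_lessThan)
  also have "\<dots> \<le> (\<Sum>u\<in>{..<n}. \<Sum>T\<in>?TT. measure iid (?A u T))"
    using m fin by (intro sum_mono measure_UNION_le) auto
  also have "\<dots> \<le> (\<Sum>u\<in>{..<n}. \<Sum>T\<in>?TT. exp (- (real n - c - 1) * M))"
    by (intro sum_mono A)
  also have "\<dots> = real n * real (n choose c) * exp (- (real n - c - 1) * M)"
    using n_subsets[of "{..<n}" c] by simp
  also have "\<dots> \<le> real n * real n ^ c * exp (- (real n - c - 1) * M)"
  proof -
    have "real (n choose c) \<le> real (n ^ c)" using assms by (intro of_nat_mono binomial_le_pow) auto
    then show ?thesis by (intro mult_right_mono mult_left_mono) auto
  qed
  finally show ?thesis .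
qed

section \<open>The expected contribution of one edge\<close>

lemma measurable_bp_message:
  assumes "3 \<le> n"
  shows "v < n \<Longrightarrow> w < n \<Longrightarrow> (\<lambda>\<omega>. bp_message (complete_graph_edges n) \<omega> k w v) \<in> borel_measurable iid"
proof (induction k arbitrary: v w)
  case (Suc k)
  show ?case unfolding bp_message_Suc[OF assms Suc.prems]
    using Suc by (intro measurable_minmsg) auto
qed simp

lemma iid_moment:
  "integrable iid (\<lambda>\<omega>. \<omega> e)" "integrable iid (\<lambda>\<omega>. (\<omega> e)\<^sup>2)" "(\<integral>\<omega>. (\<omega> e)\<^sup>2 \<partial>iid) = 2"
  using iid.erlang_ith_moment_integrable[OF zero_less_one iid_distributed[of e], of 1]
    iid.erlang_ith_moment_integrable[OF zero_less_one iid_distributed[of e], of 2]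
    iid.erlang_ith_moment[OF zero_less_one iid_distributed[of e], of 2] by auto

text \<open>On [0, \<open>\<theta>\<close>] the exponential density lies between 1 - x and 1;
  integrating x against these bounds gives the main term and the error.\<close>

lemma truncated_mean:
  assumes "0 \<le> \<theta>"
  shows "\<bar>(\<integral>\<zeta>. \<zeta> t * of_bool (\<zeta> t \<le> \<theta>) \<partial>iid) - \<theta>\<^sup>2 / 2\<bar> \<le> \<theta> ^ 3 / 3"
proof -
  have pow: "has_bochner_integral lborel (\<lambda>x. x ^ k * indicator {0..\<theta>} x) (\<theta> ^ Suc k / Suc k)" for k
  proof -
    have "((\<lambda>x. x ^ Suc k / Suc k) has_real_derivative x ^ k) (at x)" for x :: real
      by (rule derivative_eq_intros refl | simp del: of_nat_Suc)+
    then show ?thesis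
      using has_bochner_integral_FTC_Icc_nonneg[where a = 0 and b = \<theta> and F = "\<lambda>x. x ^ Suc k / Suc k" and f = "\<lambda>x. x ^ k"] assms
      by simp
  qed
  have p1: "integrable lborel (\<lambda>x. x * indicator {0..\<theta>} x)" "(\<integral>x. x * indicator {0..\<theta>} x \<partial>lborel) = \<theta>\<^sup>2 / 2"
    using pow[of 1] by (auto simp: has_bochner_integral_iff power2_eq_square)
  have p2: "integrable lborel (\<lambda>x. x\<^sup>2 * indicator {0..\<theta>} x)" "(\<integral>x. x\<^sup>2 * indicator {0..\<theta>} x \<partial>lborel) = \<theta> ^ 3 / 3"
    using pow[of 2] by (auto simp: has_bochner_integral_iff eval_nat_numeral)
  let ?g = "\<lambda>x. exponential_density 1 x * (x * of_bool (x \<le> \<theta>))"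
  have e: "(\<integral>\<zeta>. \<zeta> t * of_bool (\<zeta> t \<le> \<theta>) \<partial>iid) = (\<integral>x. ?g x \<partial>lborel)"
    using distributed_integral[OF iid_distributed[of t], of "\<lambda>x. x * of_bool (x \<le> \<theta>)"]
    by (simp add: of_bool_def exponential_density_nonneg)
  have bounds: "x * indicator {0..\<theta>} x - x\<^sup>2 * indicator {0..\<theta>} x \<le> ?g x \<and> ?g x \<le> x * indicator {0..\<theta>} x \<and> 0 \<le> ?g x" for x
  proof (cases "0 \<le> x \<and> x \<le> \<theta>")
    case True
    have "x * (1 - x) \<le> x * exp (- x)" using True exp_ge_add_one_self[of "- x"] by (intro mult_left_mono) auto
    moreover have "x * exp (- x) \<le> x * 1" using True by (intro mult_left_mono) auto
    ultimately show ?thesis using True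
      by (auto simp: exponential_density_def indicator_def power2_eq_square algebra_simps)
  next
    case False
    then show ?thesis by (auto simp: exponential_density_def indicator_def)
  qed
  have ig: "integrable lborel ?g"
  proof (rule Bochner_Integration.integrable_bound[OF p1(1)])
    show "?g \<in> borel_measurable lborel" by (simp add: of_bool_def)
    show "AE x in lborel. norm (?g x) \<le> norm (x * indicator {0..\<theta>} x)"
    proof (rule AE_I2)
      fix x
      have "0 \<le> ?g x" "?g x \<le> x * indicator {0..\<theta>} x" using bounds[of x] by auto
      then show "norm (?g x) \<le> norm (x * indicator {0..\<theta>} x)" by simp
    qed
  qed
  have "(\<integral>x. ?g x \<partial>lborel) \<le> \<theta>\<^sup>2 / 2"
    unfolding p1(2)[symmetric] using bounds by (intro integral_mono ig p1) auto
  moreover have "\<theta>\<^sup>2 / 2 - \<theta> ^ 3 / 3 \<le> (\<integral>x. ?g x \<partial>lborel)"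
    unfolding p1(2)[symmetric] p2(2)[symmetric] Bochner_Integration.integral_diff[OF p1(1) p2(1), symmetric]
    using bounds by (intro integral_mono ig p1 p2 Bochner_Integration.integrable_diff) auto
  ultimately show ?thesis unfolding e using zero_le_power[OF assms, of 3] by linarith
qed

text \<open>The true threshold X is replaced by the self-avoiding threshold Y. Since Y does not
  involve the cost of {v, w}, that cost is fresh given Y and contributes Y^2/2 up to Y^3/3; the mean
  of Y^2 is that of \<open>quadexp\<close> divided by n^2. The three errors are the failure of
  \<open>short_edges\<close>, a short cycle, and the cubic term with 128 = 16 * 4 * 6 / 3.\<close>

lemma edge_cost_estimate:
  fixes k n v w :: nat
  assumes n: "k + 4 \<le> n" and vw: "v < n" "w < n" "v \<noteq> w" and M: "0 \<le> M"
  defines "W \<equiv> {..<n} - {v, w}"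
  shows "integrable iid (\<lambda>\<omega>. \<omega> {v, w} * of_bool ({v, w} \<in> decision_cover {..<n} (bp_decision (complete_graph_edges n) \<omega> k)))"
    and "\<bar>(\<integral>\<omega>. \<omega> {v, w} * of_bool ({v, w} \<in> decision_cover {..<n} (bp_decision (complete_graph_edges n) \<omega> k)) \<partial>iid)
       - (\<integral>\<omega>. quadexp edge_sq k n W \<omega> \<partial>iid) / (2 * (real n)\<^sup>2)\<bar> \<le>
      (2 / real n ^ 3 + real n ^ 3 * (real n * real n ^ (k + 3) * exp (- (real n - real (k + 3) - 1) * M))) / 2
      + 8 * M\<^sup>2 * cycle_bound (real (k + 3) * (2 * M)) (real n * (2 * M)) (Suc k) + 128 / (real n - 2) ^ 3"
proof -
  let ?E = "complete_graph_edges n" and ?e = "{v, w}" and ?c = "k + 3"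
  have n3: "3 \<le> n" using n by simp
  have W: "v \<notin> W" "w \<notin> W" "finite W"
    using vw by (auto simp: W_def)
  have sub: "insert v W \<subseteq> {..<n}" "insert w W \<subseteq> {..<n}" "w \<notin> insert v W" "v \<notin> insert w W"
    using vw by (auto simp: W_def)
  define P where "P = real n * real n ^ ?c * exp (- (real n - real ?c - 1) * M)"
  define B where "B = cycle_bound (real ?c * (2 * M)) (real n * (2 * M)) (Suc k)"
  define X where "X \<omega> = max (bp_message ?E \<omega> k v w + bp_message ?E \<omega> (Suc k) w v) (bp_message ?E \<omega> k w v + bp_message ?E \<omega> (Suc k) v w)" for \<omega>
  define a where "a j \<omega> = samsg \<omega> j (insert w W) w" for j \<omega>
  define b where "b j \<omega> = samsg \<omega> j (insert v W) v" for j \<omega>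
  define Y where "Y \<omega> = max (a k \<omega> + b (Suc k) \<omega>) (a (Suc k) \<omega> + b k \<omega>)" for \<omega>
  have [measurable]: "a j \<in> borel_measurable iid" "b j \<in> borel_measurable iid" for j
    unfolding a_def[abs_def] b_def[abs_def] using W by (auto intro!: measurable_samsg)
  have [measurable]: "Y \<in> borel_measurable iid" unfolding Y_def[abs_def] by measurable
  have [measurable]: "X \<in> borel_measurable iid" unfolding X_def[abs_def]
    using n3 vw by (intro borel_measurable_max borel_measurable_add measurable_bp_message) auto
  have ab0: "0 \<le> a j \<omega>" "0 \<le> b j \<omega>" for j \<omega> using W by (auto simp: a_def b_def)
  have Y0: "0 \<le> Y \<omega>" for \<omega> using ab0 by (auto simp: Y_def le_max_iff_disj)
  have X0: "0 \<le> X \<omega>" for \<omega>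
    unfolding X_def using bp_message_nonneg[OF n3] vw by (auto simp: le_max_iff_disj simp del: bp_message.simps intro!: add_nonneg_nonneg)
  have cover: "?e \<in> decision_cover {..<n} (bp_decision ?E \<omega> k) \<longleftrightarrow> \<omega> ?e \<le> X \<omega>" for \<omega>
    unfolding X_def by (rule edge_in_cover_iff[OF n3 vw])
  have int_le: "integrable iid (\<lambda>\<omega>. \<omega> ?e * of_bool (\<omega> ?e \<le> Z \<omega>))" if [measurable]: "Z \<in> borel_measurable iid" for Z
    by (rule Bochner_Integration.integrable_bound[OF iid_moment(1)[of ?e]]) (auto simp: of_bool_def)
  show "integrable iid (\<lambda>\<omega>. \<omega> ?e * of_bool (?e \<in> decision_cover {..<n} (bp_decision ?E \<omega> k)))"
    unfolding cover by (rule int_le) measurable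
  let ?good = "short_edges n ?c M"
  let ?bad1 = "\<lambda>\<omega>. short_cycle \<omega> n (2 * M) (Suc k) (insert v W) w v"
  let ?bad2 = "\<lambda>\<omega>. short_cycle \<omega> n (2 * M) (Suc k) (insert w W) v w"
  have card1: "card ({..<n} - insert v W) = 1" "card ({..<n} - insert w W) = 1"
  proof -
    have "{..<n} - insert v W = {w}" "{..<n} - insert w W = {v}" using vw by (auto simp: W_def)
    then show "card ({..<n} - insert v W) = 1" "card ({..<n} - insert w W) = 1" by simp_all
  qed
  have eq: "X \<omega> = Y \<omega>" if "?good \<omega>" "\<not> ?bad1 \<omega>" "\<not> ?bad2 \<omega>" for \<omega>
  proof -
    have k1: "bp_message ?E \<omega> j w v = b j \<omega>" if "j = k \<or> j = Suc k" for j
      unfolding b_def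
    proof (rule bp_message_eq_samsg[OF \<open>?good \<omega>\<close>])
      show "\<not> short_cycle \<omega> n (2 * M) j (insert v W) w v"
        using that \<open>\<not> ?bad1 \<omega>\<close> short_cycle_mono[of \<omega> n "2 * M" k "insert v W" w v] by blast
    qed (use that n M vw sub card1 in auto)
    have k2: "bp_message ?E \<omega> j v w = a j \<omega>" if "j = k \<or> j = Suc k" for j
      unfolding a_def
    proof (rule bp_message_eq_samsg[OF \<open>?good \<omega>\<close>])
      show "\<not> short_cycle \<omega> n (2 * M) j (insert w W) v w"
        using that \<open>\<not> ?bad2 \<omega>\<close> short_cycle_mono[of \<omega> n "2 * M" k "insert w W" v w] by blast
    qed (use that n M vw sub card1 in auto)
    show ?thesis unfolding X_def Y_def k1[of k, simplified] k1[of "Suc k", OF disjI2[OF refl]] k2[of k, simplified] k2[of "Suc k", OF disjI2[OF refl]]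
      by (simp add: max.commute add.commute)
  qed
  have XM: "X \<omega> \<le> 2 * M" if "?good \<omega>" for \<omega>
    unfolding X_def using bp_message_le[OF that n3, of v w k] bp_message_le[OF that n3, of w v k]
      bp_message_le[OF that n3, of v w "Suc k"] bp_message_le[OF that n3, of w v "Suc k"] n M vw
    by (auto simp del: bp_message.simps)
  have YM: "Y \<omega> \<le> 2 * M" if "?good \<omega>" for \<omega>
  proof -
    have "a j \<omega> \<le> M" "b j \<omega> \<le> M" for j
      unfolding a_def b_def using n M vw card1 sub
      by (auto intro!: samsg_le[OF that])
    from this[of k] this[of "Suc k"] show ?thesis unfolding Y_def by auto
  qed
  \<comment> \<open>Where \<open>short_edges\<close> fails the cost is unbounded, so it is split by
    the inequality of means with weight n^3: the part with the squared cost is of order 1/n^3,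
    negligible over about n^2 edges, and the other carries the tiny probability of failure.\<close>
  have point: "\<bar>\<omega> ?e * of_bool (\<omega> ?e \<le> X \<omega>) - \<omega> ?e * of_bool (\<omega> ?e \<le> Y \<omega>)\<bar> \<le>
      ((\<omega> ?e)\<^sup>2 / real n ^ 3 + real n ^ 3 * of_bool (\<not> ?good \<omega>)) / 2 +
      2 * M * (of_bool (\<omega> {v, w} \<le> 2 * M \<and> ?bad1 \<omega>) + of_bool (\<omega> {w, v} \<le> 2 * M \<and> ?bad2 \<omega>))" for \<omega>
  proof (cases "?good \<omega>")
    case False
    define N where "N = real n ^ 3"
    have N: "0 < N" using n by (simp add: N_def)
    have "0 \<le> (\<bar>\<omega> ?e\<bar> - N)\<^sup>2 / N" using N by simp
    also have "\<dots> = (\<omega> ?e)\<^sup>2 / N + N - 2 * \<bar>\<omega> ?e\<bar>"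
      using N by (simp add: power2_diff power2_eq_square field_simps)
    finally have "\<bar>\<omega> ?e\<bar> \<le> ((\<omega> ?e)\<^sup>2 / N + N) / 2" by simp
    moreover have "\<bar>\<omega> ?e * of_bool (\<omega> ?e \<le> X \<omega>) - \<omega> ?e * of_bool (\<omega> ?e \<le> Y \<omega>)\<bar> \<le> \<bar>\<omega> ?e\<bar>" by (auto simp: of_bool_def)
    moreover have "0 \<le> 2 * M * (of_bool (\<omega> {v, w} \<le> 2 * M \<and> ?bad1 \<omega>) + of_bool (\<omega> {w, v} \<le> 2 * M \<and> ?bad2 \<omega>))"
      using M by (intro mult_nonneg_nonneg add_nonneg_nonneg) auto
    ultimately show ?thesis unfolding N_def by (simp only: False not_False_eq_True of_bool_eq mult_1_right)
  next
    case True
    have "0 \<le> ((\<omega> ?e)\<^sup>2 / real n ^ 3 + real n ^ 3 * of_bool (\<not> ?good \<omega>)) / 2" by simp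
    moreover have "\<bar>\<omega> ?e * of_bool (\<omega> ?e \<le> X \<omega>) - \<omega> ?e * of_bool (\<omega> ?e \<le> Y \<omega>)\<bar> \<le>
       2 * M * (of_bool (\<omega> {v, w} \<le> 2 * M \<and> ?bad1 \<omega>) + of_bool (\<omega> {w, v} \<le> 2 * M \<and> ?bad2 \<omega>))"
    \<comment> \<open>Both thresholds lie in [0, 2M], so they agree about a negative cost and about
      a cost above 2M. A discrepancy thus needs a short cycle together with a short edge {v,
      w}.\<close>
    proof (cases "X \<omega> = Y \<omega> \<or> \<omega> ?e < 0 \<or> 2 * M < \<omega> ?e")
      case same: True
      have "\<omega> ?e * of_bool (\<omega> ?e \<le> X \<omega>) = \<omega> ?e * of_bool (\<omega> ?e \<le> Y \<omega>)"
        using same X0[of \<omega>] Y0[of \<omega>] XM[OF True] YM[OF True] by (auto simp: of_bool_def)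
      moreover have "0 \<le> 2 * M * (of_bool (\<omega> {v, w} \<le> 2 * M \<and> ?bad1 \<omega>) + of_bool (\<omega> {w, v} \<le> 2 * M \<and> ?bad2 \<omega>))"
        using M by (intro mult_nonneg_nonneg add_nonneg_nonneg) auto
      ultimately show ?thesis by (simp only: diff_self abs_zero)
    next
      case diff: False
      then have "?bad1 \<omega> \<or> ?bad2 \<omega>" using eq[OF True] by blast
      then have "1 \<le> (of_bool (\<omega> {v, w} \<le> 2 * M \<and> ?bad1 \<omega>) + of_bool (\<omega> {w, v} \<le> 2 * M \<and> ?bad2 \<omega>) :: real)"
        using diff by (auto simp: insert_commute of_bool_def simp del: short_cycle.simps)
      then have "2 * M * 1 \<le> 2 * M * (of_bool (\<omega> {v, w} \<le> 2 * M \<and> ?bad1 \<omega>) + of_bool (\<omega> {w, v} \<le> 2 * M \<and> ?bad2 \<omega>))"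
        using M by (intro mult_left_mono) auto
      moreover have "\<bar>\<omega> ?e * of_bool (\<omega> ?e \<le> X \<omega>) - \<omega> ?e * of_bool (\<omega> ?e \<le> Y \<omega>)\<bar> \<le> 2 * M"
        using diff M by (auto simp: of_bool_def)
      ultimately show ?thesis by linarith
    qed
    ultimately show ?thesis by linarith
  qed
  have finW: "finite (insert v W)" "finite (insert w W)" using W by auto
  have meas_bad: "Measurable.pred iid ?bad1" "Measurable.pred iid ?bad2"
    using finW by (auto simp del: short_cycle.simps intro!: measurable_short_cycle)
  have meas_ev: "Measurable.pred iid (\<lambda>\<omega>. \<omega> {v, w} \<le> 2 * M \<and> ?bad1 \<omega>)" "Measurable.pred iid (\<lambda>\<omega>. \<omega> {w, v} \<le> 2 * M \<and> ?bad2 \<omega>)"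
     "Measurable.pred iid (\<lambda>\<omega>. \<not> ?good \<omega>)"
    using meas_bad by measurable
  have int_ob: "integrable iid (\<lambda>\<omega>. of_bool (R \<omega>) :: real)" if "Measurable.pred iid R" for R :: "(nat set \<Rightarrow> real) \<Rightarrow> bool"
    using that by (intro iid.integrable_const_bound[where B = 1]) (auto simp: of_bool_def)
  have bad_prob: "measure iid {\<omega>. \<omega> {v, w} \<le> 2 * M \<and> ?bad1 \<omega>} \<le> 2 * M * B" "measure iid {\<omega>. \<omega> {w, v} \<le> 2 * M \<and> ?bad2 \<omega>} \<le> 2 * M * B"
  proof -
    have star: "star_upd x {y} \<zeta> \<omega> {x', y'} = \<omega> {x', y'}" if "{x', y'} \<noteq> {x, y}" for x y x' y' \<zeta> \<omega>
      using that by (auto simp: star_upd_def)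
    have "measure iid {\<omega>. \<omega> {v, w} \<le> 2 * M \<and> ?bad1 \<omega>} \<le> 2 * M * measure iid {\<omega>. ?bad1 \<omega>}"
    proof (rule edge_indep[OF vw(3) _ meas_bad(1)])
      fix \<omega> \<zeta>
      show "short_cycle (star_upd v {w} \<zeta> \<omega>) n (2 * M) (Suc k) (insert v W) w v = ?bad1 \<omega>"
        using sub vw by (intro short_cycle_cong star) auto
    qed (use M in auto)
    also have "\<dots> \<le> 2 * M * B"
      unfolding B_def using M sub vw card1 n by (intro mult_left_mono short_cycle_prob) auto
    finally show "measure iid {\<omega>. \<omega> {v, w} \<le> 2 * M \<and> ?bad1 \<omega>} \<le> 2 * M * B" .
    have "measure iid {\<omega>. \<omega> {w, v} \<le> 2 * M \<and> ?bad2 \<omega>} \<le> 2 * M * measure iid {\<omega>. ?bad2 \<omega>}"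
    proof (rule edge_indep[OF vw(3)[symmetric] _ meas_bad(2)])
      fix \<omega> \<zeta>
      show "short_cycle (star_upd w {v} \<zeta> \<omega>) n (2 * M) (Suc k) (insert w W) v w = ?bad2 \<omega>"
        using sub vw by (intro short_cycle_cong star) auto
    qed (use M in auto)
    also have "\<dots> \<le> 2 * M * B"
      unfolding B_def using M sub vw card1 n by (intro mult_left_mono short_cycle_prob) auto
    finally show "measure iid {\<omega>. \<omega> {w, v} \<le> 2 * M \<and> ?bad2 \<omega>} \<le> 2 * M * B" .
  qed
  have step1: "\<bar>(\<integral>\<omega>. \<omega> ?e * of_bool (\<omega> ?e \<le> X \<omega>) \<partial>iid) - (\<integral>\<omega>. \<omega> ?e * of_bool (\<omega> ?e \<le> Y \<omega>) \<partial>iid)\<bar> \<le>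
      (2 / real n ^ 3 + real n ^ 3 * P) / 2 + 8 * M\<^sup>2 * B"
  proof -
    have iX: "integrable iid (\<lambda>\<omega>. \<omega> ?e * of_bool (\<omega> ?e \<le> X \<omega>))" and iY: "integrable iid (\<lambda>\<omega>. \<omega> ?e * of_bool (\<omega> ?e \<le> Y \<omega>))"
      by (rule int_le, measurable)+
    have i1: "integrable iid (\<lambda>\<omega>. ((\<omega> ?e)\<^sup>2 / real n ^ 3 + real n ^ 3 * of_bool (\<not> ?good \<omega>)) / 2)"
      by (intro Bochner_Integration.integrable_divide Bochner_Integration.integrable_add integrable_mult_right iid_moment int_ob meas_ev)
    have i2: "integrable iid (\<lambda>\<omega>. 2 * M * (of_bool (\<omega> {v, w} \<le> 2 * M \<and> ?bad1 \<omega>) + of_bool (\<omega> {w, v} \<le> 2 * M \<and> ?bad2 \<omega>)))"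
      by (intro integrable_mult_right Bochner_Integration.integrable_add int_ob meas_ev)
    have "\<bar>(\<integral>\<omega>. \<omega> ?e * of_bool (\<omega> ?e \<le> X \<omega>) \<partial>iid) - (\<integral>\<omega>. \<omega> ?e * of_bool (\<omega> ?e \<le> Y \<omega>) \<partial>iid)\<bar> \<le>
      (\<integral>\<omega>. \<bar>\<omega> ?e * of_bool (\<omega> ?e \<le> X \<omega>) - \<omega> ?e * of_bool (\<omega> ?e \<le> Y \<omega>)\<bar> \<partial>iid)"
      unfolding Bochner_Integration.integral_diff[OF iX iY, symmetric] by (rule integral_abs_bound)
    also have "\<dots> \<le> (\<integral>\<omega>. ((\<omega> ?e)\<^sup>2 / real n ^ 3 + real n ^ 3 * of_bool (\<not> ?good \<omega>)) / 2 +
      2 * M * (of_bool (\<omega> {v, w} \<le> 2 * M \<and> ?bad1 \<omega>) + of_bool (\<omega> {w, v} \<le> 2 * M \<and> ?bad2 \<omega>)) \<partial>iid)"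
      by (intro integral_mono point integrable_abs Bochner_Integration.integrable_diff iX iY Bochner_Integration.integrable_add i1 i2)
    also have "\<dots> = ((\<integral>\<omega>. (\<omega> ?e)\<^sup>2 \<partial>iid) / real n ^ 3 + real n ^ 3 * (\<integral>\<omega>. of_bool (\<not> ?good \<omega>) \<partial>iid)) / 2 +
      2 * M * ((\<integral>\<omega>. of_bool (\<omega> {v, w} \<le> 2 * M \<and> ?bad1 \<omega>) \<partial>iid) + (\<integral>\<omega>. of_bool (\<omega> {w, v} \<le> 2 * M \<and> ?bad2 \<omega>) \<partial>iid))"
      unfolding Bochner_Integration.integral_add[OF i1 i2] integral_mult_right_zero Bochner_Integration.integral_divide_zero
      using int_ob[OF meas_ev(1)] int_ob[OF meas_ev(2)] int_ob[OF meas_ev(3)] iid_moment(2)[of ?e]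
      by (simp add: Bochner_Integration.integral_add del: short_cycle.simps of_bool_not_iff)
    also have "\<dots> = (2 / real n ^ 3 + real n ^ 3 * measure iid {\<omega>. \<not> ?good \<omega>}) / 2 +
      2 * M * (measure iid {\<omega>. \<omega> {v, w} \<le> 2 * M \<and> ?bad1 \<omega>} + measure iid {\<omega>. \<omega> {w, v} \<le> 2 * M \<and> ?bad2 \<omega>})"
      by (simp only: iid_prob_eq_integral[OF meas_ev(1)] iid_prob_eq_integral[OF meas_ev(2)] iid_prob_eq_integral[OF meas_ev(3)] iid_moment(3))
    also have "\<dots> \<le> (2 / real n ^ 3 + real n ^ 3 * P) / 2 + 2 * M * (2 * M * B + 2 * M * B)"
      unfolding P_def using M n short_edges_prob[OF M, of ?c n]
      by (intro add_mono divide_right_mono mult_left_mono bad_prob) auto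
    also have "2 * M * (2 * M * B + 2 * M * B) = 8 * M\<^sup>2 * B" by (simp add: power2_eq_square)
    finally show ?thesis .
  qed
  have Y_star: "Y (star_upd v {w} \<zeta> \<omega>) = Y \<omega>" for \<zeta> \<omega>
  proof -
    have "a j (star_upd v {w} \<zeta> \<omega>) = a j \<omega>" for j
      unfolding a_def using W vw by (intro samsg_star_other) auto
    moreover have "b j (star_upd v {w} \<zeta> \<omega>) = b j \<omega>" for j
      unfolding b_def using W vw by (intro samsg_cong star_upd_other) auto
    ultimately show ?thesis by (simp add: Y_def)
  qed
  have card: "card (insert w W - {w}) = n - 2" "card (insert v W - {v}) = n - 2"
  proof -
    have "insert w W - {w} = {..<n} - {v, w}" "insert v W - {v} = {..<n} - {v, w}" using vw by (auto simp: W_def)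
    then show "card (insert w W - {w}) = n - 2" "card (insert v W - {v}) = n - 2" using vw by (simp_all add: card_Diff_subset)
  qed
  have ne: "insert w W - {w} \<noteq> {}" "insert v W - {v} \<noteq> {}"
    using card n by (metis card.empty diff_is_0_eq not_le numeral_2_eq_2 Suc_leD le_trans numeral_le_iff semiring_norm(69) le_add2 n3 numeral_3_eq_3 Suc_n_not_le_n)+
  have r: "real (n - 2) = real n - 2" using n by (simp add: of_nat_diff)
  have m3: "integrable iid (\<lambda>\<omega>. a j \<omega> ^ 3)" "integrable iid (\<lambda>\<omega>. b j \<omega> ^ 3)"
    "(\<integral>\<omega>. a j \<omega> ^ 3 \<partial>iid) \<le> 6 / (real n - 2) ^ 3" "(\<integral>\<omega>. b j \<omega> ^ 3 \<partial>iid) \<le> 6 / (real n - 2) ^ 3" for j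
    using samsg_moment[OF finW(2) ne(1), where p = 3 and k = j] samsg_moment[OF finW(1) ne(2), where p = 3 and k = j]
    unfolding a_def b_def card r by (auto simp: fact_numeral)
  define S where "S \<omega> = 16 * (a k \<omega> ^ 3 + a (Suc k) \<omega> ^ 3 + b k \<omega> ^ 3 + b (Suc k) \<omega> ^ 3)" for \<omega>
  have iS: "integrable iid S" unfolding S_def by (intro integrable_mult_right Bochner_Integration.integrable_add m3)
  have eS: "(\<integral>\<omega>. S \<omega> \<partial>iid) \<le> 384 / (real n - 2) ^ 3"
  proof -
    have "(\<integral>\<omega>. S \<omega> \<partial>iid) = 16 * ((\<integral>\<omega>. a k \<omega> ^ 3 \<partial>iid) + (\<integral>\<omega>. a (Suc k) \<omega> ^ 3 \<partial>iid) + (\<integral>\<omega>. b k \<omega> ^ 3 \<partial>iid) + (\<integral>\<omega>. b (Suc k) \<omega> ^ 3 \<partial>iid))"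
      unfolding S_def using m3 by simp
    also have "\<dots> \<le> 16 * (6 / (real n - 2) ^ 3 + 6 / (real n - 2) ^ 3 + 6 / (real n - 2) ^ 3 + 6 / (real n - 2) ^ 3)"
      by (intro mult_left_mono add_mono m3) auto
    finally show ?thesis by simp
  qed
  have YS: "Y \<omega> ^ 3 \<le> S \<omega>" for \<omega>
    unfolding Y_def S_def by (rule edge_max_cube_le[OF ab0(1) ab0(1) ab0(2) ab0(2)])
  have Y2: "(Y \<omega>)\<^sup>2 = edge_sq (a k \<omega>) (a (Suc k) \<omega>) (b k \<omega>) (b (Suc k) \<omega>)" for \<omega>
    by (simp add: Y_def edge_sq_def)
  have iY2: "integrable iid (\<lambda>\<omega>. (Y \<omega>)\<^sup>2)"
  proof (rule Bochner_Integration.integrable_bound)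
    show "integrable iid (\<lambda>\<omega>. 1 + S \<omega>)" using iS by simp
    have le: "(Y \<omega>)\<^sup>2 \<le> 1 + S \<omega>" for \<omega>
      using edge_sq_bound[OF ab0(1) ab0(1) ab0(2) ab0(2), of k \<omega> "Suc k" \<omega> k \<omega> "Suc k" \<omega>] by (simp only: Y2 S_def)
    show "AE \<omega> in iid. norm ((Y \<omega>)\<^sup>2) \<le> norm (1 + S \<omega>)"
    proof (rule AE_I2)
      fix \<omega>
      show "norm ((Y \<omega>)\<^sup>2) \<le> norm (1 + S \<omega>)"
        unfolding real_norm_def abs_of_nonneg[OF zero_le_power2] by (rule order_trans[OF le abs_ge_self])
    qed
  qed measurable
  define \<phi> where "\<phi> \<theta> = (\<integral>\<zeta>. \<zeta> w * of_bool (\<zeta> w \<le> \<theta>) \<partial>(iid :: (nat \<Rightarrow> real) measure))" for \<theta>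
  have iY: "integrable iid (\<lambda>\<omega>. \<omega> ?e * of_bool (\<omega> ?e \<le> Y \<omega>))" by (rule int_le) measurable
  have v: "v \<notin> {w}" using vw by simp
  \<comment> \<open>Only the single edge {v, w} is resampled; by \<open>Y_star\<close> the threshold
    is not affected.\<close>
  have res: "(\<integral>\<omega>. \<omega> ?e * of_bool (\<omega> ?e \<le> Y \<omega>) \<partial>iid) = (\<integral>\<omega>. \<phi> (Y \<omega>) \<partial>iid)" "integrable iid (\<lambda>\<omega>. \<phi> (Y \<omega>))"
    using integrable_resample(2,3)[OF v iY] by (simp_all only: Y_star star_upd_edge[OF v singletonI] \<phi>_def)
  have step2: "\<bar>(\<integral>\<omega>. \<omega> ?e * of_bool (\<omega> ?e \<le> Y \<omega>) \<partial>iid) - (\<integral>\<omega>. (Y \<omega>)\<^sup>2 \<partial>iid) / 2\<bar> \<le> 128 / (real n - 2) ^ 3"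
  proof -
    have i2: "integrable iid (\<lambda>\<omega>. (Y \<omega>)\<^sup>2 / 2)" using iY2 by simp
    have "\<bar>(\<integral>\<omega>. \<omega> ?e * of_bool (\<omega> ?e \<le> Y \<omega>) \<partial>iid) - (\<integral>\<omega>. (Y \<omega>)\<^sup>2 \<partial>iid) / 2\<bar> = \<bar>\<integral>\<omega>. \<phi> (Y \<omega>) - (Y \<omega>)\<^sup>2 / 2 \<partial>iid\<bar>"
      unfolding res(1) Bochner_Integration.integral_diff[OF res(2) i2] by simp
    also have "\<dots> \<le> (\<integral>\<omega>. \<bar>\<phi> (Y \<omega>) - (Y \<omega>)\<^sup>2 / 2\<bar> \<partial>iid)" by (rule integral_abs_bound)
    also have "\<dots> \<le> (\<integral>\<omega>. S \<omega> / 3 \<partial>iid)"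
    proof (rule integral_mono)
      fix \<omega>
      have "\<bar>\<phi> (Y \<omega>) - (Y \<omega>)\<^sup>2 / 2\<bar> \<le> Y \<omega> ^ 3 / 3" unfolding \<phi>_def by (rule truncated_mean[OF Y0])
      also have "\<dots> \<le> S \<omega> / 3" using YS by (intro divide_right_mono) auto
      finally show "\<bar>\<phi> (Y \<omega>) - (Y \<omega>)\<^sup>2 / 2\<bar> \<le> S \<omega> / 3" .
    qed (use res(2) i2 iS in auto)
    also have "\<dots> \<le> (384 / (real n - 2) ^ 3) / 3" using eS by simp
    finally show ?thesis by simp
  qed
  have step3: "(\<integral>\<omega>. (Y \<omega>)\<^sup>2 \<partial>iid) = (\<integral>\<omega>. quadexp edge_sq k n W \<omega> \<partial>iid) / (real n)\<^sup>2"
  proof -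
    have sc: "edge_sq (real n * x1) (real n * x2) (real n * x3) (real n * x4) = (real n)\<^sup>2 * edge_sq x1 x2 x3 x4" for x1 x2 x3 x4
    proof -
      have "max (real n * x1 + real n * x4) (real n * x2 + real n * x3) = real n * max (x1 + x4) (x2 + x3)"
        by (simp add: max_mult_distrib_left distrib_left)
      then show ?thesis by (simp add: edge_sq_def power_mult_distrib)
    qed
    have i: "integrable iid (\<lambda>\<omega>. edge_sq (real n * samsg \<omega> k (insert w W) w) (real n * samsg \<omega> (Suc k) (insert w W) w)
      (real n * samsg \<omega> k (insert v W) v) (real n * samsg \<omega> (Suc k) (insert v W) v))"
      using iY2 unfolding Y2 sc a_def b_def by (intro integrable_mult_right)
    have "(\<integral>\<omega>. quadexp edge_sq k n W \<omega> \<partial>iid) = (\<integral>\<omega>. (real n)\<^sup>2 * (Y \<omega>)\<^sup>2 \<partial>iid)"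
      unfolding quad_resample(2)[OF W(2,1) vw(3)[symmetric] i, symmetric] Y2 sc a_def b_def ..
    then show ?thesis using n by simp
  qed
  show "\<bar>(\<integral>\<omega>. \<omega> ?e * of_bool (?e \<in> decision_cover {..<n} (bp_decision ?E \<omega> k)) \<partial>iid)
       - (\<integral>\<omega>. quadexp edge_sq k n W \<omega> \<partial>iid) / (2 * (real n)\<^sup>2)\<bar> \<le>
      (2 / real n ^ 3 + real n ^ 3 * (real n * real n ^ (k + 3) * exp (- (real n - real (k + 3) - 1) * M))) / 2
      + 8 * M\<^sup>2 * cycle_bound (real (k + 3) * (2 * M)) (real n * (2 * M)) (Suc k) + 128 / (real n - 2) ^ 3"
  proof -
    have "(\<integral>\<omega>. quadexp edge_sq k n W \<omega> \<partial>iid) / (2 * (real n)\<^sup>2) = (\<integral>\<omega>. (Y \<omega>)\<^sup>2 \<partial>iid) / 2"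
      unfolding step3 by simp
    moreover have tri: "\<bar>x - z\<bar> \<le> s + t" if "\<bar>x - y\<bar> \<le> s" "\<bar>y - z\<bar> \<le> t" for x y z s t :: real
      using that by linarith
    ultimately show ?thesis
      unfolding cover using tri[OF step1 step2] unfolding P_def B_def by (simp only: of_nat_add of_nat_numeral)
  qed
qed

section \<open>Error terms as the graph grows\<close>

text \<open>The branching factor 2 (ln n)^2 is unbounded, so the induction must allow an arbitrary
  power of ln n in front: each step trades one factor for two more powers of ln n, and the 1/n of
  the closing edge outweighs them all.\<close>

lemma cycle_bound_tendsto:
  "(\<lambda>n. ln (real n) ^ p * cycle_bound (real c * (2 * ((ln (real n))\<^sup>2 / real n))) (real n * (2 * ((ln (real n))\<^sup>2 / real n))) j) \<longlonglongrightarrow> 0"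
proof (induction j arbitrary: p)
  case (Suc j)
  let ?B = "\<lambda>n. cycle_bound (real c * (2 * ((ln (real n))\<^sup>2 / real n))) (real n * (2 * ((ln (real n))\<^sup>2 / real n))) j"
  have "(\<lambda>n. 2 * real c * (ln (real n) ^ (p + 2) / real n)) \<longlonglongrightarrow> 0" by real_asymp
  from tendsto_add[OF this tendsto_mult_left[OF Suc[of "p + 2"], of 2]]
  have lim: "(\<lambda>n. 2 * real c * (ln (real n) ^ (p + 2) / real n) + 2 * (ln (real n) ^ (p + 2) * ?B n)) \<longlonglongrightarrow> 0" by simp
  show ?case
  proof (rule Lim_transform_eventually[OF lim])
    show "\<forall>\<^sub>F n in sequentially. 2 * real c * (ln (real n) ^ (p + 2) / real n) + 2 * (ln (real n) ^ (p + 2) * ?B n) =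
      ln (real n) ^ p * cycle_bound (real c * (2 * ((ln (real n))\<^sup>2 / real n))) (real n * (2 * ((ln (real n))\<^sup>2 / real n))) (Suc j)"
      using eventually_gt_at_top[of 0]
    proof eventually_elim
      fix n :: nat assume "0 < n"
      have "2 * c * (l ^ (p + 2) / x) + 2 * (l ^ (p + 2) * B) = l ^ p * (c * (2 * (l\<^sup>2 / x)) + x * (2 * (l\<^sup>2 / x)) * B)"
        if "0 < x" for l x c B :: real
        unfolding power_add using that by (simp add: field_simps)
      then show "2 * real c * (ln (real n) ^ (p + 2) / real n) + 2 * (ln (real n) ^ (p + 2) * ?B n) =
        ln (real n) ^ p * cycle_bound (real c * (2 * ((ln (real n))\<^sup>2 / real n))) (real n * (2 * ((ln (real n))\<^sup>2 / real n))) (Suc j)"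
        using \<open>0 < n\<close> by (simp only: cycle_bound.simps of_nat_0_less_iff)
    qed
  qed
qed simp

text \<open>The bound of \<open>edge_cost_estimate\<close> at M = (ln n)^2 / n.\<close>

definition edge_error :: "nat \<Rightarrow> nat \<Rightarrow> real" where
  "edge_error k n = (2 / real n ^ 3 + real n ^ 3 * (real n * real n ^ (k + 3) * exp (- (real n - real (k + 3) - 1) * ((ln (real n))\<^sup>2 / real n)))) / 2
      + 8 * ((ln (real n))\<^sup>2 / real n)\<^sup>2 * cycle_bound (real (k + 3) * (2 * ((ln (real n))\<^sup>2 / real n))) (real n * (2 * ((ln (real n))\<^sup>2 / real n))) (Suc k)
      + 128 / (real n - 2) ^ 3"

text \<open>The error per edge must be o(1/n^2), as there are about n^2/2 edges. The exponential is
  of order exp (-(ln n)^2), which beats the power n^(k+9).\<close>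

lemma edge_error_tendsto: "(\<lambda>n. (real n)\<^sup>2 * edge_error k n) \<longlonglongrightarrow> 0"
proof -
  have 1: "(\<lambda>n. 1 / real n) \<longlonglongrightarrow> 0" by real_asymp
  have 2: "(\<lambda>n. real n ^ (k + 9) * exp (- (real n - real (k + 3) - 1) * ((ln (real n))\<^sup>2 / real n)) / 2) \<longlonglongrightarrow> 0"
    by real_asymp
  have 3: "(\<lambda>n. 8 * (ln (real n) ^ 4 * cycle_bound (real (k + 3) * (2 * ((ln (real n))\<^sup>2 / real n))) (real n * (2 * ((ln (real n))\<^sup>2 / real n))) (Suc k))) \<longlonglongrightarrow> 0"
    using tendsto_mult_left[OF cycle_bound_tendsto[of 4 "k + 3" "Suc k"], of 8] by simp
  have 4: "(\<lambda>n. 128 * (real n)\<^sup>2 / (real n - 2) ^ 3) \<longlonglongrightarrow> 0" by real_asymp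
  have lim: "(\<lambda>n. (1 / real n + real n ^ (k + 9) * exp (- (real n - real (k + 3) - 1) * ((ln (real n))\<^sup>2 / real n)) / 2) +
     8 * (ln (real n) ^ 4 * cycle_bound (real (k + 3) * (2 * ((ln (real n))\<^sup>2 / real n))) (real n * (2 * ((ln (real n))\<^sup>2 / real n))) (Suc k)) +
     128 * (real n)\<^sup>2 / (real n - 2) ^ 3) \<longlonglongrightarrow> 0"
    using tendsto_add[OF tendsto_add[OF tendsto_add[OF 1 2] 3] 4] by simp
  show ?thesis
  proof (rule Lim_transform_eventually[OF lim])
    show "\<forall>\<^sub>F n in sequentially. (1 / real n + real n ^ (k + 9) * exp (- (real n - real (k + 3) - 1) * ((ln (real n))\<^sup>2 / real n)) / 2) +
     8 * (ln (real n) ^ 4 * cycle_bound (real (k + 3) * (2 * ((ln (real n))\<^sup>2 / real n))) (real n * (2 * ((ln (real n))\<^sup>2 / real n))) (Suc k)) +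
     128 * (real n)\<^sup>2 / (real n - 2) ^ 3 = (real n)\<^sup>2 * edge_error k n"
      using eventually_gt_at_top[of 0]
    proof eventually_elim
      fix n :: nat assume "0 < n"
      have alg: "(1 / x + x ^ (k + 9) * e / 2) + 8 * (l ^ 4 * B) + 128 * x\<^sup>2 / y =
        x\<^sup>2 * ((2 / x ^ 3 + x ^ 3 * (x * x ^ (k + 3) * e)) / 2 + 8 * (l\<^sup>2 / x)\<^sup>2 * B + 128 / y)" if "0 < x" for x e l B y :: real
      proof -
        have "x\<^sup>2 * (2 / x ^ 3) / 2 = 1 / x" using that by (simp add: power2_eq_square power3_eq_cube)
        moreover have "x\<^sup>2 * (x ^ 3 * (x * x ^ (k + 3) * e)) / 2 = x ^ (k + 9) * e / 2"
        proof -
          \<comment> \<open>The exponent collects 2 from the number of edges, 3 from the weight n^3,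
            and 1 + (k + 3) from the union bound.\<close>
          have "x ^ (k + 9) = x\<^sup>2 * (x ^ 3 * (x * x ^ (k + 3)))"
            by (simp only: power_add[symmetric] power_Suc[symmetric]) (simp add: add.commute)
          then show ?thesis by simp
        qed
        moreover have "x\<^sup>2 * (8 * (l\<^sup>2 / x)\<^sup>2 * B) = 8 * (l ^ 4 * B)"
          using that by (simp add: power_divide power2_eq_square eval_nat_numeral)
        moreover have "x\<^sup>2 * ((a + b) / 2 + c + d) = x\<^sup>2 * a / 2 + x\<^sup>2 * b / 2 + x\<^sup>2 * c + x\<^sup>2 * d" for a b c d
          by (simp add: algebra_simps add_divide_distrib)
        ultimately show ?thesis by (simp only: times_divide_eq_right mult.commute[of "x\<^sup>2" 128])
      qed
      show "(1 / real n + real n ^ (k + 9) * exp (- (real n - real (k + 3) - 1) * ((ln (real n))\<^sup>2 / real n)) / 2) +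
     8 * (ln (real n) ^ 4 * cycle_bound (real (k + 3) * (2 * ((ln (real n))\<^sup>2 / real n))) (real n * (2 * ((ln (real n))\<^sup>2 / real n))) (Suc k)) +
     128 * (real n)\<^sup>2 / (real n - 2) ^ 3 = (real n)\<^sup>2 * edge_error k n"
        unfolding edge_error_def by (rule alg) (use \<open>0 < n\<close> in simp)
    qed
  qed
qed

section \<open>Summation over the edges\<close>

abbreviation (input) bp_cover :: "nat \<Rightarrow> nat \<Rightarrow> (nat set \<Rightarrow> real) \<Rightarrow> nat set set" where
  "bp_cover k n \<omega> \<equiv> decision_cover {..<n} (bp_decision (complete_graph_edges n) \<omega> k)"

lemma finite_complete_graph_edges: "finite (complete_graph_edges n)"
  unfolding complete_graph_edges_def by (rule finite_subset[of _ "Pow {..<n}"]) auto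

lemma card_complete_graph_edges: "real (card (complete_graph_edges n)) = real n * (real n - 1) / 2"
proof -
  have "card (complete_graph_edges n) = n choose 2"
    unfolding complete_graph_edges_def using n_subsets[of "{..<n}" 2] by simp
  then have "2 * card (complete_graph_edges n) = n * (n - 1)"
  proof -
    have "even (n * (n - 1))" by (cases n) auto
    then have "2 * (n * (n - 1) div 2) = n * (n - 1)" by (rule dvd_mult_div_cancel)
    with \<open>card (complete_graph_edges n) = n choose 2\<close> show ?thesis by (simp only: choose_two)
  qed
  then have "2 * real (card (complete_graph_edges n)) = real n * real (n - 1)"
    by (metis of_nat_mult of_nat_numeral)
  then show ?thesis by (cases n) (auto simp: algebra_simps)
qed

lemma complete_graph_edgeE:
  assumes "e \<in> complete_graph_edges n"
  obtains v w where "e = {v, w}" "v < n" "w < n" "v \<noteq> w"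
proof -
  obtain v w where "e = {v, w}" "v \<noteq> w" using assms by (auto simp: complete_graph_edges_def card_2_iff)
  then show ?thesis using assms that by (auto simp: complete_graph_edges_def)
qed

lemma cover_cost_eq:
  "(\<Sum>e\<in>bp_cover k n \<omega>. \<omega> e) = (\<Sum>e\<in>complete_graph_edges n. \<omega> e * of_bool (e \<in> bp_cover k n \<omega>))"
  by (rule sum.mono_neutral_cong_left)
     (use cover_subset[of n \<omega> k] finite_complete_graph_edges[of n] in auto)

lemma cover_cost_integrable:
  assumes "k + 4 \<le> n"
  shows "integrable iid (\<lambda>\<omega>. \<Sum>e\<in>bp_cover k n \<omega>. \<omega> e)"
  unfolding cover_cost_eq
proof (rule Bochner_Integration.integrable_sum)
  fix e assume "e \<in> complete_graph_edges n"
  then obtain v w where "e = {v, w}" "v < n" "w < n" "v \<noteq> w" by (rule complete_graph_edgeE)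
  then show "integrable iid (\<lambda>\<omega>. \<omega> e * of_bool (e \<in> bp_cover k n \<omega>))"
    using edge_cost_estimate(1)[OF assms, of v w 0] by simp
qed

text \<open>There are n (n - 1) / 2 edges, each contributing about \<open>\<Lambda>\<close> / (2
  n^2), in total \<open>\<Lambda>\<close> / 4 - \<open>\<Lambda>\<close> / (4 n). Uniformity over
  vertex sets is used here: every edge has its own set {..<n} - {v, w}.\<close>

lemma cover_cost_limit:
  assumes \<Lambda>: "conv1 (quadexp edge_sq k) \<Lambda>"
  shows "(\<lambda>n. \<integral>\<omega>. (\<Sum>e\<in>bp_cover k n \<omega>. \<omega> e) \<partial>iid) \<longlonglongrightarrow> \<Lambda> / 4"
proof (rule LIM_zero_cancel, rule tendstoI)
  fix \<epsilon> :: real assume "0 < \<epsilon>"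
  define q where "q n V = (\<integral>\<omega>. quadexp edge_sq k n V \<omega> \<partial>iid)" for n V
  have "\<forall>\<^sub>F x in nearly_full (0 + 2). dist (case x of (n, V) \<Rightarrow> q n V) \<Lambda> < \<epsilon>"
    unfolding q_def by (rule tendstoD[OF conv1_expectation[OF \<Lambda>] \<open>0 < \<epsilon>\<close>])
  from eventually_nearly_full_remove[OF this]
  obtain n0 where n0': "\<forall>n V. n0 \<le> n \<longrightarrow> finite V \<longrightarrow> card V \<le> n \<longrightarrow> n \<le> card V + 0 \<longrightarrow>
      (\<forall>u\<in>V. \<forall>u'\<in>V. u \<noteq> u' \<longrightarrow> dist (q n (V - {u, u'})) \<Lambda> < \<epsilon>)"
    unfolding eventually_nearly_full split by blast
  have n0: "\<bar>q n ({..<n} - {u, u'}) - \<Lambda>\<bar> < \<epsilon>" if "n0 \<le> n" "u < n" "u' < n" "u \<noteq> u'" for n u u'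
    using n0'[rule_format, of n "{..<n}" u u'] that by (simp add: dist_real_def)
  have "(\<lambda>n. \<bar>\<Lambda>\<bar> / (4 * real n)) \<longlonglongrightarrow> 0" by real_asymp
  from tendsto_add[OF edge_error_tendsto[of k] this]
  have "(\<lambda>n. (real n)\<^sup>2 * edge_error k n + \<bar>\<Lambda>\<bar> / (4 * real n)) \<longlonglongrightarrow> 0" by simp
  from order_tendstoD(2)[OF this, of "\<epsilon> / 2"] \<open>0 < \<epsilon>\<close>
  have "\<forall>\<^sub>F n in sequentially. (real n)\<^sup>2 * edge_error k n + \<bar>\<Lambda>\<bar> / (4 * real n) < \<epsilon> / 2" by simp
  then show "\<forall>\<^sub>F n in sequentially. dist ((\<integral>\<omega>. (\<Sum>e\<in>bp_cover k n \<omega>. \<omega> e) \<partial>iid) - \<Lambda> / 4) 0 < \<epsilon>"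
    using eventually_ge_at_top[of "n0 + k + 4"]
  proof eventually_elim
    fix n assume small: "(real n)\<^sup>2 * edge_error k n + \<bar>\<Lambda>\<bar> / (4 * real n) < \<epsilon> / 2" and n: "n0 + k + 4 \<le> n"
    define E where "E = complete_graph_edges n"
    define c where "c e = (\<integral>\<omega>. \<omega> e * of_bool (e \<in> bp_cover k n \<omega>) \<partial>iid)" for e
    have n': "k + 4 \<le> n" "0 < n" "1 \<le> real n" using n by auto
    have int: "integrable iid (\<lambda>\<omega>. \<omega> e * of_bool (e \<in> bp_cover k n \<omega>))"
      and est: "\<bar>c e - \<Lambda> / (2 * (real n)\<^sup>2)\<bar> \<le> edge_error k n + \<epsilon> / (2 * (real n)\<^sup>2)" if "e \<in> E" for e
    proof -
      have "e \<in> complete_graph_edges n" using that by (simp add: E_def)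
      then obtain v w where vw: "e = {v, w}" "v < n" "w < n" "v \<noteq> w" by (rule complete_graph_edgeE)
      have M: "0 \<le> (ln (real n))\<^sup>2 / real n" by simp
      show "integrable iid (\<lambda>\<omega>. \<omega> e * of_bool (e \<in> bp_cover k n \<omega>))"
        unfolding vw(1) by (rule edge_cost_estimate(1)[OF n'(1) vw(2-4) M])
      have "\<bar>c e - q n ({..<n} - {v, w}) / (2 * (real n)\<^sup>2)\<bar> \<le> edge_error k n"
        unfolding c_def q_def vw(1) edge_error_def by (rule edge_cost_estimate(2)[OF n'(1) vw(2-4) M])
      moreover have "\<bar>q n ({..<n} - {v, w}) / (2 * (real n)\<^sup>2) - \<Lambda> / (2 * (real n)\<^sup>2)\<bar> \<le> \<epsilon> / (2 * (real n)\<^sup>2)"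
      proof -
        have "\<bar>q n ({..<n} - {v, w}) / (2 * (real n)\<^sup>2) - \<Lambda> / (2 * (real n)\<^sup>2)\<bar> = \<bar>q n ({..<n} - {v, w}) - \<Lambda>\<bar> / (2 * (real n)\<^sup>2)"
          by (simp flip: diff_divide_distrib)
        also have "\<dots> \<le> \<epsilon> / (2 * (real n)\<^sup>2)" using n0[of n v w] n vw by (intro divide_right_mono) auto
        finally show ?thesis .
      qed
      ultimately show "\<bar>c e - \<Lambda> / (2 * (real n)\<^sup>2)\<bar> \<le> edge_error k n + \<epsilon> / (2 * (real n)\<^sup>2)"
        by linarith
    qed
    \<comment> \<open>Nonnegativity of the error bound is read off from the estimate at one
      edge.\<close>
    have err0: "0 \<le> edge_error k n + \<epsilon> / (2 * (real n)\<^sup>2)"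
    proof -
      have "{0, 1} \<in> E" using n by (auto simp: E_def complete_graph_edges_def)
      from est[OF this] show ?thesis by linarith
    qed
    have fin: "finite E" by (simp add: E_def finite_complete_graph_edges)
    have cardE: "real (card E) = real n * (real n - 1) / 2" by (simp add: E_def card_complete_graph_edges)
    have "(\<integral>\<omega>. (\<Sum>e\<in>bp_cover k n \<omega>. \<omega> e) \<partial>iid) = (\<Sum>e\<in>E. c e)"
      unfolding cover_cost_eq c_def E_def using int[unfolded E_def] by (simp add: Bochner_Integration.integral_sum)
    also have "\<dots> - \<Lambda> / 4 = (\<Sum>e\<in>E. c e - \<Lambda> / (2 * (real n)\<^sup>2)) - \<Lambda> / (4 * real n)"
    proof -
      have "card E * (\<Lambda> / (2 * (real n)\<^sup>2)) = \<Lambda> / 4 - \<Lambda> / (4 * real n)"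
        unfolding cardE using n' by (simp add: power2_eq_square field_simps)
      then show ?thesis by (simp add: sum_subtractf)
    qed
    finally have "\<bar>(\<integral>\<omega>. (\<Sum>e\<in>bp_cover k n \<omega>. \<omega> e) \<partial>iid) - \<Lambda> / 4\<bar> \<le> \<bar>\<Sum>e\<in>E. c e - \<Lambda> / (2 * (real n)\<^sup>2)\<bar> + \<bar>\<Lambda>\<bar> / (4 * real n)"
      using abs_triangle_ineq4[of "\<Sum>e\<in>E. c e - \<Lambda> / (2 * (real n)\<^sup>2)" "\<Lambda> / (4 * real n)"] by simp
    also have "\<bar>\<Sum>e\<in>E. c e - \<Lambda> / (2 * (real n)\<^sup>2)\<bar> \<le> (\<Sum>e\<in>E. edge_error k n + \<epsilon> / (2 * (real n)\<^sup>2))"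
      by (intro order_trans[OF sum_abs] sum_mono est)
    also have "\<dots> = card E * (edge_error k n + \<epsilon> / (2 * (real n)\<^sup>2))" by simp
    also have "\<dots> \<le> (real n)\<^sup>2 * (edge_error k n + \<epsilon> / (2 * (real n)\<^sup>2))"
      unfolding cardE using n' by (intro mult_right_mono err0) (simp add: power2_eq_square field_simps)
    also have "\<dots> = (real n)\<^sup>2 * edge_error k n + \<epsilon> / 2" using n' by (simp add: field_simps)
    finally show "dist ((\<integral>\<omega>. (\<Sum>e\<in>bp_cover k n \<omega>. \<omega> e) \<partial>iid) - \<Lambda> / 4) 0 < \<epsilon>"
      using small by (simp add: dist_real_def)
  qed
qed

section \<open>Transfer to an arbitrary probability space\<close>

lemma bp_message_edge_cong:
  assumes "\<And>e. e \<in> E \<Longrightarrow> \<omega> e = \<omega>' e"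
  shows "bp_message E \<omega> k = bp_message E \<omega>' k"
proof (induction k)
  case (Suc k)
  have "(\<lambda>u. max (\<omega> {v, u} - bp_message E \<omega>' k v u) 0) ` (neighbors E v - {w}) = (\<lambda>u. max (\<omega>' {v, u} - bp_message E \<omega>' k v u) 0) ` (neighbors E v - {w})" for v w
    using assms by (intro image_cong) (auto simp: neighbors_def)
  then show ?case using Suc by (simp add: fun_eq_iff)
qed simp

lemma bp_decision_edge_cong:
  assumes "\<And>e. e \<in> E \<Longrightarrow> \<omega> e = \<omega>' e"
  shows "bp_decision E \<omega> k = bp_decision E \<omega>' k"
proof
  fix v
  have cong: "is_arg_min f P w = is_arg_min g P w" if "\<And>u. P u \<Longrightarrow> f u = g u" for f g :: "'a \<Rightarrow> real" and P w
    unfolding is_arg_min_def using that by metis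
  have msg: "bp_message E \<omega> k = bp_message E \<omega>' k" using assms by (rule bp_message_edge_cong)
  have "\<omega> {v, u} = \<omega>' {v, u}" if "u \<in> neighbors E v" for u
    using that assms by (simp add: neighbors_def)
  then show "bp_decision E \<omega> k v = bp_decision E \<omega>' k v"
    unfolding bp_decision_def msg by (intro Collect_cong cong) simp
qed

lemma cover_cost_edge_cong:
  assumes "\<And>e. e \<in> complete_graph_edges n \<Longrightarrow> \<omega> e = \<omega>' e"
  shows "(\<Sum>e\<in>bp_cover k n \<omega>. \<omega> e) = (\<Sum>e\<in>bp_cover k n \<omega>'. \<omega>' e)"
proof -
  have "bp_decision (complete_graph_edges n) \<omega> k = bp_decision (complete_graph_edges n) \<omega>' k"
    using assms by (rule bp_decision_edge_cong)
  then show ?thesis using cover_subset[of n \<omega>' k] assms by (intro sum.cong) auto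
qed

text \<open>As g depends only on the finitely many coordinates in E, both expectations are integrals
  of one function on the finite product over E, where both laws are the product of exponential
  distributions.\<close>

lemma (in prob_space) expectation_eq_iid:
  fixes g :: "('i \<Rightarrow> real) \<Rightarrow> real" and X :: "'i \<Rightarrow> 'a \<Rightarrow> real"
  assumes "finite E" "E \<noteq> {}" "indep_vars (\<lambda>_. borel) X E"
    and D: "\<And>e. e \<in> E \<Longrightarrow> distributed M lborel (X e) (exponential_density 1)"
    and [measurable]: "g \<in> borel_measurable iid"
    and cong: "\<And>\<omega> \<omega>'. (\<And>e. e \<in> E \<Longrightarrow> \<omega> e = \<omega>' e) \<Longrightarrow> g \<omega> = g \<omega>'"
  shows "expectation (\<lambda>x. g (\<lambda>e. X e x)) = (\<integral>\<omega>. g \<omega> \<partial>iid)"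
proof -
  \<comment> \<open>The value 0 off E is arbitrary, by \<open>cong\<close>; it makes G a measurable
    function on the product over E.\<close>
  define G where "G y = g (\<lambda>e. if e \<in> E then y e else 0)" for y
  have "(\<lambda>y e. if e \<in> E then y e else 0) \<in> measurable (PiM E (\<lambda>_. borel)) (PiM UNIV (\<lambda>_. borel :: real measure))"
  proof (rule measurable_PiM_single')
    fix e
    show "(\<lambda>y. if e \<in> E then y e else 0) \<in> borel_measurable (PiM E (\<lambda>_. borel))" by (cases "e \<in> E") simp_all
  qed simp
  then have "(\<lambda>y e. if e \<in> E then y e else 0) \<in> measurable (PiM E (\<lambda>_. borel)) (iid :: ('i \<Rightarrow> real) measure)"
    by (simp add: measurable_cong_sets[OF refl sets_iid])
  then have G: "G \<in> borel_measurable (PiM E (\<lambda>_. borel))"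
    unfolding G_def[abs_def] by measurable
  have G': "G \<in> borel_measurable (PiM E (\<lambda>_. expo))"
    using G by (simp cong: measurable_cong_sets sets_PiM_cong)
  have rv: "X e \<in> borel_measurable M" if "e \<in> E" for e using distributed_measurable[OF D[OF that]] by simp
  have mX: "(\<lambda>x. \<lambda>e\<in>E. X e x) \<in> measurable M (PiM E (\<lambda>_. borel))"
    using rv by (intro measurable_restrict) auto
  have dist: "distr M borel (X e) = expo" if "e \<in> E" for e
    using distributed_distr_eq_density[OF D[OF that]] by (simp cong: distr_cong)
  have "expectation (\<lambda>x. g (\<lambda>e. X e x)) = expectation (\<lambda>x. G (\<lambda>e\<in>E. X e x))"
    unfolding G_def by (intro Bochner_Integration.integral_cong refl cong) simp
  also have "\<dots> = integral\<^sup>L (distr M (PiM E (\<lambda>_. borel)) (\<lambda>x. \<lambda>e\<in>E. X e x)) G"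
    by (rule integral_distr[OF mX G, symmetric])
  also have "distr M (PiM E (\<lambda>_. borel)) (\<lambda>x. \<lambda>e\<in>E. X e x) = PiM E (\<lambda>e. distr M borel (X e))"
    using indep_vars_iff_distr_eq_PiM'[OF assms(2), of X "\<lambda>_. borel"] rv assms(3) by simp
  also have "\<dots> = PiM E (\<lambda>_. expo)" by (intro PiM_cong refl dist)
  also have "\<dots> = distr iid (PiM E (\<lambda>_. expo)) (\<lambda>\<omega>. restrict \<omega> E)"
    unfolding iid_def using assms(1) by (intro iid_factors.distr_PiM_restrict_finite[symmetric]) auto
  also have "integral\<^sup>L \<dots> G = (\<integral>\<omega>. G (restrict \<omega> E) \<partial>iid)"
    by (rule integral_distr[OF _ G']) (simp add: iid_def measurable_restrict_subset)
  also have "\<dots> = (\<integral>\<omega>. g \<omega> \<partial>iid)"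
    unfolding G_def by (intro Bochner_Integration.integral_cong refl cong) simp
  finally show ?thesis .
qed

theorem theorem2:
  fixes M :: "nat \<Rightarrow> 'a measure"
    and \<xi> :: "nat \<Rightarrow> nat set \<Rightarrow> 'a \<Rightarrow> real"
  assumes "\<And>n. prob_space (M n)"
    and "\<And>n. prob_space.indep_vars (M n) (\<lambda>_. borel) (\<xi> n) (complete_graph_edges n)"
    and "\<And>n e. e \<in> complete_graph_edges n \<Longrightarrow>
           distributed (M n) lborel (\<xi> n e) (exponential_density 1)"
  shows "\<exists>L :: nat \<Rightarrow> real.
    (\<forall>k. (\<lambda>n. prob_space.expectation (M n) (\<lambda>\<omega>.
            \<Sum>e\<in>decision_cover {..<n}
                 (bp_decision (complete_graph_edges n) (\<lambda>e. \<xi> n e \<omega>) k). \<xi> n e \<omega>))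
          \<longlonglongrightarrow> L k) \<and>
    L \<longlonglongrightarrow> Lambert_W 1 + (Lambert_W 1)\<^sup>2 / 2"
proof -
  obtain \<Lambda> where \<Lambda>: "\<And>k. conv1 (quadexp edge_sq k) (\<Lambda> k)" using edge_sq_conv by metis
  show ?thesis
  proof (intro exI conjI allI)
    show "(\<lambda>k. \<Lambda> k / 4) \<longlonglongrightarrow> Lambert_W 1 + (Lambert_W 1)\<^sup>2 / 2" by (rule edge_sq_limit[OF \<Lambda>])
    fix k
    show "(\<lambda>n. prob_space.expectation (M n) (\<lambda>\<omega>.
            \<Sum>e\<in>decision_cover {..<n}
                 (bp_decision (complete_graph_edges n) (\<lambda>e. \<xi> n e \<omega>) k). \<xi> n e \<omega>))
          \<longlonglongrightarrow> \<Lambda> k / 4"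
    proof (rule Lim_transform_eventually[OF cover_cost_limit[OF \<Lambda>]])
      show "\<forall>\<^sub>F n in sequentially. (\<integral>\<omega>. (\<Sum>e\<in>bp_cover k n \<omega>. \<omega> e) \<partial>iid) = prob_space.expectation (M n) (\<lambda>\<omega>.
            \<Sum>e\<in>decision_cover {..<n}
                 (bp_decision (complete_graph_edges n) (\<lambda>e. \<xi> n e \<omega>) k). \<xi> n e \<omega>)"
        \<comment> \<open>From k + 4 vertices on, integrability, and with it measurability, of the
          cover cost is available; smaller n do not affect the limit.\<close>
        using eventually_ge_at_top[of "k + 4"]
      proof eventually_elim
        fix n assume n: "k + 4 \<le> n"
        have "{0, 1} \<in> complete_graph_edges n" using n by (auto simp: complete_graph_edges_def)
        then have ne: "complete_graph_edges n \<noteq> {}" by blast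
        show "(\<integral>\<omega>. (\<Sum>e\<in>bp_cover k n \<omega>. \<omega> e) \<partial>iid) = prob_space.expectation (M n) (\<lambda>\<omega>.
            \<Sum>e\<in>decision_cover {..<n}
                 (bp_decision (complete_graph_edges n) (\<lambda>e. \<xi> n e \<omega>) k). \<xi> n e \<omega>)"
          using prob_space.expectation_eq_iid[OF assms(1) finite_complete_graph_edges ne assms(2) assms(3)
              borel_measurable_integrable[OF cover_cost_integrable[OF n]] cover_cost_edge_cong] by simp
      qed
    qed
  qed
qed

end
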